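(* Let $w_1, \dots, w_{n-1} \in \mathbb{C}^2$ be independent random vectors such that $$w_j = \begin{bmatrix} \alpha_j \\ \beta_j \end{bmatrix}, \qquad \alpha_j \sim \mathcal{N}_{\mathbb{C}}(0,1), \qquad \beta_j^2 \sim \chi^2_{\mathbb{C}}(n-j),$$ and let $$H = P_1 \cdots P_{n-1} D \in \mathbb{C}^{n \times n}$$ be the unitary (upper) Hessenberg matrix such that $$P_j = I_n - \frac{2}{\|v_j\|_2^2} v_j v_j^*, \qquad D = -\operatorname{diag}(\mathrm{e}^{\mathrm{i}\theta_1}, \dots, \mathrm{e}^{\mathrm{i}\theta_n}), \qquad v_j = \begin{bmatrix} 0_{j-1} \\ \alpha_j + \mathrm{e}^{\mathrm{i}\theta_j} \|w_j\|_2 \\ \beta_j \\ 0_{n-j-1} \end{bmatrix},$$ where $\theta_j = \operatorname{Arg} \alpha_j$ for $j = 1, \dots, n-1$ and $\theta_n$ is uniformly distributed on $(-\pi, \pi]$. Then the joint eigenvalue distribution of $H$ is that of Haar-distributed unitary matrices of $U(n)$.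
   Context: $U(n) = \{U \in \mathbb{C}^{n\times n} : U^*U = I_n\}$ is the unitary group, where $^*$ denotes the conjugate transpose and $I_n$ the identity matrix of order $n$; a Haar-distributed matrix of $U(n)$ is a random matrix whose law is the unique normalized (left and right) Haar measure of $U(n)$. A matrix $H$ is upper Hessenberg if $h_{ij} = 0$ whenever $i > j+1$. $\operatorname{Arg}$ denotes the principal value of the argument, with values in $(-\pi,\pi]$. $0_k$ is the zero column vector of length $k$. $\mathcal{N}_{\mathbb{R}}(\mu,\sigma^2)$ is the real Gaussian distribution with mean $\mu$ and variance $\sigma^2$. The complex Gaussian $\mathcal{N}_{\mathbb{C}}(\mu,\sigma^2)$ is the law of $\gamma + \mathrm{i}\delta$ with $\gamma \sim \mathcal{N}_{\mathbb{R}}(\operatorname{Re}\mu, \sigma^2/2)$ and $\delta \sim \mathcal{N}_{\mathbb{R}}(\operatorname{Im}\mu, \sigma^2/2)$ independent. $\chi^2_{\mathbb{C}}(k)$ is the law of $\sum_{i=1}^k |\delta_i|^2$ with $\delta_1, \dots, \delta_k$ independent and distributed as $\mathcal{N}_{\mathbb{C}}(0,1)$.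
   Formalization: Independence left unstated is assumed: α_j and β_j are independent for each j, and θ_n is independent of (w_1,…,w_{n−1}); without this the claim fails, e.g. n = 2 with β_1 = |α_1| forces |tr H| ≤ √2. *)

theory Defs
  imports "HOL-Probability.Probability" "Jordan_Normal_Form.Schur_Decomposition"
begin

unbundle no vec_syntax
hide_const (open) Finite_Cartesian_Product.vec Finite_Cartesian_Product.mat Finite_Cartesian_Product.row
  Determinants.det

section \<open>Gaussian and chi-square distributions\<close>

text \<open>The second argument is the variance; \<^const>\<open>normal_density\<close> takes the standard deviation.\<close>

definition real_normal :: "real \<Rightarrow> real \<Rightarrow> real measure" where
  "real_normal \<mu> v = density lborel (normal_density \<mu> (sqrt v))"

definition complex_normal :: "complex \<Rightarrow> real \<Rightarrow> complex measure" where
  "complex_normal \<mu> v =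
     distr (real_normal (Re \<mu>) (v / 2) \<Otimes>\<^sub>M real_normal (Im \<mu>) (v / 2)) borel
       (\<lambda>(x, y). Complex x y)"

definition chi2_complex :: "nat \<Rightarrow> real measure" where
  "chi2_complex k =
     distr (Pi\<^sub>M {1..k} (\<lambda>_. complex_normal 0 1)) borel (\<lambda>\<delta>. \<Sum>i = 1..k. (cmod (\<delta> i))\<^sup>2)"

section \<open>The unitary group and its Haar measure\<close>

definition unitary_group :: "nat \<Rightarrow> complex mat set" where
  "unitary_group n = {U \<in> carrier_mat n n. mat_adjoint U * U = 1\<^sub>m n}"

text \<open>
  The Borel sigma-algebra of \<open>U(n)\<close>, as a subspace of \<open>\<complex>\<^sup>n\<^sup>\<times>\<^sup>n\<close>: the sigma-algebra
  generated by the matrix entries.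
\<close>

definition unitary_borel :: "nat \<Rightarrow> complex mat measure" where
  "unitary_borel n =
     vimage_algebra (unitary_group n) (\<lambda>A. \<lambda>ij \<in> {..<n} \<times> {..<n}. A $$ ij)
       (Pi\<^sub>M ({..<n} \<times> {..<n}) (\<lambda>_. borel))"

definition haar_measure :: "nat \<Rightarrow> complex mat measure \<Rightarrow> bool" where
  "haar_measure n \<nu> \<longleftrightarrow>
     prob_space \<nu> \<and> sets \<nu> = sets (unitary_borel n) \<and>
     (\<forall>V \<in> unitary_group n.
        distr \<nu> \<nu> (\<lambda>X. V * X) = \<nu> \<and> distr \<nu> \<nu> (\<lambda>X. X * V) = \<nu>)"

definition haar_distributed :: "nat \<Rightarrow> 'a measure \<Rightarrow> ('a \<Rightarrow> complex mat) \<Rightarrow> bool" where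
  "haar_distributed n M U \<longleftrightarrow>
     U \<in> measurable M (unitary_borel n) \<and> haar_measure n (distr M (unitary_borel n) U)"

section \<open>Joint eigenvalue distribution\<close>

definition eigenvalues :: "complex mat \<Rightarrow> complex multiset" where
  "eigenvalues A = proots (char_poly A)"

text \<open>
  Unordered \<open>n\<close>-tuples of complex numbers, i.e. \<open>\<complex>\<^sup>n\<close> modulo permutation of the
  coordinates, with the quotient sigma-algebra: its measurable sets correspond to the
  permutation-invariant Borel subsets of \<open>\<complex>\<^sup>n\<close>.
\<close>

definition unordered_of :: "nat \<Rightarrow> (nat \<Rightarrow> complex) \<Rightarrow> complex multiset" where
  "unordered_of n x = image_mset x (mset_set {1..n})"

definition unordered_tuples :: "nat \<Rightarrow> complex multiset measure" where
  "unordered_tuples n =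
     sigma {m. size m = n}
       {A. A \<subseteq> {m. size m = n} \<and>
           unordered_of n -` A \<inter> space (Pi\<^sub>M {1..n} (\<lambda>_. borel :: complex measure))
             \<in> sets (Pi\<^sub>M {1..n} (\<lambda>_. borel :: complex measure))}"

lemma space_unordered_tuples: "space (unordered_tuples n) = {m. size m = n}"
  unfolding unordered_tuples_def by (rule space_measure_of) auto

lemma sets_unordered_tuples:
  "sets (unordered_tuples n) =
     {A. A \<subseteq> {m. size m = n} \<and>
         unordered_of n -` A \<inter> space (Pi\<^sub>M {1..n} (\<lambda>_. borel :: complex measure))
           \<in> sets (Pi\<^sub>M {1..n} (\<lambda>_. borel :: complex measure))}"
proof -
  let ?P = "Pi\<^sub>M {1..n} (\<lambda>_. borel :: complex measure)"
  let ?S = "{A. A \<subseteq> {m. size m = n} \<and> unordered_of n -` A \<inter> space ?P \<in> sets ?P}"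
  have "sigma_algebra {m. size m = n} ?S"
    unfolding sigma_algebra_iff2
  proof (intro conjI ballI allI impI)
    fix s assume s: "s \<in> ?S"
    have "unordered_of n -` ({m. size m = n} - s) \<inter> space ?P
        = space ?P - (unordered_of n -` s \<inter> space ?P)"
      by (auto simp: unordered_of_def)
    then show "{m. size m = n} - s \<in> ?S"
      using s by auto
  next
    fix A :: "nat \<Rightarrow> complex multiset set" assume A: "range A \<subseteq> ?S"
    have "unordered_of n -` (\<Union>i. A i) \<inter> space ?P = (\<Union>i. unordered_of n -` A i \<inter> space ?P)"
      by auto
    moreover have "(\<Union>i. unordered_of n -` A i \<inter> space ?P) \<in> sets ?P"
      using A by (intro sets.countable_UN) blast
    ultimately have "unordered_of n -` (\<Union>i. A i) \<inter> space ?P \<in> sets ?P"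
      by (simp only:)
    moreover have "(\<Union>i. A i) \<subseteq> {m. size m = n}"
      using A by blast
    ultimately show "(\<Union>i. A i) \<in> ?S"
      by (simp only: mem_Collect_eq simp_thms)
  qed auto
  then show ?thesis
    unfolding unordered_tuples_def by (rule sigma_algebra.sets_measure_of_eq)
qed

definition joint_eigenvalue_distribution ::
    "nat \<Rightarrow> 'a measure \<Rightarrow> ('a \<Rightarrow> complex mat) \<Rightarrow> complex multiset measure" where
  "joint_eigenvalue_distribution n M X =
     distr M (unordered_tuples n) (\<lambda>\<omega>. eigenvalues (X \<omega>))"

section \<open>The Hessenberg matrix\<close>

text \<open>
  Matrix and vector entries are indexed from \<open>0\<close>, whereas \<open>\<alpha>\<close>, \<open>\<beta>\<close>, \<open>\<theta>\<close> and the
  reflectors are numbered from \<open>1\<close>.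
\<close>

definition upper_hessenberg :: "'a :: zero mat \<Rightarrow> bool" where
  "upper_hessenberg A \<longleftrightarrow>
     (\<forall>i < dim_row A. \<forall>j < dim_col A. i > j + 1 \<longrightarrow> A $$ (i, j) = 0)"

definition norm2_vec :: "complex vec \<Rightarrow> real" where
  "norm2_vec v = sqrt (\<Sum>i < dim_vec v. (cmod (v $ i))\<^sup>2)"

definition outer_square :: "complex vec \<Rightarrow> complex mat" where
  "outer_square v = Matrix.mat (dim_vec v) (dim_vec v) (\<lambda>(i, j). v $ i * cnj (v $ j))"

definition reflector :: "complex vec \<Rightarrow> complex mat" where
  "reflector v =
     1\<^sub>m (dim_vec v) - complex_of_real (2 / (norm2_vec v)\<^sup>2) \<cdot>\<^sub>m outer_square v"

text \<open>
  The norm of the pair \<open>(a, b)\<close> is the Euclidean norm of \<open>w\<^sub>j\<close>; the phase \<open>Arg a\<close> is \<open>\<theta>\<^sub>j\<close>.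
\<close>

definition reflection_vec :: "nat \<Rightarrow> nat \<Rightarrow> complex \<Rightarrow> complex \<Rightarrow> complex vec" where
  "reflection_vec n j a b =
     Matrix.vec n (\<lambda>i. if i + 1 = j then a + exp (\<i> * complex_of_real (Arg a)) * complex_of_real (norm (a, b))
                       else if i = j then b else 0)"

definition phase_matrix :: "nat \<Rightarrow> (nat \<Rightarrow> real) \<Rightarrow> complex mat" where
  "phase_matrix n \<theta> = - mat_diag n (\<lambda>i. exp (\<i> * complex_of_real (\<theta> (i + 1))))"

definition hessenberg_product ::
    "nat \<Rightarrow> (nat \<Rightarrow> complex) \<Rightarrow> (nat \<Rightarrow> complex) \<Rightarrow> real \<Rightarrow> complex mat" where
  "hessenberg_product n a b t =
     foldr (\<lambda>j A. reflector (reflection_vec n j (a j) (b j)) * A) [1..<n]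
       (phase_matrix n (\<lambda>j. if j = n then t else Arg (a j)))"

end

theory Submission
  imports Defs
begin

text \<open>
  Write \<open>1 \<oplus> X\<close> for the block matrix and \<open>R(x)\<close> for the unitary matrix with first column \<open>x / \<parallel>x\<parallel>\<close> obtained
  from a reflector. If \<open>g\<close> is a standard Gaussian vector and \<open>X\<close> an independent Haar matrix of one
  order less, then \<open>R(g) (1 \<oplus> X)\<close> is Haar: a unitary factor \<open>V\<close> on the left turns \<open>g\<close> into \<open>V g\<close>, and
  the remaining block is absorbed by \<open>X\<close>. The Hessenberg matrix satisfies the similar recursion
  \<open>H\<^sub>k\<^sub>+\<^sub>1 = R(\<alpha>, \<beta>, 0, \<dots>, 0) (1 \<oplus> H\<^sub>k)\<close>, and conjugation by \<open>1 \<oplus> W\<close>, with \<open>W\<close> an independent Haar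
  matrix, replaces \<open>(\<alpha>, \<beta>, 0, \<dots>, 0)\<close> by \<open>(\<alpha>, \<beta> W e\<^sub>1)\<close>, which is a Gaussian vector. Hence \<open>H\<close>
  conjugated by \<open>1 \<oplus> W\<close> is Haar, and conjugation does not change the eigenvalues.
\<close>

section \<open>Unitary matrices and reflectors\<close>

text \<open>For n \<ge> 3 the matrix \<open>H\<close> is not Haar distributed, as its entries below
  the subdiagonal vanish; only its conjugacy class has the right law. The construction is the
  Householder reduction of a Haar matrix to Hessenberg form, read backwards: \<alpha> is the leading
  entry of a Gaussian column, \<beta> stands for the norm of its other n - j entries (hence the
  degrees of freedom), and the conjugation restores the direction that the reduction forgets. Only
  the law of the square of \<beta> is prescribed, so its sign is free; the Haar column
  \<open>W e1\<close> absorbs it. The choice of R cannot satisfy R(V x) = V R(x) in general. A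
  unitary matrix is determined by its first column only up to a right factor
  \<open>1 \<oplus> Y\<close>, and the whole argument rests on a Haar block being able to absorb
  this Y. Uniqueness of Haar measure and unitary invariance of Lebesgue measure are both obtained
  from Fubini, without Jacobians. The equality of laws lives on unordered tuples, whose
  sigma-algebra is a quotient, so measurability of the spectrum requires a measurable enumeration of
  the eigenvalues.\<close>

lemma mat_adjoint_index [simp]:
  fixes A :: "complex mat"
  shows "i < dim_col A \<Longrightarrow> j < dim_row A \<Longrightarrow> mat_adjoint A $$ (i, j) = cnj (A $$ (j, i))"
    and "dim_row (mat_adjoint A) = dim_col A" and "dim_col (mat_adjoint A) = dim_row A"
  by (auto simp: mat_adjoint_def mat_of_rows_index)

lemma mat_adjoint_carrier [simp, intro]:
  "(A :: complex mat) \<in> carrier_mat m n \<Longrightarrow> mat_adjoint A \<in> carrier_mat n m"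
  by (intro carrier_matI) auto

lemma mat_adjoint_mult:
  fixes A :: "complex mat"
  assumes "A \<in> carrier_mat l m" "B \<in> carrier_mat m n"
  shows "mat_adjoint (A * B) = mat_adjoint B * mat_adjoint A"
  using assms by (intro eq_matI) (auto simp: scalar_prod_def cnj_sum mult.commute intro!: sum.cong)

lemma mat_adjoint_adjoint [simp]: "mat_adjoint (mat_adjoint A) = (A :: complex mat)"
  by (intro eq_matI) auto

lemma mat_adjoint_one [simp]: "mat_adjoint (1\<^sub>m n) = (1\<^sub>m n :: complex mat)"
  by (intro eq_matI) auto

lemma unitaryD:
  assumes "U \<in> unitary_group n"
  shows "U \<in> carrier_mat n n" "mat_adjoint U * U = 1\<^sub>m n" "U * mat_adjoint U = 1\<^sub>m n"
  using assms mat_mult_left_right_inverse[of "mat_adjoint U" n U]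
  by (auto simp: unitary_group_def)

lemma unitary_one [simp]: "1\<^sub>m n \<in> unitary_group n"
  by (auto simp: unitary_group_def)

lemma unitary_mult [intro]:
  assumes "U \<in> unitary_group n" "V \<in> unitary_group n"
  shows "U * V \<in> unitary_group n"
proof -
  note U = unitaryD[OF assms(1)] and V = unitaryD[OF assms(2)]
  have "mat_adjoint (U * V) * (U * V) = mat_adjoint V * (mat_adjoint U * (U * V))"
    unfolding mat_adjoint_mult[OF U(1) V(1)]
    by (rule assoc_mult_mat[OF mat_adjoint_carrier mat_adjoint_carrier mult_carrier_mat]) (fact U V)+
  also have "mat_adjoint U * (U * V) = mat_adjoint U * U * V"
    by (rule assoc_mult_mat[symmetric, OF mat_adjoint_carrier]) (fact U V)+
  also have "mat_adjoint V * (mat_adjoint U * U * V) = mat_adjoint V * V"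
    by (simp add: U(2) left_mult_one_mat[OF V(1)])
  also have "\<dots> = 1\<^sub>m n"
    by (rule V(2))
  finally show ?thesis
    using mult_carrier_mat[OF unitaryD(1)[OF assms(1)] unitaryD(1)[OF assms(2)]]
    by (simp add: unitary_group_def)
qed

lemma unitary_adjoint [intro]:
  assumes "U \<in> unitary_group n"
  shows "mat_adjoint U \<in> unitary_group n"
  using unitaryD[OF assms] by (simp add: unitary_group_def)

lemma unitary_mult_eq:
  assumes "U \<in> unitary_group n" "A \<in> carrier_mat n m"
  shows "mat_adjoint U * (U * A) = A" "U * (mat_adjoint U * A) = A"
proof -
  note U = unitaryD[OF assms(1)]
  show "mat_adjoint U * (U * A) = A"
    using U assms(2) assoc_mult_mat[of "mat_adjoint U" n n U n A m] by auto
  show "U * (mat_adjoint U * A) = A"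
    using U assms(2) assoc_mult_mat[of U n n "mat_adjoint U" n A m] by auto
qed

section \<open>Block matrices \<open>1 \<oplus> A\<close> and unitary matrices with a common first
  column\<close>

definition one_plus :: "complex mat \<Rightarrow> complex mat" where
  "one_plus A = four_block_mat (1\<^sub>m 1) (0\<^sub>m 1 (dim_col A)) (0\<^sub>m (dim_row A) 1) A"

lemma one_plus_dim [simp]:
  "dim_row (one_plus A) = Suc (dim_row A)" "dim_col (one_plus A) = Suc (dim_col A)"
  by (auto simp: one_plus_def)

lemma one_plus_carrier [simp, intro]:
  "A \<in> carrier_mat m n \<Longrightarrow> one_plus A \<in> carrier_mat (Suc m) (Suc n)"
  by (intro carrier_matI) auto

lemma one_plus_index:
  "i \<le> dim_row A \<Longrightarrow> j \<le> dim_col A \<Longrightarrow>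
    one_plus A $$ (i, j) = (case i of 0 \<Rightarrow> (case j of 0 \<Rightarrow> 1 | Suc _ \<Rightarrow> 0)
       | Suc i' \<Rightarrow> (case j of 0 \<Rightarrow> 0 | Suc j' \<Rightarrow> A $$ (i', j')))"
  by (auto simp: one_plus_def split: nat.split)

lemma one_plus_mult:
  "A \<in> carrier_mat l m \<Longrightarrow> B \<in> carrier_mat m n \<Longrightarrow> one_plus (A * B) = one_plus A * one_plus B"
  unfolding one_plus_def
  by (subst mult_four_block_mat[of _ 1 1 _ m _ l _ _ 1 _ n]) auto

lemma one_plus_one [simp]: "one_plus (1\<^sub>m n) = 1\<^sub>m (Suc n)"
  by (intro eq_matI) (auto simp: one_plus_index split: nat.split)

lemma one_plus_adjoint: "mat_adjoint (one_plus A) = one_plus (mat_adjoint A)"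
  by (intro eq_matI) (auto simp: one_plus_index split: nat.split)

lemma one_plus_unitary [intro]:
  assumes "U \<in> unitary_group n"
  shows "one_plus U \<in> unitary_group (Suc n)"
proof -
  note U = unitaryD[OF assms]
  have "mat_adjoint (one_plus U) * one_plus U = one_plus (mat_adjoint U * U)"
    unfolding one_plus_adjoint using U by (subst one_plus_mult[of _ n n _ n]) auto
  then show ?thesis
    using U by (auto simp: unitary_group_def)
qed

lemma one_plus_inj: "one_plus A = one_plus B \<Longrightarrow> A = B"
proof (rule eq_matI)
  assume eq: "one_plus A = one_plus B"
  show d: "dim_row A = dim_row B" "dim_col A = dim_col B"
    using arg_cong[OF eq, of dim_row] arg_cong[OF eq, of dim_col] by auto
  fix i j assume "i < dim_row B" "j < dim_col B"
  then show "A $$ (i, j) = B $$ (i, j)"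
    using arg_cong[OF eq, of "\<lambda>M. M $$ (Suc i, Suc j)"] d by (auto simp: one_plus_index)
qed

text \<open>Orthonormality of the columns transfers the shape of column 0 to row 0: since column 0
  is the first unit vector, entry (0, j) of \<open>mat_adjoint C * C\<close> is
  \<open>C $$ (0, j)\<close>. What remains is a block, and it inherits unitarity.\<close>

lemma unitary_fix_first:
  assumes C: "C \<in> unitary_group (Suc n)"
    and col: "\<And>i. i \<le> n \<Longrightarrow> C $$ (i, 0) = (if i = 0 then 1 else 0)"
  shows "\<exists>Y \<in> unitary_group n. C = one_plus Y"
proof -
  note U = unitaryD[OF C]
  have row: "C $$ (0, j) = (if j = 0 then 1 else 0)" if j: "j \<le> n" for j
  proof -
    have "(if j = 0 then 1 else 0) = (mat_adjoint C * C) $$ (0, j)"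
      using U j by auto
    also have "\<dots> = (\<Sum>k = 0..<Suc n. cnj (C $$ (k, 0)) * C $$ (k, j))"
      using U(1) j by (auto simp: scalar_prod_def intro!: sum.cong)
    also have "\<dots> = (\<Sum>k = 0..<Suc n. if k = 0 then C $$ (k, j) else 0)"
      using col by (intro sum.cong) auto
    finally show ?thesis by (simp add: sum.delta)
  qed
  define Y where "Y = Matrix.mat n n (\<lambda>(i, j). C $$ (Suc i, Suc j))"
  have Y: "Y \<in> carrier_mat n n" by (auto simp: Y_def)
  have eq: "C = one_plus Y"
    using U(1) Y col row
    by (intro eq_matI) (auto simp: one_plus_index Y_def split: nat.split)
  have "one_plus (mat_adjoint Y * Y) = one_plus (1\<^sub>m n)"
    using U(2) Y unfolding eq one_plus_adjoint by (subst one_plus_mult[of _ n n _ n]) auto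
  then have "mat_adjoint Y * Y = 1\<^sub>m n" by (rule one_plus_inj)
  with Y eq show ?thesis by (auto simp: unitary_group_def)
qed

text \<open>\<open>mat_adjoint B * A\<close> has the same first column as
  \<open>mat_adjoint B * B\<close>, namely the first unit vector. Comparisons of Householder
  matrices are reduced to their first columns in this way.\<close>

lemma unitary_same_first_column:
  assumes A: "A \<in> unitary_group (Suc n)" and B: "B \<in> unitary_group (Suc n)"
    and col: "\<And>i. i \<le> n \<Longrightarrow> A $$ (i, 0) = B $$ (i, 0)"
  shows "\<exists>Y \<in> unitary_group n. A = B * one_plus Y"
proof -
  note UA = unitaryD[OF A] and UB = unitaryD[OF B]
  have "(mat_adjoint B * A) $$ (i, 0) = (mat_adjoint B * B) $$ (i, 0)" if "i \<le> n" for i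
    using that UA(1) UB(1) col by (auto simp: scalar_prod_def intro!: sum.cong)
  then have "\<exists>Y \<in> unitary_group n. mat_adjoint B * A = one_plus Y"
    by (intro unitary_fix_first unitary_mult unitary_adjoint A B) (auto simp: UB(2))
  then show ?thesis
    using unitary_mult_eq(2)[OF B UA(1)] by metis
qed

section \<open>The Euclidean norm and Householder matrices\<close>

lemma norm2_vec_nonneg [simp]: "norm2_vec x \<ge> 0"
  by (auto simp: norm2_vec_def intro!: sum_nonneg)

lemma norm2_vec_square: "(norm2_vec v)\<^sup>2 = (\<Sum>i < dim_vec v. (cmod (v $ i))\<^sup>2)"
  by (simp add: norm2_vec_def sum_nonneg)

lemma of_real_norm2_vec_square:
  "complex_of_real ((norm2_vec v)\<^sup>2) = (\<Sum>i < dim_vec v. v $ i * cnj (v $ i))"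
  by (simp only: norm2_vec_square of_real_sum complex_norm_square)

lemma norm2_vec_eq_0: "norm2_vec v = 0 \<longleftrightarrow> (\<forall>i < dim_vec v. v $ i = 0)"
  by (auto simp: norm2_vec_def sum_nonneg_eq_0_iff sum_nonneg)

lemma unitary_norm2_vec:
  assumes U: "U \<in> unitary_group n" and x: "x \<in> carrier_vec n"
  shows "norm2_vec (U *\<^sub>v x) = norm2_vec x"
proof -
  have dims [simp]: "dim_row U = n" "dim_col U = n" "dim_vec x = n"
    using unitaryD(1)[OF U] x by auto
  have "(mat_adjoint U * U) $$ (j, k) = (\<Sum>i<n. cnj (U $$ (i, j)) * U $$ (i, k))"
    if "j < n" "k < n" for j k
    using that by (auto simp: scalar_prod_def atLeast0LessThan intro!: sum.cong)
  then have orth: "(\<Sum>i<n. cnj (U $$ (i, j)) * U $$ (i, k)) = (if j = k then 1 else 0)"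
    if "j < n" "k < n" for j k
    using that unitaryD(2)[OF U] by auto
  have "complex_of_real ((norm2_vec (U *\<^sub>v x))\<^sup>2)
      = (\<Sum>i<n. (\<Sum>k<n. U $$ (i, k) * x $ k) * (\<Sum>j<n. cnj (U $$ (i, j)) * cnj (x $ j)))"
    unfolding of_real_norm2_vec_square
    by (auto simp: scalar_prod_def atLeast0LessThan cnj_sum intro!: sum.cong)
  also have "\<dots> = (\<Sum>i<n. \<Sum>j<n. \<Sum>k<n. cnj (U $$ (i, j)) * U $$ (i, k) * (x $ k * cnj (x $ j)))"
    by (simp add: sum_product mult_ac) (subst sum.swap, simp)
  also have "\<dots> = (\<Sum>j<n. \<Sum>i<n. \<Sum>k<n. cnj (U $$ (i, j)) * U $$ (i, k) * (x $ k * cnj (x $ j)))"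
    by (rule sum.swap)
  also have "\<dots> = (\<Sum>j<n. \<Sum>k<n. \<Sum>i<n. cnj (U $$ (i, j)) * U $$ (i, k) * (x $ k * cnj (x $ j)))"
    by (intro sum.cong refl sum.swap)
  also have "\<dots> = (\<Sum>j<n. \<Sum>k<n. if j = k then x $ k * cnj (x $ j) else 0)"
    by (intro sum.cong refl) (simp add: sum_distrib_right[symmetric] orth)
  also have "\<dots> = complex_of_real ((norm2_vec x)\<^sup>2)"
    unfolding of_real_norm2_vec_square by (simp add: sum.delta)
  finally have "(norm2_vec (U *\<^sub>v x))\<^sup>2 = (norm2_vec x)\<^sup>2"
    by (simp only: of_real_eq_iff)
  then show ?thesis by (simp add: power2_eq_iff_nonneg)
qed

lemma reflector_carrier [simp, intro]: "v \<in> carrier_vec n \<Longrightarrow> reflector v \<in> carrier_mat n n"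
  by (auto simp: reflector_def outer_square_def)

lemma reflector_dim [simp]: "dim_row (reflector v) = dim_vec v" "dim_col (reflector v) = dim_vec v"
  by (auto simp: reflector_def outer_square_def)

lemma reflector_index:
  "i < dim_vec v \<Longrightarrow> j < dim_vec v \<Longrightarrow> reflector v $$ (i, j)
    = (if i = j then 1 else 0) - complex_of_real (2 / (norm2_vec v)\<^sup>2) * (v $ i * cnj (v $ j))"
  by (auto simp: reflector_def outer_square_def)

lemma reflector_unitary [intro]:
  assumes v: "v \<in> carrier_vec n"
  shows "reflector v \<in> unitary_group n"
proof -
  have [simp]: "dim_vec v = n" using v by auto
  have c: "reflector v \<in> carrier_mat n n" using v by auto
  define s where "s = complex_of_real (2 / (norm2_vec v)\<^sup>2)"
  have cs [simp]: "cnj s = s" by (simp add: s_def)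
  \<comment> \<open>For \<open>v = 0\<close> the quotient 2 / 0 is 0, so both sides vanish and the
    reflector is the identity.\<close>
  have ss: "s * s * (\<Sum>k<n. v $ k * cnj (v $ k)) = 2 * s"
    using of_real_norm2_vec_square[of v, symmetric]
    by (auto simp: s_def power2_eq_square)
  have "mat_adjoint (reflector v) * reflector v = 1\<^sub>m n"
  proof (rule eq_matI)
    fix i j assume "i < dim_row (1\<^sub>m n :: complex mat)" "j < dim_col (1\<^sub>m n :: complex mat)"
    then have ij: "i < n" "j < n" by auto
    let ?d = "\<lambda>a b :: nat. if a = b then 1 else (0 :: complex)"
    have "(mat_adjoint (reflector v) * reflector v) $$ (i, j)
       = (\<Sum>k<n. (?d k i - s * (v $ i * cnj (v $ k))) * (?d k j - s * (v $ k * cnj (v $ j))))"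
      using ij c by (auto simp: scalar_prod_def atLeast0LessThan reflector_index s_def[symmetric]
           mult.commute simp del: of_real_divide of_real_power intro!: sum.cong)
    also have "\<dots> = (\<Sum>k<n. (if k = i then ?d k j else 0)
        - (if k = i then s * (v $ k * cnj (v $ j)) else 0)
        - (if k = j then s * (v $ i * cnj (v $ k)) else 0)
        + s * s * (v $ k * cnj (v $ k)) * (v $ i * cnj (v $ j)))"
      by (intro sum.cong refl) (auto simp: algebra_simps)
    also have "\<dots> = ?d i j - 2 * s * (v $ i * cnj (v $ j))
        + (s * s * (\<Sum>k<n. v $ k * cnj (v $ k))) * (v $ i * cnj (v $ j))"
      using ij by (simp add: sum.distrib sum_subtractf sum.delta sum_distrib_left sum_distrib_right)
    also have "\<dots> = 1\<^sub>m n $$ (i, j)"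
      unfolding ss using ij by simp
    finally show "(mat_adjoint (reflector v) * reflector v) $$ (i, j) = 1\<^sub>m n $$ (i, j)" .
  qed (use c in auto)
  then show ?thesis using c by (auto simp: unitary_group_def)
qed

lemma mat_diag_unitary:
  assumes "\<And>i. i < n \<Longrightarrow> cmod (f i) = 1"
  shows "mat_diag n f \<in> unitary_group n"
proof -
  have "mat_adjoint (mat_diag n f) = mat_diag n (\<lambda>i. cnj (f i))"
    by (intro eq_matI) (auto simp: mat_diag_def)
  moreover have "mat_diag n (\<lambda>i. cnj (f i) * f i) = 1\<^sub>m n"
    using assms by (intro eq_matI) (auto simp: mat_diag_def mult.commute complex_norm_square[symmetric])
  ultimately show ?thesis by (auto simp: unitary_group_def)
qed

text \<open>The value 1 at 0 corresponds to \<^term>\<open>Arg 0 = 0\<close>.\<close>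

definition phase :: "complex \<Rightarrow> complex" where
  "phase z = (if z = 0 then 1 else sgn z)"

lemma exp_Arg: "exp (\<i> * complex_of_real (Arg z)) = phase z"
  using cis_Arg[of z] by (auto simp: phase_def cis_conv_exp Arg_zero)

lemma cmod_phase [simp]: "cmod (phase z) = 1"
  by (simp add: phase_def norm_sgn)

lemma phase_mult_norm: "phase z * complex_of_real (cmod z) = z"
  by (auto simp: phase_def sgn_div_norm scaleR_conv_of_real)

lemma phase_mult_cnj: "phase z * cnj (phase z) = 1"
  by (simp add: complex_norm_square[symmetric])

text \<open>Adding |x| with the phase of the leading entry gives a leading entry of modulus |x_0| +
  |x|, which is nonzero whenever x is; there is no cancellation.\<close>

definition house_vec :: "complex vec \<Rightarrow> complex vec" where
  "house_vec x = Matrix.vec (dim_vec x)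
     (\<lambda>i. x $ i + (if i = 0 then phase (x $ 0) * complex_of_real (norm2_vec x) else 0))"

text \<open>The reflector alone sends the first unit vector to - cnj p x / |x| with p =
  \<open>phase (x $ 0)\<close>. The diagonal factor, one entry of the matrix \<open>D\<close>,
  corrects this to x / |x|.\<close>

definition house :: "complex vec \<Rightarrow> complex mat" where
  "house x = reflector (house_vec x)
     * mat_diag (dim_vec x) (\<lambda>i. if i = 0 then - phase (x $ 0) else 1)"

lemma house_vec_dim [simp]: "dim_vec (house_vec x) = dim_vec x"
  by (simp add: house_vec_def)

lemma house_dim [simp]: "dim_row (house x) = dim_vec x" "dim_col (house x) = dim_vec x"
  by (simp_all add: house_def mat_diag_def)

lemma house_vec_carrier [simp, intro]: "x \<in> carrier_vec n \<Longrightarrow> house_vec x \<in> carrier_vec n"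
  by (auto simp: house_vec_def)

lemma house_carrier [simp, intro]: "x \<in> carrier_vec n \<Longrightarrow> house x \<in> carrier_mat n n"
  unfolding house_def by (rule mult_carrier_mat[of _ n n]) auto

lemma house_unitary [intro]:
  assumes "x \<in> carrier_vec n"
  shows "house x \<in> unitary_group n"
proof -
  have "dim_vec x = n" using assms by auto
  then show ?thesis
    unfolding house_def using assms
    by (intro unitary_mult reflector_unitary) (auto intro!: mat_diag_unitary)
qed

lemma house_index:
  assumes "i < dim_vec x" "j < dim_vec x"
  shows "house x $$ (i, j) = reflector (house_vec x) $$ (i, j) * (if j = 0 then - phase (x $ 0) else 1)"
proof -
  have "reflector (house_vec x) \<in> carrier_mat (dim_vec x) (dim_vec x)" by auto
  from mat_diag_mult_right[OF this] show ?thesis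
    unfolding house_def using assms by auto
qed

text \<open>With r = |x| and x_0 = p a, where p is the phase and a \<ge> 0, the Householder vector v
  satisfies v_0 = p (a + r) and |v|^2 = 2 r (a + r). Hence 2 cnj v_0 / |v|^2 = cnj p / r, and the
  factor - p turns the column into v / r, corrected at index 0.\<close>

lemma house_first_column:
  assumes x: "norm2_vec x \<noteq> 0" and i: "i < dim_vec x"
  shows "house x $$ (i, 0) = x $ i / complex_of_real (norm2_vec x)"
proof -
  define r where "r = norm2_vec x"
  define a where "a = cmod (x $ 0)"
  define p where "p = phase (x $ 0)"
  have r: "r > 0" using x norm2_vec_nonneg[of x] unfolding r_def by linarith
  have a: "a \<ge> 0" by (simp add: a_def)
  have x0: "x $ 0 = p * complex_of_real a"
    unfolding p_def a_def by (rule phase_mult_norm[symmetric])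
  have pp: "p * cnj p = 1" by (simp add: p_def phase_mult_cnj)
  obtain m where m: "dim_vec x = Suc m" using i by (cases "dim_vec x") auto
  have v0: "house_vec x $ 0 = p * complex_of_real (a + r)"
    using m x0 unfolding house_vec_def p_def[symmetric] r_def[symmetric]
    by (simp add: algebra_simps)
  have cp: "cmod p = 1" by (simp add: p_def)
  have "(norm2_vec (house_vec x))\<^sup>2 = (cmod (house_vec x $ 0))\<^sup>2 + (\<Sum>i<m. (cmod (x $ Suc i))\<^sup>2)"
    unfolding norm2_vec_square using m
    by (simp add: house_vec_def sum.lessThan_Suc_shift del: sum.lessThan_Suc)
  moreover have "r\<^sup>2 = a\<^sup>2 + (\<Sum>i<m. (cmod (x $ Suc i))\<^sup>2)"
    unfolding r_def norm2_vec_square m a_def by (simp add: sum.lessThan_Suc_shift del: sum.lessThan_Suc)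
  ultimately have nv: "(norm2_vec (house_vec x))\<^sup>2 = 2 * r * (a + r)"
    unfolding v0 norm_mult cp norm_of_real using a r by (simp add: power2_eq_square algebra_simps)
  have ar: "complex_of_real (a + r) \<noteq> 0"
    using a r by (metis add_nonneg_eq_0_iff less_eq_real_def less_irrefl of_real_eq_0_iff)
  have rr: "complex_of_real r \<noteq> 0" using r by simp
  let ?v = "house_vec x $ i"
  have "house x $$ (i, 0) = ((if i = 0 then 1 else 0)
      - complex_of_real (2 / (norm2_vec (house_vec x))\<^sup>2) * (?v * cnj (house_vec x $ 0))) * (- p)"
    using i m by (subst house_index) (simp_all add: reflector_index p_def)
  also have "\<dots> = (if i = 0 then - p else 0) + complex_of_real (2 / (2 * r * (a + r)))
      * complex_of_real (a + r) * ?v * (p * cnj p)"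
    unfolding nv v0 by (simp add: algebra_simps del: of_real_add of_real_mult of_real_divide)
  also have "complex_of_real (2 / (2 * r * (a + r))) * complex_of_real (a + r) = 1 / r"
    using ar rr by (simp del: of_real_add add: mult.assoc)
  \<comment> \<open>At index 0 the entry of the Householder vector is x_0 + p r, and the surplus p r
    / r cancels against - p.\<close>
  also have "(if i = 0 then - p else 0) + 1 / r * ?v * (p * cnj p) = x $ i / r"
    unfolding pp using i rr
    by (auto simp: house_vec_def p_def[symmetric] r_def[symmetric] field_simps)
  finally show ?thesis by (simp add: r_def)
qed

text \<open>Both matrices have first column U x / |U x|, because U preserves the norm.\<close>

lemma unitary_mult_house:
  assumes U: "U \<in> unitary_group (Suc n)" and x: "x \<in> carrier_vec (Suc n)" "norm2_vec x \<noteq> 0"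
  shows "\<exists>Y \<in> unitary_group n. U * house x = house (U *\<^sub>v x) * one_plus Y"
proof (rule unitary_same_first_column)
  note Uc = unitaryD(1)[OF U]
  have Ux: "U *\<^sub>v x \<in> carrier_vec (Suc n)"
    using Uc x(1) by (rule mult_mat_vec_carrier)
  show "U * house x \<in> unitary_group (Suc n)" "house (U *\<^sub>v x) \<in> unitary_group (Suc n)"
    using U x Ux by auto
  fix i assume i: "i \<le> n"
  have "(U * house x) $$ (i, 0) = (\<Sum>j = 0..<Suc n. U $$ (i, j) * house x $$ (j, 0))"
    using i Uc house_carrier[OF x(1)] by (auto simp: scalar_prod_def intro!: sum.cong)
  also have "\<dots> = (\<Sum>j = 0..<Suc n. U $$ (i, j) * x $ j) / norm2_vec x"
    unfolding sum_divide_distrib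
    using x by (intro sum.cong refl) (auto simp: house_first_column)
  also have "\<dots> = (U *\<^sub>v x) $ i / norm2_vec (U *\<^sub>v x)"
    using i Uc x by (auto simp: unitary_norm2_vec[OF U x(1)] scalar_prod_def intro!: sum.cong)
  also have "\<dots> = house (U *\<^sub>v x) $$ (i, 0)"
    using i Ux Uc by (subst house_first_column) (auto simp: unitary_norm2_vec[OF U x(1)] x(2))
  finally show "(U * house x) $$ (i, 0) = house (U *\<^sub>v x) $$ (i, 0)" .
qed

section \<open>Householder matrices of vectors supported on two coordinates\<close>

definition pair_vec :: "nat \<Rightarrow> complex \<times> complex \<Rightarrow> complex vec" where
  "pair_vec n z = Matrix.vec n (\<lambda>i. if i = 0 then fst z else if i = 1 then snd z else 0)"

lemma pair_vec_dim [simp]: "dim_vec (pair_vec n z) = n"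
  by (simp add: pair_vec_def)

lemma pair_vec_carrier [simp, intro]: "pair_vec n z \<in> carrier_vec n"
  by (simp add: pair_vec_def)

lemma pair_vec_0: "pair_vec (Suc n) z $ 0 = fst z"
  by (simp add: pair_vec_def)

lemma norm2_pair_vec: "norm2_vec (pair_vec (Suc (Suc k)) z) = norm z"
  by (cases z) (simp add: norm2_vec_def pair_vec_def norm_prod_def sum.lessThan_Suc_shift
    del: sum.lessThan_Suc)

text \<open>The Householder vector of a pair is again supported on the indices 0 and 1, so the
  matrix is a 2 by 2 block extended by the identity.\<close>

lemma house_pair_index:
  assumes "i < n" "j < n" "i \<ge> 2 \<or> j \<ge> 2"
  shows "house (pair_vec n z) $$ (i, j) = (if i = j then 1 else 0)"
  using assms by (auto simp: house_index reflector_index house_vec_def pair_vec_def)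

text \<open>With respect to blocks of sizes 2 and k the factors are \<open>B \<oplus> 1\<close> and
  \<open>1 \<oplus> W\<close>; they act on complementary coordinates.\<close>

lemma house_pair_commute:
  assumes W: "W \<in> carrier_mat k k"
  shows "house (pair_vec (Suc (Suc k)) z) * one_plus (one_plus W)
       = one_plus (one_plus W) * house (pair_vec (Suc (Suc k)) z)"
proof -
  let ?H = "house (pair_vec (Suc (Suc k)) z)"
  have Hc: "?H \<in> carrier_mat (Suc (Suc k)) (Suc (Suc k))" by auto
  define B where "B = Matrix.mat 2 2 (\<lambda>(i, j). ?H $$ (i, j))"
  have B: "B \<in> carrier_mat 2 2" by (auto simp: B_def)
  have 1: "?H = four_block_mat B (0\<^sub>m 2 k) (0\<^sub>m k 2) (1\<^sub>m k)"
    using Hc B by (intro eq_matI) (auto simp: house_pair_index B_def)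
  have 2: "one_plus (one_plus W) = four_block_mat (1\<^sub>m 2) (0\<^sub>m 2 k) (0\<^sub>m k 2) W"
    using W by (intro eq_matI) (auto simp: one_plus_index split: nat.split)
  show ?thesis
    unfolding 1 2 using B W
    by (simp add: mult_four_block_mat[of _ 2 2 _ k _ k _ _ 2 _ k])
qed

section \<open>The Hessenberg matrix built from the bottom right corner\<close>

text \<open>
  \<^term>\<open>hmat k w t\<close> has order \<open>k + 1\<close>; its parameter \<open>w i\<close> is the pair \<open>w\<^sub>j\<close> of the paper with
  \<open>j = k + 1 - i\<close>, so that \<open>\<beta>\<^sub>j\<^sup>2\<close> has \<open>i\<close> degrees of freedom.
\<close>

fun hmat :: "nat \<Rightarrow> (nat \<Rightarrow> complex \<times> complex) \<Rightarrow> real \<Rightarrow> complex mat" where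
  "hmat 0 w t = mat_diag 1 (\<lambda>_. - exp (\<i> * complex_of_real t))"
| "hmat (Suc k) w t = house (pair_vec (Suc (Suc k)) (w (Suc k))) * one_plus (hmat k w t)"

lemma hmat_unitary [intro]: "hmat k w t \<in> unitary_group (Suc k)"
  by (induction k) (auto simp del: One_nat_def intro!: mat_diag_unitary simp: One_nat_def[symmetric])

lemma hmat_cong: "(\<And>i. i \<in> {1..k} \<Longrightarrow> w i = w' i) \<Longrightarrow> hmat k w t = hmat k w' t"
  by (induction k) auto

lemma hmat_upper_hessenberg: "upper_hessenberg (hmat k w t)"
proof (induction k)
  case 0
  then show ?case by (auto simp: upper_hessenberg_def mat_diag_def)
next
  case (Suc k)
  let ?H = "house (pair_vec (Suc (Suc k)) (w (Suc k)))"
  have Hc: "?H \<in> carrier_mat (Suc (Suc k)) (Suc (Suc k))" by auto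
  have hc: "hmat k w t \<in> carrier_mat (Suc k) (Suc k)" using unitaryD(1) by auto
  show ?case
    unfolding upper_hessenberg_def
  proof (intro allI impI)
    fix i j assume "i < dim_row (hmat (Suc k) w t)" "j < dim_col (hmat (Suc k) w t)" and ij: "i > j + 1"
    then have b: "i < Suc (Suc k)" "j < Suc (Suc k)" using Hc hc by auto
    have "hmat (Suc k) w t $$ (i, j)
        = (\<Sum>l = 0..<Suc (Suc k). ?H $$ (i, l) * one_plus (hmat k w t) $$ (l, j))"
      using b Hc hc by (auto simp: scalar_prod_def simp del: sum.op_ivl_Suc intro!: sum.cong)
    \<comment> \<open>From i > j + 1 follows i \<ge> 2, so row i of \<open>?H\<close> is a unit
      vector and row i of the product is row i of the block matrix.\<close>
    also have "\<dots> = (\<Sum>l = 0..<Suc (Suc k). if l = i then one_plus (hmat k w t) $$ (l, j) else 0)"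
      using b ij by (intro sum.cong refl) (auto simp: house_pair_index)
    also have "\<dots> = one_plus (hmat k w t) $$ (i, j)"
      using b by (simp add: sum.delta del: sum.op_ivl_Suc)
    also have "\<dots> = 0"
      using b ij hc Suc unfolding upper_hessenberg_def
      by (auto simp: one_plus_index split: nat.split)
    finally show "hmat (Suc k) w t $$ (i, j) = 0" .
  qed
qed

text \<open>A leading zero changes neither the norm nor the outer product in the remaining
  coordinates.\<close>

lemma one_plus_reflector:
  assumes v: "v \<in> carrier_vec n" and v': "v' \<in> carrier_vec (Suc n)"
    and "v' $ 0 = 0" "\<And>i. i < n \<Longrightarrow> v' $ Suc i = v $ i"
  shows "reflector v' = one_plus (reflector v)"
proof -
  have "norm2_vec v' = norm2_vec v"
    using assms by (auto simp: norm2_vec_def sum.lessThan_Suc_shift simp del: sum.lessThan_Suc)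
  then show ?thesis
    using assms by (intro eq_matI) (auto simp: reflector_index one_plus_index split: nat.split)
qed

text \<open>The matrix \<open>D\<close> splits as \<open>E * one_plus D'\<close>, where
  \<open>E\<close> carries only the first phase. All reflectors after the first have the form
  \<open>one_plus R'\<close>, hence commute with \<open>E\<close>; moving \<open>E\<close> to the
  left completes the first reflector to a Householder matrix.\<close>

lemma hessenberg_product_Suc:
  "hessenberg_product (Suc (Suc k)) a b t
     = house (pair_vec (Suc (Suc k)) (a 1, b 1)) * one_plus (hessenberg_product (Suc k) (a \<circ> Suc) (b \<circ> Suc) t)"
proof -
  let ?m = "Suc k"
  let ?n = "Suc ?m"
  let ?R = "\<lambda>j. reflector (reflection_vec ?n j (a j) (b j))"
  let ?R' = "\<lambda>j. reflector (reflection_vec ?m j (a (Suc j)) (b (Suc j)))"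
  define \<theta> where "\<theta> j = (if j = ?n then t else Arg (a j))" for j
  define \<theta>' where "\<theta>' j = (if j = ?m then t else Arg ((a \<circ> Suc) j))" for j
  define E where "E = mat_diag ?n (\<lambda>i. if i = 0 then - phase (a 1) else 1)"
  have E: "E \<in> carrier_mat ?n ?n" by (simp add: E_def)
  have rv: "reflection_vec n j c d \<in> carrier_vec n" for n j c d by (simp add: reflection_vec_def)
  have c: "foldr (\<lambda>j A. ?R' j * A) js (phase_matrix ?m \<theta>') \<in> carrier_mat ?m ?m" for js
    by (induction js) (auto simp: phase_matrix_def rv intro!: mult_carrier_mat[of _ ?m ?m])
  \<comment> \<open>\<open>E\<close> is scalar on each of the two diagonal blocks.\<close>
  have comm: "one_plus A * (E * B) = E * (one_plus A * B)"
    if "A \<in> carrier_mat ?m ?m" "B \<in> carrier_mat ?n ?n" for A B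
  proof -
    have "one_plus A * E = E * one_plus A"
      unfolding E_def using that
      by (subst mat_diag_mult_right[of _ ?n], simp, subst mat_diag_mult_left[of _ _ ?n], simp)
         (auto intro!: eq_matI simp: one_plus_index split: nat.split)
    then show ?thesis
      using that E assoc_mult_mat[of "one_plus A" ?n ?n E ?n B ?n] assoc_mult_mat[of E ?n ?n "one_plus A" ?n B ?n]
      by auto
  qed
  have R: "?R (Suc j) = one_plus (?R' j)" if "j \<in> {1..<?m}" for j
    using that by (intro one_plus_reflector[OF rv rv]) (auto simp: reflection_vec_def)
  have P: "phase_matrix ?m \<theta>' \<in> carrier_mat ?m ?m"
    by (simp add: phase_matrix_def)
  have "phase_matrix ?n \<theta> = E * one_plus (phase_matrix ?m \<theta>')"
    unfolding E_def mat_diag_mult_left[OF one_plus_carrier[OF P]]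
    using P by (intro eq_matI) (auto simp: phase_matrix_def mat_diag_def one_plus_index \<theta>_def \<theta>'_def
         exp_Arg split: nat.split)
  \<comment> \<open>Stated for an arbitrary list of indices, so that induction on the list is
    possible although the two base matrices are fixed.\<close>
  then have base: "foldr (\<lambda>j A. ?R (Suc j) * A) js (phase_matrix ?n \<theta>)
      = E * one_plus (foldr (\<lambda>j A. ?R' j * A) js (phase_matrix ?m \<theta>'))"
    if "set js \<subseteq> {1..<?m}" for js
    using that
  proof (induction js)
    case (Cons j js)
    have r: "?R' j \<in> carrier_mat ?m ?m" by (simp add: rv)
    show ?case
      using Cons comm[OF r one_plus_carrier[OF c]] R[of j] one_plus_mult[OF r c] by simp
  qed simp
  have "[1..<?n] = 1 # map Suc [1..<?m]"
    unfolding map_Suc_upt by (subst upt_conv_Cons) simp_all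
  then have "hessenberg_product ?n a b t = ?R 1 * foldr (\<lambda>j A. ?R (Suc j) * A) [1..<?m] (phase_matrix ?n \<theta>)"
    unfolding hessenberg_product_def \<theta>_def by (simp add: foldr_map o_def)
  also have "\<dots> = ?R 1 * (E * one_plus (foldr (\<lambda>j A. ?R' j * A) [1..<?m] (phase_matrix ?m \<theta>')))"
    by (subst base) auto
  also have "\<dots> = ?R 1 * E * one_plus (foldr (\<lambda>j A. ?R' j * A) [1..<?m] (phase_matrix ?m \<theta>'))"
    using E c by (subst assoc_mult_mat[of _ ?n ?n _ ?n _ ?n]) (auto simp: rv)
  also have "foldr (\<lambda>j A. ?R' j * A) [1..<?m] (phase_matrix ?m \<theta>') = hessenberg_product ?m (a \<circ> Suc) (b \<circ> Suc) t"
    unfolding hessenberg_product_def \<theta>'_def by simp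
  also have "?R 1 * E = house (pair_vec ?n (a 1, b 1))"
  proof -
    have "reflection_vec ?n 1 (a 1) (b 1) = house_vec (pair_vec ?n (a 1, b 1))"
      unfolding house_vec_def norm2_pair_vec
      by (intro eq_vecI) (auto simp: reflection_vec_def pair_vec_def exp_Arg)
    then show ?thesis by (simp add: house_def E_def pair_vec_0 cong: if_cong)
  qed
  finally show ?thesis .
qed

lemma hessenberg_product_eq_hmat:
  "hessenberg_product (Suc k) a b t = hmat k (\<lambda>i. (a (Suc k - i), b (Suc k - i))) t"
proof (induction k arbitrary: a b)
  case 0
  show ?case
    by (intro eq_matI) (auto simp: hessenberg_product_def phase_matrix_def mat_diag_def)
next
  case (Suc k)
  show ?case
    unfolding hessenberg_product_Suc Suc hmat.simps
    by (intro arg_cong2[where f = "(*)"] arg_cong[where f = one_plus] hmat_cong) (auto simp: Suc_diff_le)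
qed

section \<open>Measurability and Haar measures\<close>

lemma space_unitary_borel [simp]: "space (unitary_borel n) = unitary_group n"
  by (simp add: unitary_borel_def)

lemma measurable_unitary_borelI:
  assumes "\<And>x. x \<in> space M \<Longrightarrow> f x \<in> unitary_group n"
    and "\<And>i j. i < n \<Longrightarrow> j < n \<Longrightarrow> (\<lambda>x. f x $$ (i, j)) \<in> borel_measurable M"
  shows "f \<in> measurable M (unitary_borel n)"
  unfolding unitary_borel_def
  by (rule measurable_vimage_algebra2) (use assms in \<open>auto intro!: measurable_restrict\<close>)

lemma measurable_entry:
  assumes f: "f \<in> measurable M (unitary_borel n)" and "i < n" "j < n"
  shows "(\<lambda>x. f x $$ (i, j)) \<in> borel_measurable M"
proof -
  have 1: "(\<lambda>A. \<lambda>ij \<in> {..<n} \<times> {..<n}. A $$ ij)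
      \<in> measurable (unitary_borel n) (Pi\<^sub>M ({..<n} \<times> {..<n}) (\<lambda>_. borel :: complex measure))"
    unfolding unitary_borel_def by (rule measurable_vimage_algebra1) (auto simp: space_PiM)
  have "(\<lambda>A. (\<lambda>ij \<in> {..<n} \<times> {..<n}. A $$ ij) (i, j)) \<in> borel_measurable (unitary_borel n)"
    by (rule measurable_compose[OF 1 measurable_component_singleton]) (use assms in auto)
  then have "(\<lambda>A :: complex mat. A $$ (i, j)) \<in> borel_measurable (unitary_borel n)"
    using assms by simp
  from measurable_compose[OF f this] show ?thesis .
qed

lemma measurable_unitaryD:
  "f \<in> measurable M (unitary_borel n) \<Longrightarrow> x \<in> space M \<Longrightarrow> f x \<in> unitary_group n"
  using measurable_space[of f M "unitary_borel n"] by auto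

lemma measurable_mat_mult [measurable (raw)]:
  assumes f: "f \<in> measurable M (unitary_borel n)" and g: "g \<in> measurable M (unitary_borel n)"
  shows "(\<lambda>x. f x * g x) \<in> measurable M (unitary_borel n)"
proof (rule measurable_unitary_borelI)
  note fg = measurable_unitaryD[OF f] measurable_unitaryD[OF g]
  show "f x * g x \<in> unitary_group n" if "x \<in> space M" for x
    using fg that by auto
  fix i j assume ij: "i < n" "j < n"
  have "(\<lambda>x. \<Sum>k = 0..<n. f x $$ (i, k) * g x $$ (k, j)) \<in> borel_measurable M"
    using ij by (intro borel_measurable_sum borel_measurable_times measurable_entry[OF f] measurable_entry[OF g]) auto
  also have "?this \<longleftrightarrow> (\<lambda>x. (f x * g x) $$ (i, j)) \<in> borel_measurable M"
  proof (intro measurable_cong)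
    fix x assume "x \<in> space M"
    then have "f x \<in> carrier_mat n n" "g x \<in> carrier_mat n n"
      using fg unitaryD(1) by auto
    then show "(\<Sum>k = 0..<n. f x $$ (i, k) * g x $$ (k, j)) = (f x * g x) $$ (i, j)"
      using ij by (auto simp: scalar_prod_def intro!: sum.cong)
  qed
  finally show "(\<lambda>x. (f x * g x) $$ (i, j)) \<in> borel_measurable M" .
qed

lemma borel_measurable_cnj [measurable]: "cnj \<in> borel_measurable borel"
  by (intro borel_measurable_continuous_onI continuous_intros)

lemma measurable_mat_adjoint [measurable (raw)]:
  assumes f: "f \<in> measurable M (unitary_borel n)"
  shows "(\<lambda>x. mat_adjoint (f x)) \<in> measurable M (unitary_borel n)"
proof (rule measurable_unitary_borelI)
  note f' = measurable_unitaryD[OF f]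
  show "mat_adjoint (f x) \<in> unitary_group n" if "x \<in> space M" for x
    using f' that by auto
  fix i j assume ij: "i < n" "j < n"
  have "(\<lambda>x. cnj (f x $$ (j, i))) \<in> borel_measurable M"
    by (rule measurable_compose[OF measurable_entry[OF f] borel_measurable_cnj]) (use ij in auto)
  also have "?this \<longleftrightarrow> (\<lambda>x. mat_adjoint (f x) $$ (i, j)) \<in> borel_measurable M"
  proof (intro measurable_cong)
    fix x assume "x \<in> space M"
    then have "f x \<in> carrier_mat n n" using f' unitaryD(1) by auto
    then show "cnj (f x $$ (j, i)) = mat_adjoint (f x) $$ (i, j)" using ij by auto
  qed
  finally show "(\<lambda>x. mat_adjoint (f x) $$ (i, j)) \<in> borel_measurable M" .
qed

lemma measurable_one_plus [measurable (raw)]: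
  assumes f: "f \<in> measurable M (unitary_borel n)"
  shows "(\<lambda>x. one_plus (f x)) \<in> measurable M (unitary_borel (Suc n))"
proof (rule measurable_unitary_borelI)
  note f' = measurable_unitaryD[OF f]
  show "one_plus (f x) \<in> unitary_group (Suc n)" if "x \<in> space M" for x
    using f' that by auto
  fix i j assume ij: "i < Suc n" "j < Suc n"
  have "(\<lambda>x. if i = 0 then if j = 0 then 1 else 0 else if j = 0 then 0 else f x $$ (i - 1, j - 1))
      \<in> borel_measurable M"
    using ij measurable_entry[OF f] by (cases i; cases j) simp_all
  also have "?this \<longleftrightarrow> (\<lambda>x. one_plus (f x) $$ (i, j)) \<in> borel_measurable M"
  proof (intro measurable_cong)
    fix x assume "x \<in> space M"
    then have "f x \<in> carrier_mat n n" using f' unitaryD(1) by auto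
    then show "(if i = 0 then if j = 0 then 1 else 0 else if j = 0 then 0 else f x $$ (i - 1, j - 1))
        = one_plus (f x) $$ (i, j)"
      using ij by (auto simp: one_plus_index split: nat.split)
  qed
  finally show "(\<lambda>x. one_plus (f x) $$ (i, j)) \<in> borel_measurable M" .
qed

lemma borel_measurable_phase [measurable]: "phase \<in> borel_measurable borel"
  unfolding phase_def[abs_def] sgn_div_norm by measurable

lemma measurable_house:
  assumes g: "\<And>x. x \<in> space M \<Longrightarrow> g x \<in> carrier_vec n"
    and m: "\<And>i. i < n \<Longrightarrow> (\<lambda>x. g x $ i) \<in> borel_measurable M"
  shows "(\<lambda>x. house (g x)) \<in> measurable M (unitary_borel n)"
proof (rule measurable_unitary_borelI)
  show "house (g x) \<in> unitary_group n" if "x \<in> space M" for x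
    using g that by auto
  fix i j assume ij: "i < n" "j < n"
  \<comment> \<open>Norm and Householder vector are rewritten as explicit functions of the entries
    of \<open>g x\<close>, which reduces the claim to arithmetic of measurable functions.\<close>
  define r where "r x = sqrt (\<Sum>k<n. (cmod (g x $ k))\<^sup>2)" for x
  have r [measurable]: "r \<in> borel_measurable M"
    unfolding r_def
    by (intro borel_measurable_sqrt[THEN measurable_compose_rev] borel_measurable_sum
       borel_measurable_power measurable_compose[OF m borel_measurable_norm]) auto
  define v where "v k x = g x $ k + (if k = 0 then phase (g x $ 0) * complex_of_real (r x) else 0)" for k x
  have v: "v k \<in> borel_measurable M" if "k < n" for k
  proof -
    have [measurable]: "(\<lambda>x. g x $ k) \<in> borel_measurable M" by (rule m) fact
    have [measurable]: "(\<lambda>x. g x $ 0) \<in> borel_measurable M" by (rule m) (use that in auto)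
    show ?thesis unfolding v_def by measurable
  qed
  note [measurable] = v[OF ij(1)] v[OF ij(2)]
  have [measurable]: "(\<lambda>x. g x $ 0) \<in> borel_measurable M" by (rule m) (use ij in auto)
  have [measurable]: "(\<lambda>x. \<Sum>k<n. (cmod (v k x))\<^sup>2) \<in> borel_measurable M"
    by (intro borel_measurable_sum borel_measurable_power measurable_compose[OF v borel_measurable_norm]) auto
  have "(\<lambda>x. ((if i = j then 1 else 0)
        - complex_of_real (2 / (\<Sum>k<n. (cmod (v k x))\<^sup>2)) * (v i x * cnj (v j x)))
        * (if j = 0 then - phase (g x $ 0) else 1)) \<in> borel_measurable M"
    by measurable
  also have "?this \<longleftrightarrow> (\<lambda>x. house (g x) $$ (i, j)) \<in> borel_measurable M"
  proof (intro measurable_cong)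
    fix x assume "x \<in> space M"
    then have d: "dim_vec (g x) = n" using g by auto
    have r: "norm2_vec (g x) = r x" by (simp add: norm2_vec_def r_def d)
    have v: "house_vec (g x) $ k = v k x" if "k < n" for k
      using that by (simp add: house_vec_def v_def d r)
    have "(norm2_vec (house_vec (g x)))\<^sup>2 = (\<Sum>k<n. (cmod (v k x))\<^sup>2)"
      unfolding norm2_vec_square by (simp add: d v)
    then show "((if i = j then 1 else 0)
        - complex_of_real (2 / (\<Sum>k<n. (cmod (v k x))\<^sup>2)) * (v i x * cnj (v j x)))
        * (if j = 0 then - phase (g x $ 0) else 1) = house (g x) $$ (i, j)"
      using ij by (simp add: house_index reflector_index d v)
  qed
  finally show "(\<lambda>x. house (g x) $$ (i, j)) \<in> borel_measurable M" .
qed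

lemma measurable_house_pair [measurable (raw)]:
  assumes [measurable]: "z \<in> borel_measurable M"
  shows "(\<lambda>x. house (pair_vec n (z x))) \<in> measurable M (unitary_borel n)"
proof (rule measurable_house)
  fix i assume i: "i < n"
  have "(\<lambda>x. if i = 0 then fst (z x) else if i = 1 then snd (z x) else 0) \<in> borel_measurable M"
    unfolding borel_prod[symmetric] using assms[folded borel_prod] by measurable
  then show "(\<lambda>x. pair_vec n (z x) $ i) \<in> borel_measurable M"
    using i by (simp add: pair_vec_def)
qed auto

lemma measurable_hmat:
  assumes w: "\<And>i. i \<in> {1..k} \<Longrightarrow> (\<lambda>x. w x i) \<in> borel_measurable M"
    and [measurable]: "t \<in> borel_measurable M"
  shows "(\<lambda>x. hmat k (w x) (t x)) \<in> measurable M (unitary_borel (Suc k))"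
  using w
proof (induction k)
  case 0
  have [measurable]: "(\<lambda>x. exp (\<i> * complex_of_real x)) \<in> borel_measurable borel"
    by (intro borel_measurable_continuous_onI continuous_intros)
  show ?case
    by (rule measurable_unitary_borelI) (use hmat_unitary[of 0] in \<open>auto simp: mat_diag_def\<close>)
next
  case (Suc k)
  have [measurable]: "(\<lambda>x. w x (Suc k)) \<in> borel_measurable M" by (rule Suc) auto
  have [measurable]: "(\<lambda>x. hmat k (w x) (t x)) \<in> measurable M (unitary_borel (Suc k))"
    by (rule Suc) (use Suc in auto)
  show ?case unfolding hmat.simps by measurable
qed

section \<open>Invariant integrals and uniqueness of Haar measure\<close>

lemma nn_integral_swap:
  assumes "prob_space M" "prob_space N"
    and "(\<lambda>(x, y). f x y) \<in> borel_measurable (M \<Otimes>\<^sub>M N)"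
  shows "(\<integral>\<^sup>+x. (\<integral>\<^sup>+y. f x y \<partial>N) \<partial>M) = (\<integral>\<^sup>+y. (\<integral>\<^sup>+x. f x y \<partial>M) \<partial>N)"
proof -
  interpret M: prob_space M by fact
  interpret N: prob_space N by fact
  interpret pair_sigma_finite M N ..
  show ?thesis using Fubini'[OF assms(3)] by simp
qed

lemma measurable_mult_unitary:
  assumes "V \<in> unitary_group n"
  shows "(\<lambda>X. V * X) \<in> measurable (unitary_borel n) (unitary_borel n)"
    and "(\<lambda>X. X * V) \<in> measurable (unitary_borel n) (unitary_borel n)"
  by (rule measurable_mat_mult; use assms in simp)+

lemma haar_measureD:
  assumes "haar_measure n \<nu>"
  shows "prob_space \<nu>" "sets \<nu> = sets (unitary_borel n)" "space \<nu> = unitary_group n"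
    and "V \<in> unitary_group n \<Longrightarrow> f \<in> borel_measurable (unitary_borel n) \<Longrightarrow>
      (\<integral>\<^sup>+X. f (V * X) \<partial>\<nu>) = (\<integral>\<^sup>+X. f X \<partial>\<nu>)"
    and "V \<in> unitary_group n \<Longrightarrow> f \<in> borel_measurable (unitary_borel n) \<Longrightarrow>
      (\<integral>\<^sup>+X. f (X * V) \<partial>\<nu>) = (\<integral>\<^sup>+X. f X \<partial>\<nu>)"
proof -
  show "prob_space \<nu>" and s [measurable_cong]: "sets \<nu> = sets (unitary_borel n)"
    using assms by (auto simp: haar_measure_def)
  from sets_eq_imp_space_eq[OF s] show "space \<nu> = unitary_group n" by simp
  { assume "V \<in> unitary_group n"
    note m = measurable_mult_unitary[OF this]
    assume f: "f \<in> borel_measurable (unitary_borel n)"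
    have "(\<integral>\<^sup>+X. f (V * X) \<partial>\<nu>) = (\<integral>\<^sup>+X. f X \<partial>distr \<nu> \<nu> (\<lambda>X. V * X))"
      using m(1) f by (subst nn_integral_distr) (simp_all cong: measurable_cong_sets add: s)
    then show "(\<integral>\<^sup>+X. f (V * X) \<partial>\<nu>) = (\<integral>\<^sup>+X. f X \<partial>\<nu>)"
      using assms \<open>V \<in> unitary_group n\<close> by (simp add: haar_measure_def)
    have "(\<integral>\<^sup>+X. f (X * V) \<partial>\<nu>) = (\<integral>\<^sup>+X. f X \<partial>distr \<nu> \<nu> (\<lambda>X. X * V))"
      using m(2) f by (subst nn_integral_distr) (simp_all cong: measurable_cong_sets add: s)
    then show "(\<integral>\<^sup>+X. f (X * V) \<partial>\<nu>) = (\<integral>\<^sup>+X. f X \<partial>\<nu>)"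
      using assms \<open>V \<in> unitary_group n\<close> by (simp add: haar_measure_def) }
qed

text \<open>Integrate \<open>f (Y * X)\<close> over both variables: left invariance of \<mu> removes
  Y, right invariance of \<nu> removes X after Fubini, and both total masses are 1.\<close>

lemma left_right_invariant_eq:
  assumes \<mu>: "prob_space \<mu>" and s\<mu> [measurable_cong]: "sets \<mu> = sets (unitary_borel n)"
    and \<nu>: "prob_space \<nu>" and s\<nu> [measurable_cong]: "sets \<nu> = sets (unitary_borel n)"
    and left: "\<And>V f. V \<in> unitary_group n \<Longrightarrow> f \<in> borel_measurable (unitary_borel n) \<Longrightarrow>
      (\<integral>\<^sup>+X. f (V * X) \<partial>\<mu>) = (\<integral>\<^sup>+X. f X \<partial>\<mu>)"
    and right: "\<And>V f. V \<in> unitary_group n \<Longrightarrow> f \<in> borel_measurable (unitary_borel n) \<Longrightarrow>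
      (\<integral>\<^sup>+X. f (X * V) \<partial>\<nu>) = (\<integral>\<^sup>+X. f X \<partial>\<nu>)"
  shows "\<mu> = \<nu>"
proof (rule measure_eqI)
  show "sets \<mu> = sets \<nu>" using s\<mu> s\<nu> by simp
  interpret \<mu>: prob_space \<mu> by fact
  interpret \<nu>: prob_space \<nu> by fact
  have sp: "space \<mu> = unitary_group n" "space \<nu> = unitary_group n"
    using s\<mu> s\<nu> by (auto dest!: sets_eq_imp_space_eq)
  fix A assume "A \<in> sets \<mu>"
  then have [measurable]: "A \<in> sets (unitary_borel n)" using s\<mu> by simp
  let ?f = "indicator A :: complex mat \<Rightarrow> ennreal"
  have "emeasure \<mu> A = (\<integral>\<^sup>+X. ?f X \<partial>\<mu>)" using \<open>A \<in> sets \<mu>\<close> by simp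
  also have "\<dots> = (\<integral>\<^sup>+Y. (\<integral>\<^sup>+X. ?f X \<partial>\<mu>) \<partial>\<nu>)" by (simp add: \<nu>.emeasure_space_1)
  also have "\<dots> = (\<integral>\<^sup>+Y. (\<integral>\<^sup>+X. ?f (Y * X) \<partial>\<mu>) \<partial>\<nu>)"
    by (intro nn_integral_cong left[symmetric]) (auto simp: sp)
  also have "\<dots> = (\<integral>\<^sup>+X. (\<integral>\<^sup>+Y. ?f (Y * X) \<partial>\<nu>) \<partial>\<mu>)"
    by (intro nn_integral_swap \<mu> \<nu>) measurable
  also have "\<dots> = (\<integral>\<^sup>+X. (\<integral>\<^sup>+Y. ?f Y \<partial>\<nu>) \<partial>\<mu>)"
    by (intro nn_integral_cong right) (auto simp: sp)
  also have "\<dots> = emeasure \<nu> A" using s\<nu> by (simp add: \<mu>.emeasure_space_1)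
  finally show "emeasure \<mu> A = emeasure \<nu> A" .
qed

lemma haar_measure_unique:
  assumes "haar_measure n \<mu>" "haar_measure n \<nu>"
  shows "\<mu> = \<nu>"
  using left_right_invariant_eq[OF haar_measureD(1,2)[OF assms(1)] haar_measureD(1,2)[OF assms(2)]
    haar_measureD(4)[OF assms(1)] haar_measureD(5)[OF assms(2)]] .

text \<open>Left invariance suffices: the image under inversion is right invariant, hence equal.\<close>

lemma haar_measureI:
  assumes \<mu>: "prob_space \<mu>" and s\<mu> [measurable_cong]: "sets \<mu> = sets (unitary_borel n)"
    and left: "\<And>V f. V \<in> unitary_group n \<Longrightarrow> f \<in> borel_measurable (unitary_borel n) \<Longrightarrow>
      (\<integral>\<^sup>+X. f (V * X) \<partial>\<mu>) = (\<integral>\<^sup>+X. f X \<partial>\<mu>)"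
  shows "haar_measure n \<mu>"
proof -
  interpret \<mu>: prob_space \<mu> by fact
  have sp: "space \<mu> = unitary_group n" using sets_eq_imp_space_eq[OF s\<mu>] by simp
  have [measurable]: "mat_adjoint \<in> measurable \<mu> (unitary_borel n)" by measurable
  have right: "(\<integral>\<^sup>+X. f (X * V) \<partial>distr \<mu> (unitary_borel n) mat_adjoint)
      = (\<integral>\<^sup>+X. f X \<partial>distr \<mu> (unitary_borel n) mat_adjoint)"
    if V: "V \<in> unitary_group n" and [measurable]: "f \<in> borel_measurable (unitary_borel n)" for V f
  proof -
    have [measurable]: "(\<lambda>_. V) \<in> measurable M (unitary_borel n)" for M :: "complex mat measure"
      using V by simp
    have "(\<integral>\<^sup>+X. f (X * V) \<partial>distr \<mu> (unitary_borel n) mat_adjoint) = (\<integral>\<^sup>+X. f (mat_adjoint X * V) \<partial>\<mu>)"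
      by (subst nn_integral_distr) auto
    \<comment> \<open>Taking adjoints turns a translation on the right into one on the left, where
      the hypothesis on \<mu> applies.\<close>
    also have "\<dots> = (\<integral>\<^sup>+X. f (mat_adjoint (mat_adjoint V * X)) \<partial>\<mu>)"
    proof (intro nn_integral_cong)
      fix X assume "X \<in> space \<mu>"
      then have "mat_adjoint (mat_adjoint V * X) = mat_adjoint X * V"
        using V unitaryD(1) by (subst mat_adjoint_mult[of _ n n _ n]) (auto simp: sp)
      then show "f (mat_adjoint X * V) = f (mat_adjoint (mat_adjoint V * X))" by simp
    qed
    also have "\<dots> = (\<integral>\<^sup>+X. f (mat_adjoint X) \<partial>\<mu>)"
      by (rule left[where f = "\<lambda>X. f (mat_adjoint X)"]) (use V in auto)
    also have "\<dots> = (\<integral>\<^sup>+X. f X \<partial>distr \<mu> (unitary_borel n) mat_adjoint)"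
      by (subst nn_integral_distr) auto
    finally show ?thesis .
  qed
  have eq: "\<mu> = distr \<mu> (unitary_borel n) mat_adjoint"
    by (rule left_right_invariant_eq[OF \<mu> s\<mu> \<mu>.prob_space_distr sets_distr left right]) auto
  have invI: "distr \<mu> \<mu> h = \<mu>"
    if h: "h \<in> measurable (unitary_borel n) (unitary_borel n)"
      and *: "\<And>f. f \<in> borel_measurable (unitary_borel n) \<Longrightarrow> (\<integral>\<^sup>+X. f (h X) \<partial>\<mu>) = (\<integral>\<^sup>+X. f X \<partial>\<mu>)" for h
  proof (rule measure_eqI)
    fix A assume A: "A \<in> sets (distr \<mu> \<mu> h)"
    then have [measurable]: "A \<in> sets (unitary_borel n)" using s\<mu> by simp
    note [measurable] = h
    have "emeasure (distr \<mu> \<mu> h) A = (\<integral>\<^sup>+X. indicator A X \<partial>distr \<mu> \<mu> h)"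
      using A by simp
    also have "\<dots> = (\<integral>\<^sup>+X. indicator A (h X) \<partial>\<mu>)"
      by (rule nn_integral_distr) auto
    also have "\<dots> = emeasure \<mu> A" using A by (subst *) auto
    finally show "emeasure (distr \<mu> \<mu> h) A = emeasure \<mu> A" .
  qed simp
  have right': "(\<integral>\<^sup>+X. f (X * V) \<partial>\<mu>) = (\<integral>\<^sup>+X. f X \<partial>\<mu>)"
    if "V \<in> unitary_group n" "f \<in> borel_measurable (unitary_borel n)" for V f
    using right[OF that] unfolding eq[symmetric] .
  show ?thesis
    unfolding haar_measure_def
  proof (intro conjI ballI \<mu> s\<mu>)
    fix V assume V: "V \<in> unitary_group n"
    then have [measurable]: "(\<lambda>_. V) \<in> measurable (unitary_borel n) (unitary_borel n)" by simp
    show "distr \<mu> \<mu> ((*) V) = \<mu>" by (rule invI[OF _ left[OF V]]) auto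
    show "distr \<mu> \<mu> (\<lambda>X. X * V) = \<mu>" by (rule invI[OF _ right'[OF V]]) auto
  qed
qed

section \<open>Gaussian vectors\<close>

text \<open>Lebesgue measure is characterised by the volumes of boxes, and a complex box is the
  product of two real intervals. This allows the Gaussian law, defined by its real and imaginary
  parts, to be given a density on the complex plane.\<close>

lemma lborel_complex: "lborel = distr (lborel \<Otimes>\<^sub>M lborel) borel (\<lambda>(x, y). Complex x y)"
proof (rule lborel_eqI)
  have [measurable]: "(\<lambda>(x, y). Complex x y) \<in> borel_measurable (lborel \<Otimes>\<^sub>M lborel)"
  proof -
    have "(\<lambda>(x, y). Complex x y) = (\<lambda>p. complex_of_real (fst p) + \<i> * complex_of_real (snd p))"
      by (auto simp: complex_eq_iff)
    also have "\<dots> \<in> borel_measurable (lborel \<Otimes>\<^sub>M lborel)" by measurable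
    finally show ?thesis .
  qed
  fix l u :: complex assume *: "\<And>b. b \<in> Basis \<Longrightarrow> l \<bullet> b \<le> u \<bullet> b"
  have "(\<lambda>(x, y). Complex x y) -` box l u = {Re l<..<Re u} \<times> {Im l<..<Im u}"
    by (auto simp: in_box_complex_iff)
  then have "emeasure (distr (lborel \<Otimes>\<^sub>M lborel) borel (\<lambda>(x, y). Complex x y)) (box l u)
      = emeasure (lborel \<Otimes>\<^sub>M lborel) ({Re l<..<Re u} \<times> {Im l<..<Im u})"
    by (subst emeasure_distr) (auto simp: space_pair_measure)
  also have "\<dots> = ennreal ((Re u - Re l) * (Im u - Im l))"
    using *[of 1] *[of \<i>]
    by (subst lborel.emeasure_pair_measure_Times) (auto simp: Basis_complex_def inner_complex_def ennreal_mult)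
  also have "(Re u - Re l) * (Im u - Im l) = (\<Prod>b\<in>Basis. (u - l) \<bullet> b)"
    by (simp add: Basis_complex_def inner_complex_def)
  finally show "emeasure (distr (lborel \<Otimes>\<^sub>M lborel) borel (\<lambda>(x, y). Complex x y)) (box l u)
      = (\<Prod>b\<in>Basis. (u - l) \<bullet> b)" .
qed simp

lemma measurable_Complex: "(\<lambda>(x, y). Complex x y) \<in> borel_measurable (borel \<Otimes>\<^sub>M borel)"
proof -
  have "(\<lambda>(x, y). Complex x y) = (\<lambda>p. complex_of_real (fst p) + \<i> * complex_of_real (snd p))"
    by (auto simp: complex_eq_iff)
  also have "\<dots> \<in> borel_measurable (borel \<Otimes>\<^sub>M borel)" by measurable
  finally show ?thesis .
qed

definition complex_normal_density :: "complex \<Rightarrow> real" where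
  "complex_normal_density z = exp (- (cmod z)\<^sup>2) / pi"

text \<open>Variance 1/2 in each coordinate gives the density exp(-x^2) / sqrt pi; the product of
  two such factors depends on the modulus alone.\<close>

lemma complex_normal_eq_density:
  "complex_normal 0 1 = density lborel (\<lambda>z. ennreal (complex_normal_density z))"
proof -
  let ?n = "normal_density 0 (sqrt (1 / 2))"
  note [measurable] = measurable_Complex
  have C [measurable]: "(\<lambda>(x, y). Complex x y) \<in> measurable (lborel \<Otimes>\<^sub>M lborel) borel"
    by measurable
  have [measurable]: "complex_normal_density \<in> borel_measurable borel"
    unfolding complex_normal_density_def[abs_def] by measurable
  interpret prob_space "density lborel ?n"
    by (rule prob_space_normal_density) simp
  have "density lborel ?n \<Otimes>\<^sub>M density lborel ?n
      = density (lborel \<Otimes>\<^sub>M lborel) (\<lambda>(x, y). ennreal (?n x) * ennreal (?n y))"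
    by (rule pair_measure_density) (auto intro: sigma_finite_measure_axioms lborel.sigma_finite_measure_axioms)
  also have "(\<lambda>(x, y). ennreal (?n x) * ennreal (?n y))
      = (\<lambda>p. ennreal (complex_normal_density ((\<lambda>(x, y). Complex x y) p)))"
  proof
    fix p :: "real \<times> real"
    obtain x y where p: "p = (x, y)" by (cases p)
    have "?n x * ?n y = complex_normal_density (Complex x y)"
      by (simp add: normal_density_def complex_normal_density_def cmod_power2 mult_exp_exp)
    then show "(case p of (x, y) \<Rightarrow> ennreal (?n x) * ennreal (?n y))
        = ennreal (complex_normal_density (case p of (x, y) \<Rightarrow> Complex x y))"
      by (simp add: p ennreal_mult[symmetric])
  qed
  finally have "distr (density lborel ?n \<Otimes>\<^sub>M density lborel ?n) borel (\<lambda>(x, y). Complex x y)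
      = distr (density (lborel \<Otimes>\<^sub>M lborel) (\<lambda>p. ennreal (complex_normal_density ((\<lambda>(x, y). Complex x y) p))))
          borel (\<lambda>(x, y). Complex x y)"
    by simp
  also have "\<dots> = density (distr (lborel \<Otimes>\<^sub>M lborel) borel (\<lambda>(x, y). Complex x y)) (\<lambda>z. ennreal (complex_normal_density z))"
    by (rule density_distr[symmetric]) measurable
  finally show ?thesis
    by (simp add: complex_normal_def real_normal_def lborel_complex[symmetric])
qed

lemma measurable_complex_normal_density [measurable]:
  "complex_normal_density \<in> borel_measurable borel"
  unfolding complex_normal_density_def[abs_def] by measurable

lemma sets_complex_normal [simp, measurable_cong]: "sets (complex_normal \<mu> v) = sets borel"
  by (simp add: complex_normal_def)

lemma space_complex_normal [simp]: "space (complex_normal \<mu> v) = UNIV"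
  by (simp add: complex_normal_def)

lemma prob_space_complex_normal: "prob_space (complex_normal 0 1)"
proof -
  interpret R: prob_space "real_normal 0 (1 / 2)"
    unfolding real_normal_def by (rule prob_space_normal_density) simp
  interpret P: pair_prob_space "real_normal 0 (1 / 2)" "real_normal 0 (1 / 2)" ..
  have [measurable_cong]: "sets (real_normal 0 (1 / 2)) = sets borel" by (simp add: real_normal_def)
  note [measurable] = measurable_Complex
  have "prob_space (distr (real_normal 0 (1 / 2) \<Otimes>\<^sub>M real_normal 0 (1 / 2)) borel (\<lambda>(x, y). Complex x y))"
    by (rule P.prob_space_distr) measurable
  then show ?thesis
    by (simp add: complex_normal_def)
qed

lemma complex_normal_null: "AE z in complex_normal 0 1. z \<noteq> 0"
proof -
  have "AE z in (lborel :: complex measure). z \<noteq> 0"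
    by (rule AE_lborel_singleton)
  then show ?thesis
    unfolding complex_normal_eq_density by (subst AE_density) auto
qed

text \<open>Samples are functions on \<open>{..<n}\<close>, so that the theory of product measures
  applies; \<open>Matrix.vec n\<close> turns them into vectors.\<close>

definition gauss :: "nat \<Rightarrow> (nat \<Rightarrow> complex) measure" where
  "gauss n = Pi\<^sub>M {..<n} (\<lambda>_. complex_normal 0 1)"

lemma sets_gauss [measurable_cong]: "sets (gauss n) = sets (Pi\<^sub>M {..<n} (\<lambda>_. borel))"
  unfolding gauss_def by (intro sets_PiM_cong) auto

lemma prob_space_gauss: "prob_space (gauss n)"
  unfolding gauss_def by (intro prob_space_PiM prob_space_complex_normal)

interpretation lborel_product: product_sigma_finite "\<lambda>_ :: nat. lborel :: complex measure"
  by standard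

section \<open>Lebesgue measure on complex n-space and unitary invariance of Gaussian
  vectors\<close>

definition lebesgue_vec :: "nat \<Rightarrow> (nat \<Rightarrow> complex) measure" where
  "lebesgue_vec n = Pi\<^sub>M {..<n} (\<lambda>_. lborel)"

lemma sets_lebesgue_vec [measurable_cong]: "sets (lebesgue_vec n) = sets (Pi\<^sub>M {..<n} (\<lambda>_. borel))"
  unfolding lebesgue_vec_def by (intro sets_PiM_cong) auto

lemma space_lebesgue_vec: "space (lebesgue_vec n) = space (Pi\<^sub>M {..<n} (\<lambda>_. borel))"
  by (rule sets_eq_imp_space_eq[OF sets_lebesgue_vec])

lemma sigma_finite_lebesgue_vec: "sigma_finite_measure (lebesgue_vec n)"
  unfolding lebesgue_vec_def by (rule lborel_product.sigma_finite) simp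

text \<open>A product measure is determined on boxes, and the preimage of a box under a translation
  is the box with translated sides; the claim thus reduces to one coordinate.\<close>

lemma lebesgue_vec_translate:
  fixes h :: "(nat \<Rightarrow> complex) \<Rightarrow> ennreal"
  assumes [measurable]: "h \<in> borel_measurable (Pi\<^sub>M {..<n} (\<lambda>_. borel))"
  shows "(\<integral>\<^sup>+x. h (\<lambda>i\<in>{..<n}. x i + c i) \<partial>lebesgue_vec n) = (\<integral>\<^sup>+x. h x \<partial>lebesgue_vec n)"
proof -
  let ?t = "\<lambda>x. \<lambda>i\<in>{..<n}. x i + c i"
  have t [measurable]: "?t \<in> measurable (lebesgue_vec n) (Pi\<^sub>M {..<n} (\<lambda>_. lborel))"
    by (rule measurable_restrict) (simp add: lebesgue_vec_def)
  have "distr (lebesgue_vec n) (Pi\<^sub>M {..<n} (\<lambda>_. lborel)) ?t = Pi\<^sub>M {..<n} (\<lambda>_. lborel)"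
  proof (rule lborel_product.PiM_eqI)
    fix A :: "nat \<Rightarrow> complex set" assume A: "\<And>i. i \<in> {..<n} \<Longrightarrow> A i \<in> sets lborel"
    have tr: "emeasure lborel ((\<lambda>z. z + c i) -` A i) = emeasure lborel (A i)" if "i < n" for i
    proof -
      have "emeasure lborel (A i) = emeasure (distr lborel borel ((+) (c i))) (A i)"
        by (simp add: lborel_distr_plus)
      also have "\<dots> = emeasure lborel ((\<lambda>z. z + c i) -` A i)"
        using A[of i] that by (subst emeasure_distr) (auto simp: add.commute[of "c i"] vimage_def)
      finally show ?thesis by simp
    qed
    have "?t -` (Pi\<^sub>E {..<n} A) \<inter> space (lebesgue_vec n) = Pi\<^sub>E {..<n} (\<lambda>i. (\<lambda>z. z + c i) -` A i)"
      by (auto simp: space_lebesgue_vec space_PiM PiE_iff)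
    then have "emeasure (distr (lebesgue_vec n) (Pi\<^sub>M {..<n} (\<lambda>_. lborel)) ?t) (Pi\<^sub>E {..<n} A)
       = emeasure (lebesgue_vec n) (Pi\<^sub>E {..<n} (\<lambda>i. (\<lambda>z. z + c i) -` A i))"
      using A by (subst emeasure_distr[OF t]) (auto intro!: sets_PiM_I_finite)
    also have "\<dots> = (\<Prod>i<n. emeasure lborel ((\<lambda>z. z + c i) -` A i))"
      unfolding lebesgue_vec_def
    proof (rule lborel_product.emeasure_PiM)
      fix i assume "i \<in> {..<n}"
      then have [measurable]: "A i \<in> sets borel" using A by simp
      have "(\<lambda>z. z + c i) -` A i \<inter> space borel \<in> sets borel" by measurable
      then show "(\<lambda>z. z + c i) -` A i \<in> sets lborel" by simp
    qed simp
    finally show "emeasure (distr (lebesgue_vec n) (Pi\<^sub>M {..<n} (\<lambda>_. lborel)) ?t) (Pi\<^sub>E {..<n} A)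
       = (\<Prod>i<n. emeasure lborel (A i))"
      by (simp add: tr)
  qed auto
  then have "(\<integral>\<^sup>+x. h x \<partial>lebesgue_vec n)
      = (\<integral>\<^sup>+x. h x \<partial>distr (lebesgue_vec n) (Pi\<^sub>M {..<n} (\<lambda>_. lborel)) ?t)"
    by (simp add: lebesgue_vec_def)
  also have "\<dots> = (\<integral>\<^sup>+x. h (?t x) \<partial>lebesgue_vec n)"
    by (rule nn_integral_distr[OF t]) simp
  finally show ?thesis by simp
qed

text \<open>Points of \<open>Pi\<^sub>M\<close> are extensional functions, hence the restriction to
  \<open>{..<n}\<close>.\<close>

definition mat_act :: "nat \<Rightarrow> complex mat \<Rightarrow> (nat \<Rightarrow> complex) \<Rightarrow> nat \<Rightarrow> complex" where
  "mat_act n V x = (\<lambda>i\<in>{..<n}. (V *\<^sub>v Matrix.vec n x) $ i)"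

lemma vec_mat_act:
  assumes "V \<in> carrier_mat n n"
  shows "Matrix.vec n (mat_act n V x) = V *\<^sub>v Matrix.vec n x"
  using assms by (intro eq_vecI) (auto simp: mat_act_def)

lemma mat_act_extensional: "mat_act n V x \<in> extensional {..<n}"
  by (simp add: mat_act_def)

lemma extensional_vec_eqI:
  assumes "x \<in> extensional {..<n}" "y \<in> extensional {..<n}" "Matrix.vec n x = Matrix.vec n y"
  shows "x = y"
proof (rule extensionalityI[OF assms(1,2)])
  fix i assume "i \<in> {..<n}"
  then show "x i = y i" using arg_cong[OF assms(3), of "\<lambda>v. v $ i"] by simp
qed

lemma measurable_mat_act [measurable]:
  assumes V: "V \<in> carrier_mat n n"
  shows "mat_act n V \<in> measurable (Pi\<^sub>M {..<n} (\<lambda>_. borel)) (Pi\<^sub>M {..<n} (\<lambda>_. borel))"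
  unfolding mat_act_def[abs_def]
proof (rule measurable_restrict)
  fix i assume i: "i \<in> {..<n}"
  have "(\<lambda>x. \<Sum>j = 0..<n. V $$ (i, j) * x j) \<in> borel_measurable (Pi\<^sub>M {..<n} (\<lambda>_. borel))"
    by (intro borel_measurable_sum borel_measurable_times measurable_const measurable_component_singleton) auto
  also have "?this \<longleftrightarrow> (\<lambda>x. (V *\<^sub>v Matrix.vec n x) $ i) \<in> borel_measurable (Pi\<^sub>M {..<n} (\<lambda>_. borel))"
    using V i by (intro measurable_cong) (auto simp: scalar_prod_def intro!: sum.cong)
  finally show "(\<lambda>x. (V *\<^sub>v Matrix.vec n x) $ i) \<in> borel_measurable (Pi\<^sub>M {..<n} (\<lambda>_. borel))" .
qed

definition gauss_weight :: "nat \<Rightarrow> (nat \<Rightarrow> complex) \<Rightarrow> ennreal" where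
  "gauss_weight n x = (\<Prod>i<n. ennreal (complex_normal_density (x i)))"

text \<open>The weight is a function of the norm, which is what makes it invariant under unitary
  matrices.\<close>

lemma gauss_weight_eq:
  "gauss_weight n x = ennreal ((1 / pi) ^ n * exp (- (norm2_vec (Matrix.vec n x))\<^sup>2))"
  unfolding gauss_weight_def norm2_vec_square complex_normal_density_def
  by (subst prod_ennreal) (auto simp: prod_dividef exp_sum sum_negf[symmetric] power_one_over)

lemma measurable_gauss_weight [measurable]:
  "gauss_weight n \<in> borel_measurable (Pi\<^sub>M {..<n} (\<lambda>_. borel))"
  unfolding gauss_weight_def[abs_def] by measurable

lemma gauss_eq_density: "gauss n = density (lebesgue_vec n) (gauss_weight n)"
proof -
  interpret N: prob_space "complex_normal 0 1" by (rule prob_space_complex_normal)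
  interpret product_sigma_finite "\<lambda>_ :: nat. complex_normal 0 1" ..
  show ?thesis
    unfolding gauss_def
  proof (rule PiM_eqI[symmetric])
    show "sets (density (lebesgue_vec n) (gauss_weight n)) = sets (Pi\<^sub>M {..<n} (\<lambda>_. complex_normal 0 1))"
      using sets_lebesgue_vec[of n] sets_gauss[of n] by (simp add: gauss_def)
    fix A :: "nat \<Rightarrow> complex set" assume A: "\<And>i. i \<in> {..<n} \<Longrightarrow> A i \<in> sets (complex_normal 0 1)"
    then have A': "i < n \<Longrightarrow> A i \<in> sets borel" for i by simp
    have PA [measurable]: "Pi\<^sub>E {..<n} A \<in> sets (Pi\<^sub>M {..<n} (\<lambda>_. borel))"
      by (rule sets_PiM_I_finite) (simp_all add: A')
    have "emeasure (density (lebesgue_vec n) (gauss_weight n)) (Pi\<^sub>E {..<n} A)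
       = (\<integral>\<^sup>+x. gauss_weight n x * indicator (Pi\<^sub>E {..<n} A) x \<partial>lebesgue_vec n)"
      by (rule emeasure_density)
         (simp_all add: measurable_cong_sets[OF sets_lebesgue_vec refl] sets_lebesgue_vec PA)
    also have "\<dots> = (\<integral>\<^sup>+x. (\<Prod>i<n. ennreal (complex_normal_density (x i)) * indicator (A i) (x i)) \<partial>lebesgue_vec n)"
    proof (intro nn_integral_cong)
      fix x assume "x \<in> space (lebesgue_vec n)"
      then have "indicator (Pi\<^sub>E {..<n} A) x = (\<Prod>i<n. indicator (A i) (x i) :: ennreal)"
        by (auto simp: space_lebesgue_vec space_PiM PiE_iff indicator_def prod_zero_iff)
      then show "gauss_weight n x * indicator (Pi\<^sub>E {..<n} A) x
         = (\<Prod>i<n. ennreal (complex_normal_density (x i)) * indicator (A i) (x i))"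
        by (simp add: gauss_weight_def prod.distrib)
    qed
    also have "\<dots> = (\<Prod>i<n. \<integral>\<^sup>+z. ennreal (complex_normal_density z) * indicator (A i) z \<partial>lborel)"
      unfolding lebesgue_vec_def
    proof (rule lborel_product.product_nn_integral_prod)
      fix i assume "i \<in> {..<n}"
      then have [measurable]: "A i \<in> sets borel" using A' by simp
      show "(\<lambda>z. ennreal (complex_normal_density z) * indicator (A i) z) \<in> borel_measurable lborel"
        by measurable
    qed simp
    also have "\<dots> = (\<Prod>i<n. emeasure (complex_normal 0 1) (A i))"
      unfolding complex_normal_eq_density
      by (intro prod.cong refl emeasure_density[symmetric]) (simp_all add: A')
    finally show "emeasure (density (lebesgue_vec n) (gauss_weight n)) (Pi\<^sub>E {..<n} A)
       = (\<Prod>i<n. emeasure (complex_normal 0 1) (A i))" .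
  qed simp
qed

lemma nn_integral_gauss_weight: "(\<integral>\<^sup>+x. gauss_weight n x \<partial>lebesgue_vec n) = 1"
proof -
  interpret prob_space "gauss n" by (rule prob_space_gauss)
  have "1 = emeasure (gauss n) (space (gauss n))" by (simp add: emeasure_space_1)
  also have "\<dots> = (\<integral>\<^sup>+x. gauss_weight n x * indicator (space (lebesgue_vec n)) x \<partial>lebesgue_vec n)"
    unfolding gauss_eq_density space_density by (rule emeasure_density) auto
  also have "\<dots> = (\<integral>\<^sup>+x. gauss_weight n x \<partial>lebesgue_vec n)"
    by (intro nn_integral_cong) simp
  finally show ?thesis by simp
qed

text \<open>
  Both Lebesgue measure and its image under \<open>V\<close> are translation invariant and give the rotation
  invariant weight \<^term>\<open>gauss_weight n\<close> the same total mass, so Fubini shows that they agree.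
\<close>

lemma lebesgue_vec_unitary:
  fixes h :: "(nat \<Rightarrow> complex) \<Rightarrow> ennreal"
  assumes V: "V \<in> unitary_group n"
    and h [measurable]: "h \<in> borel_measurable (Pi\<^sub>M {..<n} (\<lambda>_. borel))"
  shows "(\<integral>\<^sup>+x. h (mat_act n V x) \<partial>lebesgue_vec n) = (\<integral>\<^sup>+x. h x \<partial>lebesgue_vec n)"
proof -
  note Vc = unitaryD(1)[OF V]
  let ?L = "lebesgue_vec n" and ?T = "mat_act n V" and ?w = "gauss_weight n"
  let ?B = "Pi\<^sub>M {..<n} (\<lambda>_. borel :: complex measure)"
  define add where "add x y = (\<lambda>i\<in>{..<n}. x i + y i :: complex)" for x y :: "nat \<Rightarrow> complex"
  define neg where "neg x = (\<lambda>i\<in>{..<n}. - x i :: complex)" for x :: "nat \<Rightarrow> complex"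
  note [measurable] = measurable_mat_act[OF Vc]
  have T' [measurable]: "(\<lambda>x. ?T (f x)) \<in> measurable M ?B" if "f \<in> measurable M ?B" for f and M :: "'c measure"
    by (rule measurable_compose[OF that measurable_mat_act[OF Vc]])
  have [measurable (raw)]: "(\<lambda>x. add (f x) (g x)) \<in> measurable M ?B"
    if [measurable]: "f \<in> measurable M ?B" "g \<in> measurable M ?B" for f g and M :: "'c measure"
    unfolding add_def by measurable
  have [measurable (raw)]: "(\<lambda>x. neg (f x)) \<in> measurable M ?B"
    if [measurable]: "f \<in> measurable M ?B" for f and M :: "'c measure"
    unfolding neg_def by measurable
  have add_ext [simp]: "add x y \<in> extensional {..<n}" for x y by (simp add: add_def)
  have vec_add: "Matrix.vec n (add x y) = Matrix.vec n x + Matrix.vec n y" for x y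
    by (intro eq_vecI) (auto simp: add_def)
  have in_space: "x \<in> extensional {..<n}" if "x \<in> space ?L" for x
    using that by (simp add: space_lebesgue_vec space_PiM PiE_def)
  interpret L: sigma_finite_measure ?L by (rule sigma_finite_lebesgue_vec)
  interpret LL: pair_sigma_finite ?L ?L ..
  have P: "(\<integral>\<^sup>+x. f (add x c) \<partial>?L) = (\<integral>\<^sup>+x. f x \<partial>?L)" if "f \<in> borel_measurable ?B" for f c
    unfolding add_def by (rule lebesgue_vec_translate[OF that])
  \<comment> \<open>A translation by c after V equals V after the translation by
    \<open>mat_adjoint V\<close> c, and Lebesgue measure does not notice the latter.\<close>
  have Q: "(\<integral>\<^sup>+x. f (add (?T x) c) \<partial>?L) = (\<integral>\<^sup>+x. f (?T x) \<partial>?L)"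
    if [measurable]: "f \<in> borel_measurable ?B" for f c
  proof -
    have "add (?T x) c = ?T (add x (mat_act n (mat_adjoint V) c))" for x
    proof (rule extensional_vec_eqI[of _ n])
      have "V *\<^sub>v (mat_adjoint V *\<^sub>v Matrix.vec n c) = Matrix.vec n c"
        using Vc unitaryD(3)[OF V] by (subst assoc_mult_mat_vec[symmetric]) auto
      then show "Matrix.vec n (add (?T x) c) = Matrix.vec n (?T (add x (mat_act n (mat_adjoint V) c)))"
        using Vc mat_adjoint_carrier[OF Vc]
        by (simp add: vec_add vec_mat_act mult_add_distrib_mat_vec[OF Vc vec_carrier mult_mat_vec_carrier[OF _ vec_carrier]])
    qed (simp_all add: mat_act_extensional)
    then show ?thesis
      using P[of "\<lambda>x. f (?T x)" "mat_act n (mat_adjoint V) c"] by simp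
  qed
  have wT: "?w (?T x) = ?w x" for x
    by (simp add: gauss_weight_eq vec_mat_act[OF Vc] unitary_norm2_vec[OF V])
  have wneg: "?w (add x (neg y)) = ?w (add y (neg x))" for x y
    unfolding gauss_weight_def
    by (intro prod.cong refl) (auto simp: add_def neg_def complex_normal_density_def norm_minus_commute)
  have h' [measurable (raw)]: "(\<lambda>x. h (f x)) \<in> borel_measurable M" if "f \<in> measurable M ?B" for f and M :: "'c measure"
    by (rule measurable_compose[OF that h])
  have w' [measurable (raw)]: "(\<lambda>x. ?w (f x)) \<in> borel_measurable M" if "f \<in> measurable M ?B" for f and M :: "'c measure"
    by (rule measurable_compose[OF that measurable_gauss_weight])
  have fs [measurable]: "fst \<in> measurable (?L \<Otimes>\<^sub>M ?L) ?B" "snd \<in> measurable (?L \<Otimes>\<^sub>M ?L) ?B"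
    "(\<lambda>x. x) \<in> measurable ?L ?B"
    by (auto simp: measurable_cong_sets[OF _ sets_lebesgue_vec[symmetric]])
  have "(\<integral>\<^sup>+y. h (?T y) \<partial>?L) = (\<integral>\<^sup>+x. ?w x \<partial>?L) * (\<integral>\<^sup>+y. h (?T y) \<partial>?L)"
    by (simp add: nn_integral_gauss_weight)
  also have "\<dots> = (\<integral>\<^sup>+x. ?w x * (\<integral>\<^sup>+y. h (?T y) \<partial>?L) \<partial>?L)"
    by (rule nn_integral_multc[symmetric]) measurable
  \<comment> \<open>By \<open>Q\<close> the inner integral is unchanged when \<open>?T y\<close> is
    shifted by x; this couples the two variables before Fubini is applied.\<close>
  also have "\<dots> = (\<integral>\<^sup>+x. ?w x * (\<integral>\<^sup>+y. h (add (?T y) x) \<partial>?L) \<partial>?L)"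
    by (simp add: Q)
  also have "\<dots> = (\<integral>\<^sup>+x. (\<integral>\<^sup>+y. ?w x * h (add (?T y) x) \<partial>?L) \<partial>?L)"
    by (intro nn_integral_cong nn_integral_cmult[symmetric]) measurable
  also have "\<dots> = (\<integral>\<^sup>+y. (\<integral>\<^sup>+x. ?w x * h (add (?T y) x) \<partial>?L) \<partial>?L)"
    by (rule LL.Fubini') measurable
  \<comment> \<open>Translating x by - \<open>?T y\<close> frees the argument of h from y and moves
    the dependence into the weight.\<close>
  also have "\<dots> = (\<integral>\<^sup>+y. (\<integral>\<^sup>+x. ?w (add x (neg (?T y))) * h x \<partial>?L) \<partial>?L)"
  proof (rule nn_integral_cong)
    fix y
    have "(\<integral>\<^sup>+x. ?w x * h (add (?T y) x) \<partial>?L)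
        = (\<integral>\<^sup>+x. ?w (add x (neg (?T y))) * h (add (?T y) (add x (neg (?T y)))) \<partial>?L)"
      by (rule P[symmetric, of "\<lambda>x. ?w x * h (add (?T y) x)"])
         (auto intro!: borel_measurable_times simp: add_def)
    also have "\<dots> = (\<integral>\<^sup>+x. ?w (add x (neg (?T y))) * h x \<partial>?L)"
    proof (intro nn_integral_cong)
      fix x assume "x \<in> space ?L"
      then have "add (?T y) (add x (neg (?T y))) = x"
        by (intro extensionalityI[of _ "{..<n}"]) (auto simp: in_space add_def neg_def)
      then show "?w (add x (neg (?T y))) * h (add (?T y) (add x (neg (?T y)))) = ?w (add x (neg (?T y))) * h x"
        by simp
    qed
    finally show "(\<integral>\<^sup>+x. ?w x * h (add (?T y) x) \<partial>?L) = (\<integral>\<^sup>+x. ?w (add x (neg (?T y))) * h x \<partial>?L)" .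
  qed
  also have "\<dots> = (\<integral>\<^sup>+x. (\<integral>\<^sup>+y. ?w (add x (neg (?T y))) * h x \<partial>?L) \<partial>?L)"
    by (rule LL.Fubini') measurable
  \<comment> \<open>The weight is even, so the signs may be exchanged. Then \<open>Q\<close> removes
    x from the inner integral, which becomes the total mass 1 of the weight.\<close>
  also have "\<dots> = (\<integral>\<^sup>+x. (\<integral>\<^sup>+y. ?w (add (?T y) (neg x)) \<partial>?L) * h x \<partial>?L)"
    unfolding wneg[of _ "?T _"]
    by (intro nn_integral_cong nn_integral_multc) (auto simp: add_def)
  also have "\<dots> = (\<integral>\<^sup>+x. h x \<partial>?L)"
    by (simp add: Q wT nn_integral_gauss_weight)
  finally show ?thesis .
qed

lemma gauss_unitary:
  fixes F :: "complex vec \<Rightarrow> ennreal"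
  assumes V: "V \<in> unitary_group n"
    and F [measurable]: "(\<lambda>x. F (Matrix.vec n x)) \<in> borel_measurable (Pi\<^sub>M {..<n} (\<lambda>_. borel))"
  shows "(\<integral>\<^sup>+x. F (V *\<^sub>v Matrix.vec n x) \<partial>gauss n) = (\<integral>\<^sup>+x. F (Matrix.vec n x) \<partial>gauss n)"
proof -
  note Vc = unitaryD(1)[OF V]
  note [measurable] = measurable_mat_act[OF Vc]
  have wT: "gauss_weight n (mat_act n V x) = gauss_weight n x" for x
    by (simp add: gauss_weight_eq vec_mat_act[OF Vc] unitary_norm2_vec[OF V])
  have FT [measurable]: "(\<lambda>x. F (V *\<^sub>v Matrix.vec n x)) \<in> borel_measurable (Pi\<^sub>M {..<n} (\<lambda>_. borel))"
    using measurable_compose[OF measurable_mat_act[OF Vc] F] by (simp add: vec_mat_act[OF Vc])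
  have "(\<integral>\<^sup>+x. F (V *\<^sub>v Matrix.vec n x) \<partial>gauss n)
      = (\<integral>\<^sup>+x. gauss_weight n x * F (V *\<^sub>v Matrix.vec n x) \<partial>lebesgue_vec n)"
    unfolding gauss_eq_density by (rule nn_integral_density) measurable
  also have "\<dots> = (\<integral>\<^sup>+x. gauss_weight n (mat_act n V x) * F (Matrix.vec n (mat_act n V x)) \<partial>lebesgue_vec n)"
    by (simp add: wT vec_mat_act[OF Vc])
  also have "\<dots> = (\<integral>\<^sup>+x. gauss_weight n x * F (Matrix.vec n x) \<partial>lebesgue_vec n)"
    by (rule lebesgue_vec_unitary[OF V]) measurable
  also have "\<dots> = (\<integral>\<^sup>+x. F (Matrix.vec n x) \<partial>gauss n)"
    unfolding gauss_eq_density by (rule nn_integral_density[symmetric]) measurable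
  finally show ?thesis .
qed

text \<open>Already the entry 0 is almost surely nonzero. Householder matrices have the prescribed
  first column only for nonzero vectors.\<close>

lemma gauss_nonzero: "AE x in gauss (Suc n). norm2_vec (Matrix.vec (Suc n) x) \<noteq> 0"
proof -
  have "AE x in gauss (Suc n). x 0 \<noteq> 0"
    unfolding gauss_def
    by (rule AE_PiM_component[where i = 0 and P = "\<lambda>z. z \<noteq> 0"])
       (auto intro: prob_space_complex_normal complex_normal_null)
  then show ?thesis by eventually_elim (auto simp: norm2_vec_eq_0)
qed

text \<open>The Gaussians in \<open>chi2_complex\<close> are numbered from 1, those of
  \<open>gauss\<close> from 0; the proof is the reindexing.\<close>

lemma distr_gauss_norm: "distr (gauss k) borel (\<lambda>x. (norm2_vec (Matrix.vec k x))\<^sup>2) = chi2_complex k"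
proof -
  let ?K = "Pi\<^sub>M {1..k} (\<lambda>_. complex_normal 0 1)" and ?r = "\<lambda>x. \<lambda>i\<in>{..<k}. x (Suc i)"
  have r [measurable]: "?r \<in> measurable ?K (gauss k)"
    unfolding gauss_def by measurable
  have "gauss k = distr ?K (gauss k) ?r"
    unfolding gauss_def
    using distr_PiM_reindex[of "{1..k}" "\<lambda>_. complex_normal 0 1" Suc "{..<k}"]
    by (auto simp: prob_space_complex_normal)
  then have "distr (gauss k) borel (\<lambda>x. (norm2_vec (Matrix.vec k x))\<^sup>2)
      = distr (distr ?K (gauss k) ?r) borel (\<lambda>x. (norm2_vec (Matrix.vec k x))\<^sup>2)" by simp
  also have "\<dots> = distr ?K borel ((\<lambda>x. (norm2_vec (Matrix.vec k x))\<^sup>2) \<circ> ?r)"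
  proof (rule distr_distr[OF _ r])
    have "(\<lambda>x. \<Sum>i<k. (cmod (x i))\<^sup>2) \<in> borel_measurable (gauss k)" by measurable
    then show "(\<lambda>x. (norm2_vec (Matrix.vec k x))\<^sup>2) \<in> borel_measurable (gauss k)"
      by (simp add: norm2_vec_square)
  qed
  also have "(\<lambda>x. (norm2_vec (Matrix.vec k x))\<^sup>2) \<circ> ?r = (\<lambda>x. \<Sum>i = 1..k. (cmod (x i))\<^sup>2)"
  proof
    fix x :: "nat \<Rightarrow> complex"
    have "(\<Sum>i<k. (cmod (x (Suc i)))\<^sup>2) = (\<Sum>i = 1..k. (cmod (x i))\<^sup>2)"
      by (rule sum.reindex_bij_witness[of _ "\<lambda>i. i - 1" Suc]) auto
    then show "((\<lambda>x. (norm2_vec (Matrix.vec k x))\<^sup>2) \<circ> ?r) x = (\<Sum>i = 1..k. (cmod (x i))\<^sup>2)"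
      by (simp add: norm2_vec_square)
  qed
  finally show ?thesis by (simp add: chi2_complex_def)
qed

text \<open>The coordinate split off is the one with index 0, since it is the coordinate that
  \<open>1 \<oplus> W\<close> fixes. The remaining indices 1 to k have to be shifted down to recover
  \<open>gauss k\<close>.\<close>

lemma nn_integral_gauss_Suc:
  fixes F :: "complex vec \<Rightarrow> ennreal"
  assumes F [measurable]: "(\<lambda>x. F (Matrix.vec (Suc k) x)) \<in> borel_measurable (Pi\<^sub>M {..<Suc k} (\<lambda>_. borel))"
  shows "(\<integral>\<^sup>+x. F (Matrix.vec (Suc k) x) \<partial>gauss (Suc k))
    = (\<integral>\<^sup>+a. (\<integral>\<^sup>+x. F (vCons a (Matrix.vec k x)) \<partial>gauss k) \<partial>complex_normal 0 1)"
proof -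
  interpret N: prob_space "complex_normal 0 1" by (rule prob_space_complex_normal)
  interpret product_sigma_finite "\<lambda>_ :: nat. complex_normal 0 1" ..
  let ?K = "Pi\<^sub>M {1..k} (\<lambda>_. complex_normal 0 1)" and ?r = "\<lambda>x. \<lambda>i\<in>{1..k}. x (i - 1)"
  have pred: "(\<lambda>i. i - 1) \<in> {1..k} \<rightarrow> {..<k}"
    by (rule Pi_I) (simp only: atLeastAtMost_iff lessThan_iff, linarith)
  then have r [measurable]: "?r \<in> measurable (gauss k) ?K"
    unfolding gauss_def by (intro measurable_restrict measurable_component_singleton) (rule funcset_mem)
  have "inj_on (\<lambda>i. i - 1) {1..k}" by (rule inj_onI) (simp, linarith)
  with pred have K: "?K = distr (gauss k) ?K ?r"
    unfolding gauss_def
    using distr_PiM_reindex[of "{..<k}" "\<lambda>_. complex_normal 0 1" "\<lambda>i. i - 1" "{1..k}"]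
    by (simp add: prob_space_complex_normal)
  have ins: "{..<Suc k} = insert 0 {1..k}" by auto
  have F' [measurable]: "(\<lambda>x. F (Matrix.vec (Suc k) x)) \<in> borel_measurable (Pi\<^sub>M (insert 0 {1..k}) (\<lambda>_. complex_normal 0 1))"
    using F unfolding ins[symmetric]
    by (subst measurable_cong_sets[OF sets_gauss[unfolded gauss_def] refl])
  have "(\<integral>\<^sup>+x. F (Matrix.vec (Suc k) x) \<partial>gauss (Suc k))
     = (\<integral>\<^sup>+a. (\<integral>\<^sup>+x. F (Matrix.vec (Suc k) (x(0 := a))) \<partial>?K) \<partial>complex_normal 0 1)"
    unfolding gauss_def ins by (rule product_nn_integral_insert_rev[OF _ _ F']) auto
  also have "\<dots> = (\<integral>\<^sup>+a. (\<integral>\<^sup>+x. F (vCons a (Matrix.vec k x)) \<partial>gauss k) \<partial>complex_normal 0 1)"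
  proof (intro nn_integral_cong)
    fix a :: complex
    have "(\<lambda>x. x(0 := a)) \<in> measurable ?K (Pi\<^sub>M (insert 0 {1..k}) (\<lambda>_. complex_normal 0 1))"
      by (rule measurable_fun_upd[where J = "{1..k}"]) auto
    from measurable_compose[OF this F']
    have "(\<integral>\<^sup>+x. F (Matrix.vec (Suc k) (x(0 := a))) \<partial>?K)
        = (\<integral>\<^sup>+x. F (Matrix.vec (Suc k) ((?r x)(0 := a))) \<partial>gauss k)"
      by (subst K, subst nn_integral_distr[OF r]) auto
    also have "\<dots> = (\<integral>\<^sup>+x. F (vCons a (Matrix.vec k x)) \<partial>gauss k)"
      by (intro nn_integral_cong arg_cong[where f = F] eq_vecI) (auto simp: vCons_def split: nat.split)
    finally show "(\<integral>\<^sup>+x. F (Matrix.vec (Suc k) (x(0 := a))) \<partial>?K) = (\<integral>\<^sup>+x. F (vCons a (Matrix.vec k x)) \<partial>gauss k)" .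
  qed
  finally show ?thesis .
qed

section \<open>Construction of Haar measure\<close>

lemma measurable_house_gauss [measurable]:
  "(\<lambda>x. house (Matrix.vec n x)) \<in> measurable (Pi\<^sub>M {..<n} (\<lambda>_. borel)) (unitary_borel n)"
  by (rule measurable_house) auto

text \<open>
  Unitary factors on the left of \<^term>\<open>house x\<close> only matter through their action on \<open>x\<close>, since the
  rest is absorbed by the Haar distributed block.
\<close>

lemma haar_absorb:
  assumes \<mu>: "haar_measure k \<mu>" and [measurable]: "f \<in> borel_measurable (unitary_borel (Suc k))"
    and U: "U \<in> unitary_group (Suc k)"
    and x: "x \<in> carrier_vec (Suc k)" "norm2_vec x \<noteq> 0"
  shows "(\<integral>\<^sup>+X. f (U * house x * one_plus X) \<partial>\<mu>) = (\<integral>\<^sup>+X. f (house (U *\<^sub>v x) * one_plus X) \<partial>\<mu>)"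
proof -
  note sp = haar_measureD(3)[OF \<mu>]
  obtain Y where Y: "Y \<in> unitary_group k" "U * house x = house (U *\<^sub>v x) * one_plus Y"
    using unitary_mult_house[OF U x] by blast
  let ?A = "house (U *\<^sub>v x)"
  have A: "?A \<in> unitary_group (Suc k)"
    using mult_mat_vec_carrier[OF unitaryD(1)[OF U] x(1)] by auto
  then have [measurable]: "(\<lambda>_. ?A) \<in> measurable (unitary_borel k) (unitary_borel (Suc k))" by simp
  have "(\<integral>\<^sup>+X. f (U * house x * one_plus X) \<partial>\<mu>) = (\<integral>\<^sup>+X. f (?A * one_plus (Y * X)) \<partial>\<mu>)"
  proof (rule nn_integral_cong)
    fix X assume "X \<in> space \<mu>"
    then have X: "X \<in> carrier_mat k k" using unitaryD(1) by (simp add: sp)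
    note Yc = unitaryD(1)[OF Y(1)]
    have "?A * one_plus Y * one_plus X = ?A * (one_plus Y * one_plus X)"
      by (rule assoc_mult_mat[OF unitaryD(1)[OF A] one_plus_carrier[OF Yc] one_plus_carrier[OF X]])
    then show "f (U * house x * one_plus X) = f (?A * one_plus (Y * X))"
      using one_plus_mult[OF Yc X] by (simp add: Y(2))
  qed
  also have "\<dots> = (\<integral>\<^sup>+X. f (?A * one_plus X) \<partial>\<mu>)"
    by (rule haar_measureD(4)[OF \<mu> Y(1), of "\<lambda>X. f (?A * one_plus X)"]) measurable
  finally show ?thesis .
qed

definition haar_step :: "nat \<Rightarrow> complex mat measure \<Rightarrow> complex mat measure" where
  "haar_step k \<mu> = distr (gauss (Suc k) \<Otimes>\<^sub>M \<mu>) (unitary_borel (Suc k))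
     (\<lambda>(x, X). house (Matrix.vec (Suc k) x) * one_plus X)"

lemma
  assumes \<mu>: "haar_measure k \<mu>"
  shows nn_integral_haar_step: "f \<in> borel_measurable (unitary_borel (Suc k)) \<Longrightarrow>
      (\<integral>\<^sup>+X. f X \<partial>haar_step k \<mu>)
      = (\<integral>\<^sup>+x. (\<integral>\<^sup>+X. f (house (Matrix.vec (Suc k) x) * one_plus X) \<partial>\<mu>) \<partial>gauss (Suc k))"
    and haar_measure_step: "haar_measure (Suc k) (haar_step k \<mu>)"
proof -
  note s\<mu> [measurable_cong] = haar_measureD(2)[OF \<mu>]
  note sp = haar_measureD(3)[OF \<mu>]
  interpret \<mu>: prob_space \<mu> by (rule haar_measureD(1)[OF \<mu>])
  interpret G: prob_space "gauss (Suc k)" by (rule prob_space_gauss)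
  interpret P: pair_prob_space "gauss (Suc k)" \<mu> ..
  let ?h = "\<lambda>x. house (Matrix.vec (Suc k) x)"
  have m [measurable]: "(\<lambda>(x, X). ?h x * one_plus X) \<in> measurable (gauss (Suc k) \<Otimes>\<^sub>M \<mu>) (unitary_borel (Suc k))"
    by measurable
  show I: "(\<integral>\<^sup>+X. f X \<partial>haar_step k \<mu>) = (\<integral>\<^sup>+x. (\<integral>\<^sup>+X. f (?h x * one_plus X) \<partial>\<mu>) \<partial>gauss (Suc k))"
    if [measurable]: "f \<in> borel_measurable (unitary_borel (Suc k))" for f
  proof -
    have "(\<integral>\<^sup>+X. f X \<partial>haar_step k \<mu>) = (\<integral>\<^sup>+p. f ((\<lambda>(x, X). ?h x * one_plus X) p) \<partial>(gauss (Suc k) \<Otimes>\<^sub>M \<mu>))"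
      unfolding haar_step_def by (rule nn_integral_distr[OF m]) simp
    also have "\<dots> = (\<integral>\<^sup>+x. (\<integral>\<^sup>+X. f ((\<lambda>(x, X). ?h x * one_plus X) (x, X)) \<partial>\<mu>) \<partial>gauss (Suc k))"
      by (rule \<mu>.nn_integral_fst[symmetric]) measurable
    finally show ?thesis by simp
  qed
  show "haar_measure (Suc k) (haar_step k \<mu>)"
  proof (rule haar_measureI)
    show "prob_space (haar_step k \<mu>)"
      unfolding haar_step_def by (rule P.prob_space_distr[OF m])
    show "sets (haar_step k \<mu>) = sets (unitary_borel (Suc k))"
      by (simp add: haar_step_def)
    fix V and f :: "complex mat \<Rightarrow> ennreal" assume V: "V \<in> unitary_group (Suc k)"
      and f [measurable]: "f \<in> borel_measurable (unitary_borel (Suc k))"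
    have fV: "(\<lambda>X. f (V * X)) \<in> borel_measurable (unitary_borel (Suc k))"
      by (rule measurable_compose[OF measurable_mult_unitary(1)[OF V] f])
    \<comment> \<open>After absorption the inner integral depends on V only through the vector it
      acts on, so the invariance of the Gaussian law can remove V.\<close>
    define G where "G v = (\<integral>\<^sup>+X. f (house v * one_plus X) \<partial>\<mu>)" for v
    have "(\<integral>\<^sup>+X. f (V * X) \<partial>haar_step k \<mu>)
        = (\<integral>\<^sup>+x. (\<integral>\<^sup>+X. f (V * (?h x * one_plus X)) \<partial>\<mu>) \<partial>gauss (Suc k))"
      by (rule I[OF fV])
    \<comment> \<open>The absorption needs a nonzero vector, so this equality of integrands holds
      only almost everywhere.\<close>
    also have "\<dots> = (\<integral>\<^sup>+x. G (V *\<^sub>v Matrix.vec (Suc k) x) \<partial>gauss (Suc k))"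
    proof (rule nn_integral_cong_AE, use gauss_nonzero[of k] in eventually_elim)
      fix x assume x: "norm2_vec (Matrix.vec (Suc k) x) \<noteq> 0"
      have "(\<integral>\<^sup>+X. f (V * (?h x * one_plus X)) \<partial>\<mu>) = (\<integral>\<^sup>+X. f (V * ?h x * one_plus X) \<partial>\<mu>)"
      proof (rule nn_integral_cong)
        fix X assume "X \<in> space \<mu>"
        then have "one_plus X \<in> carrier_mat (Suc k) (Suc k)" using unitaryD(1) by (auto simp: sp)
        then show "f (V * (?h x * one_plus X)) = f (V * ?h x * one_plus X)"
          using assoc_mult_mat[OF unitaryD(1)[OF V] house_carrier[of "Matrix.vec (Suc k) x"]] by simp
      qed
      also have "\<dots> = G (V *\<^sub>v Matrix.vec (Suc k) x)"
        unfolding G_def by (rule haar_absorb[OF \<mu> f V _ x]) simp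
      finally show "(\<integral>\<^sup>+X. f (V * (?h x * one_plus X)) \<partial>\<mu>) = G (V *\<^sub>v Matrix.vec (Suc k) x)" .
    qed
    also have "\<dots> = (\<integral>\<^sup>+x. G (Matrix.vec (Suc k) x) \<partial>gauss (Suc k))"
      by (rule gauss_unitary[OF V]) (unfold G_def, measurable)
    also have "\<dots> = (\<integral>\<^sup>+X. f X \<partial>haar_step k \<mu>)"
      unfolding G_def by (rule I[OF f, symmetric])
    finally show "(\<integral>\<^sup>+X. f (V * X) \<partial>haar_step k \<mu>) = (\<integral>\<^sup>+X. f X \<partial>haar_step k \<mu>)" .
  qed
qed

lemma unitary_group_0: "V \<in> unitary_group 0 \<Longrightarrow> V = 1\<^sub>m 0"
  using unitaryD(1)[of V 0] by (intro eq_matI) auto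

text \<open>The induction starts at order 0, where the empty matrix is the only element and the
  point mass is invariant.\<close>

lemma haar_measure_exists: "\<exists>\<mu>. haar_measure n \<mu>"
proof (induction n)
  case 0
  let ?R = "return (unitary_borel 0) (1\<^sub>m 0 :: complex mat)"
  have "haar_measure 0 ?R"
  proof (rule haar_measureI)
    show "prob_space ?R" by (rule prob_space_return) simp
    fix V :: "complex mat" and f :: "complex mat \<Rightarrow> ennreal"
    assume V: "V \<in> unitary_group 0" and f: "f \<in> borel_measurable (unitary_borel 0)"
    have "(\<lambda>X. f (V * X)) \<in> borel_measurable (unitary_borel 0)"
      by (rule measurable_compose[OF measurable_mult_unitary(1)[OF V] f])
    then show "(\<integral>\<^sup>+X. f (V * X) \<partial>?R) = (\<integral>\<^sup>+X. f X \<partial>?R)"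
      using f unitary_group_0[OF V] by (simp add: nn_integral_return)
  qed simp
  then show ?case by blast
next
  case (Suc k)
  then show ?case using haar_measure_step by blast
qed

section \<open>The Haar measure of each order and polar coordinates of Gaussian vectors\<close>

definition haar :: "nat \<Rightarrow> complex mat measure" where
  "haar n = (SOME \<mu>. haar_measure n \<mu>)"

lemma haar_measure_haar: "haar_measure n (haar n)"
  unfolding haar_def using haar_measure_exists by (rule someI_ex)

lemma sets_haar [measurable_cong]: "sets (haar n) = sets (unitary_borel n)"
  and space_haar: "space (haar n) = unitary_group n"
  and prob_space_haar: "prob_space (haar n)"
  using haar_measureD(1-3)[OF haar_measure_haar] by auto

text \<open>Uniqueness identifies the chosen Haar measure of order k + 1 with the one built from
  order k.\<close>

lemma nn_integral_haar_Suc: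
  "f \<in> borel_measurable (unitary_borel (Suc k)) \<Longrightarrow> (\<integral>\<^sup>+X. f X \<partial>haar (Suc k))
      = (\<integral>\<^sup>+x. (\<integral>\<^sup>+X. f (house (Matrix.vec (Suc k) x) * one_plus X) \<partial>haar k) \<partial>gauss (Suc k))"
  using haar_measure_unique[OF haar_measure_haar haar_measure_step[OF haar_measure_haar, of k]]
    nn_integral_haar_step[OF haar_measure_haar, of f k] by simp

text \<open>The type \<open>complex vec\<close> is given no sigma-algebra here: measurability of F
  is always expressed through \<open>Matrix.vec n\<close> on the product space, and this lemma
  composes such an F with a family of measurable entries.\<close>

lemma measurable_vec_fun:
  assumes F: "(\<lambda>x. F (Matrix.vec n x)) \<in> borel_measurable (Pi\<^sub>M {..<n} (\<lambda>_. borel))"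
    and g: "\<And>i. i < n \<Longrightarrow> (\<lambda>p. g p i) \<in> borel_measurable M"
  shows "(\<lambda>p. F (Matrix.vec n (g p))) \<in> borel_measurable M"
proof -
  have "(\<lambda>p. \<lambda>i\<in>{..<n}. g p i) \<in> measurable M (Pi\<^sub>M {..<n} (\<lambda>_. borel))"
    by (rule measurable_restrict) (use g in auto)
  from measurable_compose[OF this F]
  have "(\<lambda>p. F (Matrix.vec n (\<lambda>i\<in>{..<n}. g p i))) \<in> borel_measurable M" .
  also have "(\<lambda>p. Matrix.vec n (\<lambda>i\<in>{..<n}. g p i)) = (\<lambda>p. Matrix.vec n (g p))"
    by (intro ext eq_vecI) auto
  then have "(\<lambda>p. F (Matrix.vec n (\<lambda>i\<in>{..<n}. g p i))) = (\<lambda>p. F (Matrix.vec n (g p)))"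
    by metis
  finally show ?thesis .
qed

text \<open>Used twice below: with V a Householder matrix it replaces the direction of a fixed
  vector by the first Haar column, and with V diagonal it removes a phase.\<close>

lemma haar_column_right:
  fixes F :: "complex vec \<Rightarrow> ennreal"
  assumes F: "(\<lambda>x. F (Matrix.vec n x)) \<in> borel_measurable (Pi\<^sub>M {..<n} (\<lambda>_. borel))"
    and V: "V \<in> unitary_group n"
  shows "(\<integral>\<^sup>+W. F (Matrix.vec n (\<lambda>i. c * (W * V) $$ (i, 0))) \<partial>haar n)
     = (\<integral>\<^sup>+W. F (Matrix.vec n (\<lambda>i. c * W $$ (i, 0))) \<partial>haar n)"
proof (rule haar_measureD(5)[OF haar_measure_haar V])
  show "(\<lambda>W. F (Matrix.vec n (\<lambda>i. c * W $$ (i, 0)))) \<in> borel_measurable (unitary_borel n)"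
    by (rule measurable_vec_fun[OF F])
       (intro borel_measurable_times measurable_const measurable_entry[OF measurable_ident_sets], auto)
qed

text \<open>
  \<open>g\<close> has the law of \<open>W g\<close> for an independent Haar matrix \<open>W\<close>, and \<open>W g\<close> is \<open>\<parallel>g\<parallel>\<close> times the first
  column of the Haar matrix \<open>W R(g)\<close>. Similarly the phase of \<open>b\<close> is absorbed by \<open>W\<close>.
\<close>

lemma nn_integral_gauss_polar:
  fixes F :: "complex vec \<Rightarrow> ennreal"
  assumes \<kappa>: "prob_space \<kappa>" and s\<kappa> [measurable_cong]: "sets \<kappa> = sets borel"
    and chi: "distr \<kappa> borel (\<lambda>b. (cmod b)\<^sup>2) = chi2_complex n"
    and n: "n > 0"
    and F: "(\<lambda>x. F (Matrix.vec n x)) \<in> borel_measurable (Pi\<^sub>M {..<n} (\<lambda>_. borel))"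
  shows "(\<integral>\<^sup>+W. (\<integral>\<^sup>+b. F (Matrix.vec n (\<lambda>i. b * W $$ (i, 0))) \<partial>\<kappa>) \<partial>haar n)
     = (\<integral>\<^sup>+x. F (Matrix.vec n x) \<partial>gauss n)"
proof -
  interpret \<kappa>: prob_space \<kappa> by fact
  interpret H: prob_space "haar n" by (rule prob_space_haar)
  interpret G: prob_space "gauss n" by (rule prob_space_gauss)
  let ?r = "\<lambda>x. norm2_vec (Matrix.vec n x)"
  let ?c = "\<lambda>c W. Matrix.vec n (\<lambda>i. complex_of_real c * W $$ (i, 0))"
  have r [measurable]: "?r \<in> borel_measurable (gauss n)"
    unfolding norm2_vec_def by simp
  have e: "(\<lambda>p. snd p $$ (i, j)) \<in> borel_measurable (A \<Otimes>\<^sub>M haar n)" if "i < n" "j < n" for i j and A :: "'x measure"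
    by (rule measurable_entry) (use that in auto)
  have e': "(\<lambda>p. fst p $$ (i, j)) \<in> borel_measurable (haar n \<Otimes>\<^sub>M A)" if "i < n" "j < n" for i j and A :: "'x measure"
    by (rule measurable_entry) (use that in auto)
  have gx: "(\<lambda>x. x j) \<in> borel_measurable (gauss n)" if "j < n" for j
    using that by (auto intro: measurable_component_singleton simp: measurable_cong_sets[OF sets_gauss refl])
  have "(\<integral>\<^sup>+x. F (Matrix.vec n x) \<partial>gauss n) = (\<integral>\<^sup>+W. (\<integral>\<^sup>+x. F (Matrix.vec n x) \<partial>gauss n) \<partial>haar n)"
    by (simp add: H.emeasure_space_1)
  \<comment> \<open>For each fixed W the Gaussian law is invariant under W, so averaging over W
    introduces the Haar matrix for free.\<close>
  also have "\<dots> = (\<integral>\<^sup>+W. (\<integral>\<^sup>+x. F (W *\<^sub>v Matrix.vec n x) \<partial>gauss n) \<partial>haar n)"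
    by (rule nn_integral_cong) (simp add: space_haar gauss_unitary[OF _ F])
  also have "\<dots> = (\<integral>\<^sup>+W. (\<integral>\<^sup>+x. F (Matrix.vec n (\<lambda>i. \<Sum>j<n. W $$ (i, j) * x j)) \<partial>gauss n) \<partial>haar n)"
  proof (intro nn_integral_cong arg_cong[where f = F] eq_vecI)
    fix W x i assume "W \<in> space (haar n)"
    then have W: "W \<in> carrier_mat n n" using unitaryD(1) by (simp add: space_haar)
    then show "dim_vec (W *\<^sub>v Matrix.vec n x) = dim_vec (Matrix.vec n (\<lambda>i. \<Sum>j<n. W $$ (i, j) * x j))"
      by simp
    assume "i < dim_vec (Matrix.vec n (\<lambda>i. \<Sum>j<n. W $$ (i, j) * x j))"
    then show "(W *\<^sub>v Matrix.vec n x) $ i = Matrix.vec n (\<lambda>i. \<Sum>j<n. W $$ (i, j) * x j) $ i"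
      using W by (auto simp: scalar_prod_def atLeast0LessThan intro!: sum.cong)
  qed
  also have "\<dots> = (\<integral>\<^sup>+x. (\<integral>\<^sup>+W. F (Matrix.vec n (\<lambda>i. \<Sum>j<n. W $$ (i, j) * x j)) \<partial>haar n) \<partial>gauss n)"
  proof (rule nn_integral_swap[OF prob_space_haar prob_space_gauss], unfold split_beta, rule measurable_vec_fun[OF F])
    fix i assume "i < n"
    then show "(\<lambda>p. \<Sum>j<n. fst p $$ (i, j) * snd p j) \<in> borel_measurable (haar n \<Otimes>\<^sub>M gauss n)"
      by (intro borel_measurable_sum borel_measurable_times e' measurable_compose[OF measurable_snd gx]) auto
  qed
  also have "\<dots> = (\<integral>\<^sup>+x. (\<integral>\<^sup>+W. F (?c (?r x) W) \<partial>haar n) \<partial>gauss n)"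
  proof (rule nn_integral_cong)
    fix x
    have hc: "house (Matrix.vec n x) \<in> carrier_mat n n" by auto
    \<comment> \<open>x is its norm times the first column of its Householder matrix; for norm 0
      both sides vanish.\<close>
    have x0: "x j = complex_of_real (?r x) * house (Matrix.vec n x) $$ (j, 0)" if "j < n" for j
      using that norm2_vec_eq_0[of "Matrix.vec n x"]
      by (cases "?r x = 0") (auto simp: house_first_column)
    have "(\<integral>\<^sup>+W. F (Matrix.vec n (\<lambda>i. \<Sum>j<n. W $$ (i, j) * x j)) \<partial>haar n)
        = (\<integral>\<^sup>+W. F (?c (?r x) (W * house (Matrix.vec n x))) \<partial>haar n)"
    proof (intro nn_integral_cong arg_cong[where f = F] eq_vecI)
      fix W i assume "W \<in> space (haar n)" "i < dim_vec (?c (?r x) (W * house (Matrix.vec n x)))"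
      then have W: "W \<in> carrier_mat n n" "i < n" using unitaryD(1) by (auto simp: space_haar)
      have "(\<Sum>j<n. W $$ (i, j) * x j)
          = (\<Sum>j<n. complex_of_real (?r x) * (W $$ (i, j) * house (Matrix.vec n x) $$ (j, 0)))"
        by (intro sum.cong refl) (subst x0, auto)
      also have "\<dots> = complex_of_real (?r x) * (W * house (Matrix.vec n x)) $$ (i, 0)"
        using W hc n by (auto simp: scalar_prod_def atLeast0LessThan sum_distrib_left intro!: sum.cong)
      finally show "Matrix.vec n (\<lambda>i. \<Sum>j<n. W $$ (i, j) * x j) $ i = ?c (?r x) (W * house (Matrix.vec n x)) $ i"
        using W by simp
    qed simp
    also have "\<dots> = (\<integral>\<^sup>+W. F (?c (?r x) W) \<partial>haar n)"
      by (rule haar_column_right[OF F]) auto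
    finally show "(\<integral>\<^sup>+W. F (Matrix.vec n (\<lambda>i. \<Sum>j<n. W $$ (i, j) * x j)) \<partial>haar n)
        = (\<integral>\<^sup>+W. F (?c (?r x) W) \<partial>haar n)" .
  qed
  also have "\<dots> = (\<integral>\<^sup>+W. (\<integral>\<^sup>+x. F (?c (?r x) W) \<partial>gauss n) \<partial>haar n)"
  proof (rule nn_integral_swap[OF prob_space_gauss prob_space_haar], unfold split_beta, rule measurable_vec_fun[OF F])
    fix i assume "i < n"
    then show "(\<lambda>p. complex_of_real (?r (fst p)) * snd p $$ (i, 0)) \<in> borel_measurable (gauss n \<Otimes>\<^sub>M haar n)"
      using n by (intro borel_measurable_times e measurable_compose[OF _ borel_measurable_of_real]
        measurable_compose[OF measurable_fst r]) auto
  qed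
  also have "\<dots> = (\<integral>\<^sup>+W. (\<integral>\<^sup>+b. F (?c (cmod b) W) \<partial>\<kappa>) \<partial>haar n)"
  proof (rule nn_integral_cong)
    fix W :: "complex mat"
    \<comment> \<open>The laws of \<open>?r x\<close> and of the modulus of b are compared through
      their squares, both of which have the law \<open>chi2_complex n\<close>; the square root
      recovers the radius.\<close>
    define u where "u s = F (?c (sqrt s) W)" for s
    have u: "u \<in> borel_measurable borel"
      unfolding u_def by (rule measurable_vec_fun[OF F]) measurable
    have "(\<integral>\<^sup>+x. F (?c (?r x) W) \<partial>gauss n) = (\<integral>\<^sup>+x. u ((?r x)\<^sup>2) \<partial>gauss n)"
      by (simp add: u_def)
    also have "\<dots> = (\<integral>\<^sup>+s. u s \<partial>distr (gauss n) borel (\<lambda>x. (?r x)\<^sup>2))"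
      by (rule nn_integral_distr[symmetric]) (use u in auto)
    also have "\<dots> = (\<integral>\<^sup>+s. u s \<partial>distr \<kappa> borel (\<lambda>b. (cmod b)\<^sup>2))"
      by (simp add: distr_gauss_norm chi)
    also have "\<dots> = (\<integral>\<^sup>+b. u ((cmod b)\<^sup>2) \<partial>\<kappa>)"
      by (rule nn_integral_distr) (use u in auto)
    also have "\<dots> = (\<integral>\<^sup>+b. F (?c (cmod b) W) \<partial>\<kappa>)"
      by (simp add: u_def)
    finally show "(\<integral>\<^sup>+x. F (?c (?r x) W) \<partial>gauss n) = (\<integral>\<^sup>+b. F (?c (cmod b) W) \<partial>\<kappa>)" .
  qed
  also have "\<dots> = (\<integral>\<^sup>+b. (\<integral>\<^sup>+W. F (?c (cmod b) W) \<partial>haar n) \<partial>\<kappa>)"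
  proof (rule nn_integral_swap[OF prob_space_haar \<kappa>], unfold split_beta, rule measurable_vec_fun[OF F])
    fix i assume "i < n"
    then show "(\<lambda>p. complex_of_real (cmod (snd p)) * fst p $$ (i, 0)) \<in> borel_measurable (haar n \<Otimes>\<^sub>M \<kappa>)"
      using n by (intro borel_measurable_times e') auto
  qed
  also have "\<dots> = (\<integral>\<^sup>+b. (\<integral>\<^sup>+W. F (Matrix.vec n (\<lambda>i. b * W $$ (i, 0))) \<partial>haar n) \<partial>\<kappa>)"
  proof (rule nn_integral_cong)
    fix b
    \<comment> \<open>Right multiplication by this matrix multiplies the first column by the phase
      of b and leaves the other columns alone.\<close>
    let ?D = "mat_diag n (\<lambda>i. if i = 0 then phase b else 1)"
    have D: "?D \<in> unitary_group n" by (rule mat_diag_unitary) auto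
    have "(\<integral>\<^sup>+W. F (Matrix.vec n (\<lambda>i. b * W $$ (i, 0))) \<partial>haar n) = (\<integral>\<^sup>+W. F (?c (cmod b) (W * ?D)) \<partial>haar n)"
    proof (intro nn_integral_cong arg_cong[where f = F] eq_vecI)
      fix W i assume "W \<in> space (haar n)" "i < dim_vec (?c (cmod b) (W * ?D))"
      then have W: "W \<in> carrier_mat n n" "i < n" using unitaryD(1) by (auto simp: space_haar)
      have "b * W $$ (i, 0) = complex_of_real (cmod b) * (W $$ (i, 0) * phase b)"
        by (subst phase_mult_norm[of b, symmetric]) (simp add: mult_ac)
      also have "\<dots> = complex_of_real (cmod b) * (W * ?D) $$ (i, 0)"
        using W n by (subst mat_diag_mult_right[OF W(1)]) simp
      finally show "Matrix.vec n (\<lambda>i. b * W $$ (i, 0)) $ i = ?c (cmod b) (W * ?D) $ i"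
        using W by simp
    qed simp
    also have "\<dots> = (\<integral>\<^sup>+W. F (?c (cmod b) W) \<partial>haar n)"
      by (rule haar_column_right[OF F D])
    finally show "(\<integral>\<^sup>+W. F (?c (cmod b) W) \<partial>haar n) = (\<integral>\<^sup>+W. F (Matrix.vec n (\<lambda>i. b * W $$ (i, 0))) \<partial>haar n)"
      by simp
  qed
  also have "\<dots> = (\<integral>\<^sup>+W. (\<integral>\<^sup>+b. F (Matrix.vec n (\<lambda>i. b * W $$ (i, 0))) \<partial>\<kappa>) \<partial>haar n)"
  proof (rule nn_integral_swap[OF \<kappa> prob_space_haar], unfold split_beta, rule measurable_vec_fun[OF F])
    fix i assume "i < n"
    then show "(\<lambda>p. fst p * snd p $$ (i, 0)) \<in> borel_measurable (\<kappa> \<Otimes>\<^sub>M haar n)"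
      using n by (intro borel_measurable_times e) auto
  qed
  finally show ?thesis by simp
qed

section \<open>The law of the Hessenberg matrix\<close>

definition uniform_angle :: "real measure" where
  "uniform_angle = uniform_measure lborel {-pi<..pi}"

lemma sets_uniform_angle [simp, measurable_cong]: "sets uniform_angle = sets borel"
  by (simp add: uniform_angle_def)

lemma prob_space_uniform_angle: "prob_space uniform_angle"
  unfolding uniform_angle_def by (rule prob_space_uniform_measure) auto

text \<open>Cut the translated interval at pi and move the part beyond pi back by one period; the
  two pieces fill the original interval.\<close>

lemma nn_integral_periodic_shift:
  fixes h :: "real \<Rightarrow> ennreal"
  assumes [measurable]: "h \<in> borel_measurable borel" and per: "\<And>t. h (t + 2 * pi) = h t"
    and \<phi>: "0 \<le> \<phi>" "\<phi> < 2 * pi"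
  shows "(\<integral>\<^sup>+t. h (t + \<phi>) * indicator {-pi<..pi} t \<partial>lborel) = (\<integral>\<^sup>+t. h t * indicator {-pi<..pi} t \<partial>lborel)"
proof -
  have shift: "(\<integral>\<^sup>+t. f (t + c) \<partial>lborel) = (\<integral>\<^sup>+t. f t \<partial>lborel)"
    if "f \<in> borel_measurable borel" for f :: "real \<Rightarrow> ennreal" and c
    using nn_integral_real_affine[of f 1 c] that by (simp add: add.commute)
  let ?I = "\<lambda>a b. \<integral>\<^sup>+t. h t * indicator {a<..b} t \<partial>lborel"
  have split: "?I a b = ?I a c + ?I c b" if "a \<le> c" "c \<le> b" for a b c :: real
  proof -
    have "h t * indicator {a<..b} t = h t * indicator {a<..c} t + h t * indicator {c<..b} t" for t
      using that by (auto simp: indicator_def)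
    then show ?thesis by (simp add: nn_integral_add)
  qed
  have "(\<integral>\<^sup>+t. h (t + \<phi>) * indicator {-pi<..pi} t \<partial>lborel)
      = (\<integral>\<^sup>+t. h (t + \<phi>) * indicator {-pi + \<phi><..pi + \<phi>} (t + \<phi>) \<partial>lborel)"
    by (intro nn_integral_cong) (auto simp: indicator_def)
  also have "\<dots> = ?I (-pi + \<phi>) (pi + \<phi>)"
    by (rule shift[of "\<lambda>t. h t * indicator {-pi + \<phi><..pi + \<phi>} t"]) measurable
  also have "\<dots> = ?I (-pi + \<phi>) pi + ?I pi (pi + \<phi>)"
    using \<phi> by (intro split) auto
  also have "?I pi (pi + \<phi>) = (\<integral>\<^sup>+t. h (t + 2 * pi) * indicator {pi<..pi + \<phi>} (t + 2 * pi) \<partial>lborel)"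
    by (rule shift[symmetric, of "\<lambda>t. h t * indicator {pi<..pi + \<phi>} t"]) measurable
  also have "\<dots> = ?I (-pi) (-pi + \<phi>)"
    by (intro nn_integral_cong) (auto simp: per indicator_def)
  also have "?I (-pi + \<phi>) pi + ?I (-pi) (-pi + \<phi>) = ?I (-pi) pi"
    using \<phi> by (subst split[of "-pi" "-pi + \<phi>" pi]) (auto simp: add.commute)
  finally show ?thesis .
qed

lemma uniform_angle_rotate:
  fixes g :: "complex \<Rightarrow> ennreal"
  assumes g [measurable]: "g \<in> borel_measurable borel" and v: "cmod v = 1"
  shows "(\<integral>\<^sup>+t. g (v * exp (\<i> * complex_of_real t)) \<partial>uniform_angle)
    = (\<integral>\<^sup>+t. g (exp (\<i> * complex_of_real t)) \<partial>uniform_angle)"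
proof -
  have [measurable]: "(\<lambda>t. exp (\<i> * complex_of_real t)) \<in> borel_measurable borel"
    by (intro borel_measurable_continuous_onI continuous_intros)
  let ?h = "\<lambda>t. g (exp (\<i> * complex_of_real t))"
  \<comment> \<open>The angle is taken in the range [0, 2 pi) of \<open>Arg2pi\<close>, which is
    what the shift lemma requires.\<close>
  have veq: "v = exp (\<i> * complex_of_real (Arg2pi v))"
    using Arg2pi_eq[of v] v by simp
  have "(\<integral>\<^sup>+t. g (v * exp (\<i> * complex_of_real t)) \<partial>uniform_angle)
      = (\<integral>\<^sup>+t. ?h (t + Arg2pi v) \<partial>uniform_angle)"
    by (subst (1) veq, intro nn_integral_cong arg_cong[where f = g])
       (simp add: exp_add[symmetric] algebra_simps)
  also have "\<dots> = (\<integral>\<^sup>+t. ?h (t + Arg2pi v) * indicator {-pi<..pi} t \<partial>lborel) / emeasure lborel {-pi<..pi}"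
    unfolding uniform_angle_def by (rule nn_integral_uniform_measure) auto
  also have "(\<integral>\<^sup>+t. ?h (t + Arg2pi v) * indicator {-pi<..pi} t \<partial>lborel)
      = (\<integral>\<^sup>+t. ?h t * indicator {-pi<..pi} t \<partial>lborel)"
    by (rule nn_integral_periodic_shift)
       (use Arg2pi_lt_2pi[of v] in \<open>auto simp: Arg2pi_ge_0 algebra_simps exp_add exp_two_pi_i\<close>)
  also have "\<dots> / emeasure lborel {-pi<..pi} = (\<integral>\<^sup>+t. ?h t \<partial>uniform_angle)"
    unfolding uniform_angle_def by (rule nn_integral_uniform_measure[symmetric]) auto
  finally show ?thesis .
qed

text \<open>\<open>\<kappa> i\<close> is the law of the \<beta> with i degrees of freedom. It is
  left as a parameter because only the law of the square of \<beta> is prescribed.\<close>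

definition hess_law :: "(nat \<Rightarrow> complex measure) \<Rightarrow> nat \<Rightarrow> complex mat measure" where
  "hess_law \<kappa> k = distr (Pi\<^sub>M {1..k} (\<lambda>i. complex_normal 0 1 \<Otimes>\<^sub>M \<kappa> i) \<Otimes>\<^sub>M uniform_angle)
     (unitary_borel (Suc k)) (\<lambda>(w, t). hmat k w t)"

lemma sets_hess_law [measurable_cong]: "sets (hess_law \<kappa> k) = sets (unitary_borel (Suc k))"
  and space_hess_law: "space (hess_law \<kappa> k) = unitary_group (Suc k)"
  by (simp_all add: hess_law_def)

lemma sets_normal_pair:
  "sets \<kappa> = sets borel \<Longrightarrow> sets (complex_normal 0 1 \<Otimes>\<^sub>M \<kappa>) = sets (borel :: (complex \<times> complex) measure)"
  unfolding borel_prod[symmetric] by (rule sets_pair_measure_cong) simp_all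

lemma prob_space_normal_pair: "prob_space \<kappa> \<Longrightarrow> prob_space (complex_normal 0 1 \<Otimes>\<^sub>M \<kappa>)"
  by (intro prob_space_pair prob_space_complex_normal)

lemma measurable_hmat_PiM:
  assumes "\<And>i. sets (\<kappa> i) = sets borel"
  shows "(\<lambda>(w, t). hmat k w t) \<in> measurable
    (Pi\<^sub>M {1..k} (\<lambda>i. complex_normal 0 1 \<Otimes>\<^sub>M \<kappa> i) \<Otimes>\<^sub>M uniform_angle) (unitary_borel (Suc k))"
  unfolding split_beta
proof (rule measurable_hmat)
  fix i assume i: "i \<in> {1..k}"
  have "(\<lambda>x. fst x i) \<in> measurable (Pi\<^sub>M {1..k} (\<lambda>i. complex_normal 0 1 \<Otimes>\<^sub>M \<kappa> i) \<Otimes>\<^sub>M uniform_angle)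
      (complex_normal 0 1 \<Otimes>\<^sub>M \<kappa> i)"
    by (rule measurable_compose[OF measurable_fst measurable_component_singleton[OF i]])
  then show "(\<lambda>x. fst x i) \<in> borel_measurable (Pi\<^sub>M {1..k} (\<lambda>i. complex_normal 0 1 \<Otimes>\<^sub>M \<kappa> i) \<Otimes>\<^sub>M uniform_angle)"
    by (simp only: measurable_cong_sets[OF refl sets_normal_pair[OF assms]])
qed measurable

lemma prob_space_hess_law:
  assumes "\<And>i. sets (\<kappa> i) = sets borel" "\<And>i. prob_space (\<kappa> i)"
  shows "prob_space (hess_law \<kappa> k)"
  unfolding hess_law_def
  by (intro prob_space.prob_space_distr[OF _ measurable_hmat_PiM] prob_space_pair prob_space_PiM
    prob_space_normal_pair prob_space_uniform_angle assms)

lemma nn_integral_hess_law: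
  assumes \<kappa>: "\<And>i. sets (\<kappa> i) = sets borel" and [measurable]: "f \<in> borel_measurable (unitary_borel (Suc k))"
  shows "(\<integral>\<^sup>+X. f X \<partial>hess_law \<kappa> k)
    = (\<integral>\<^sup>+w. (\<integral>\<^sup>+t. f (hmat k w t) \<partial>uniform_angle) \<partial>Pi\<^sub>M {1..k} (\<lambda>i. complex_normal 0 1 \<Otimes>\<^sub>M \<kappa> i))"
proof -
  interpret U: prob_space uniform_angle by (rule prob_space_uniform_angle)
  note m [measurable] = measurable_hmat_PiM[where k = k, OF \<kappa>]
  let ?P = "Pi\<^sub>M {1..k} (\<lambda>i. complex_normal 0 1 \<Otimes>\<^sub>M \<kappa> i)"
  have "(\<integral>\<^sup>+X. f X \<partial>hess_law \<kappa> k) = (\<integral>\<^sup>+p. f ((\<lambda>(w, t). hmat k w t) p) \<partial>(?P \<Otimes>\<^sub>M uniform_angle))"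
    unfolding hess_law_def by (rule nn_integral_distr[OF m]) simp
  also have "\<dots> = (\<integral>\<^sup>+w. (\<integral>\<^sup>+t. f ((\<lambda>(w, t). hmat k w t) (w, t)) \<partial>uniform_angle) \<partial>?P)"
    by (rule U.nn_integral_fst[symmetric]) (rule measurable_compose[OF m], simp)
  finally show ?thesis by simp
qed

lemma measurable_house_pair' [measurable (raw)]:
  assumes [measurable]: "a \<in> borel_measurable M" "b \<in> borel_measurable M"
  shows "(\<lambda>x. house (pair_vec n (a x, b x))) \<in> measurable M (unitary_borel n)"
  by (rule measurable_house_pair) measurable

lemma nn_integral_hess_law_Suc:
  assumes \<kappa>: "\<And>i. sets (\<kappa> i) = sets borel" "\<And>i. prob_space (\<kappa> i)"
    and f [measurable]: "f \<in> borel_measurable (unitary_borel (Suc (Suc k)))"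
  shows "(\<integral>\<^sup>+X. f X \<partial>hess_law \<kappa> (Suc k))
    = (\<integral>\<^sup>+a. (\<integral>\<^sup>+b. (\<integral>\<^sup>+X. f (house (pair_vec (Suc (Suc k)) (a, b)) * one_plus X) \<partial>hess_law \<kappa> k)
        \<partial>\<kappa> (Suc k)) \<partial>complex_normal 0 1)"
proof -
  let ?N = "\<lambda>i. complex_normal 0 1 \<Otimes>\<^sub>M \<kappa> i"
  have prob: "prob_space (?N i)" for i by (rule prob_space_normal_pair[OF \<kappa>(2)])
  interpret product_prob_space ?N by (rule product_prob_spaceI) (rule prob)
  interpret \<kappa>: prob_space "\<kappa> (Suc k)" by fact
  interpret U: prob_space uniform_angle by (rule prob_space_uniform_angle)
  interpret L: prob_space "hess_law \<kappa> k" by (rule prob_space_hess_law[OF \<kappa>])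
  note [measurable_cong] = \<kappa>(1)
  note m [measurable] = measurable_hmat_PiM[where k = "Suc k", OF \<kappa>(1)]
  have ins: "{1..Suc k} = insert (Suc k) {1..k}" by auto
  let ?R = "\<lambda>z. house (pair_vec (Suc (Suc k)) z)"
  have "(\<lambda>w. \<integral>\<^sup>+t. f ((\<lambda>(w, t). hmat (Suc k) w t) (w, t)) \<partial>uniform_angle) \<in> borel_measurable (Pi\<^sub>M {1..Suc k} ?N)"
    by (rule U.borel_measurable_nn_integral) (simp only: split_beta prod.collapse, measurable)
  then have mi: "(\<lambda>w. \<integral>\<^sup>+t. f (hmat (Suc k) w t) \<partial>uniform_angle) \<in> borel_measurable (Pi\<^sub>M (insert (Suc k) {1..k}) ?N)"
    unfolding ins by simp
  have "(\<integral>\<^sup>+X. f X \<partial>hess_law \<kappa> (Suc k)) = (\<integral>\<^sup>+w. (\<integral>\<^sup>+t. f (hmat (Suc k) w t) \<partial>uniform_angle) \<partial>Pi\<^sub>M (insert (Suc k) {1..k}) ?N)"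
    unfolding ins[symmetric] by (rule nn_integral_hess_law[OF \<kappa>(1) f])
  also have "\<dots> = (\<integral>\<^sup>+z. (\<integral>\<^sup>+w. (\<integral>\<^sup>+t. f (hmat (Suc k) (w(Suc k := z)) t) \<partial>uniform_angle) \<partial>Pi\<^sub>M {1..k} ?N) \<partial>?N (Suc k))"
    by (rule product_nn_integral_insert_rev[OF _ _ mi]) auto
  also have "\<dots> = (\<integral>\<^sup>+z. (\<integral>\<^sup>+X. f (?R z * one_plus X) \<partial>hess_law \<kappa> k) \<partial>?N (Suc k))"
  proof (rule nn_integral_cong)
    fix z
    \<comment> \<open>\<open>hmat k\<close> reads only the indices 1 to k, so the update at
      \<open>Suc k\<close> affects the outermost Householder matrix alone.\<close>
    have "hmat (Suc k) (w(Suc k := z)) t = ?R z * one_plus (hmat k w t)" for w t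
      by (simp, intro arg_cong2[where f = "(*)"] arg_cong[where f = one_plus] hmat_cong) auto
    moreover have [measurable]: "(\<lambda>_. ?R z) \<in> measurable (unitary_borel (Suc k)) (unitary_borel (Suc (Suc k)))"
      by (rule measurable_const) auto
    have "(\<lambda>X. f (?R z * one_plus X)) \<in> borel_measurable (unitary_borel (Suc k))" by measurable
    note nn_integral_hess_law[OF \<kappa>(1) this]
    ultimately show "(\<integral>\<^sup>+w. (\<integral>\<^sup>+t. f (hmat (Suc k) (w(Suc k := z)) t) \<partial>uniform_angle) \<partial>Pi\<^sub>M {1..k} ?N)
       = (\<integral>\<^sup>+X. f (?R z * one_plus X) \<partial>hess_law \<kappa> k)" by simp
  qed
  also have "\<dots> = (\<integral>\<^sup>+a. (\<integral>\<^sup>+b. (\<integral>\<^sup>+X. f (?R (a, b) * one_plus X) \<partial>hess_law \<kappa> k) \<partial>\<kappa> (Suc k)) \<partial>complex_normal 0 1)"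
  proof (rule \<kappa>.nn_integral_fst[symmetric])
    have [measurable]: "?R \<in> measurable (?N (Suc k)) (unitary_borel (Suc (Suc k)))"
      by (rule measurable_house_pair) (simp add: measurable_cong_sets[OF sets_normal_pair[OF \<kappa>(1)] refl])
    show "(\<lambda>z. \<integral>\<^sup>+X. f (?R z * one_plus X) \<partial>hess_law \<kappa> k) \<in> borel_measurable (?N (Suc k))"
      by measurable
  qed
  finally show ?thesis .
qed

text \<open>\<open>U(1)\<close> is the unit circle and left multiplication by an element is a
  rotation; the minus sign of \<open>D\<close> commutes with it.\<close>

lemma hess_law_0: "hess_law \<kappa> 0 = haar 1"
proof -
  let ?P = "Pi\<^sub>M {1..0} (\<lambda>i. complex_normal 0 1 \<Otimes>\<^sub>M \<kappa> i) \<Otimes>\<^sub>M uniform_angle"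
  let ?d = "\<lambda>c. mat_diag 1 (\<lambda>_. c :: complex)"
  interpret U: prob_space uniform_angle by (rule prob_space_uniform_angle)
  have P: "prob_space ?P" by (intro prob_space_pair prob_space_uniform_angle prob_space_PiM) auto
  then interpret P: prob_space ?P .
  interpret E: prob_space "Pi\<^sub>M {1..0} (\<lambda>i. complex_normal 0 1 \<Otimes>\<^sub>M \<kappa> i)" by (rule prob_space_PiM) auto
  have m: "(\<lambda>(w, t). hmat 0 w t) \<in> measurable ?P (unitary_borel (Suc 0))"
    unfolding split_beta by (rule measurable_hmat) auto
  have I: "(\<integral>\<^sup>+X. f X \<partial>hess_law \<kappa> 0) = (\<integral>\<^sup>+t. f (?d (- exp (\<i> * complex_of_real t))) \<partial>uniform_angle)"
    if f: "f \<in> borel_measurable (unitary_borel (Suc 0))" for f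
  proof -
    have "(\<integral>\<^sup>+X. f X \<partial>hess_law \<kappa> 0) = (\<integral>\<^sup>+p. f ((\<lambda>(w, t). hmat 0 w t) p) \<partial>?P)"
      unfolding hess_law_def by (rule nn_integral_distr[OF m]) (use f in simp)
    also have "\<dots> = (\<integral>\<^sup>+w. (\<integral>\<^sup>+t. f ((\<lambda>(w, t). hmat 0 w t) (w, t)) \<partial>uniform_angle)
        \<partial>Pi\<^sub>M {1..0} (\<lambda>i. complex_normal 0 1 \<Otimes>\<^sub>M \<kappa> i))"
      by (rule U.nn_integral_fst[symmetric]) (rule measurable_compose[OF m f])
    finally show ?thesis
      by (simp only: prod.case hmat.simps nn_integral_const E.emeasure_space_1 mult_1_right)
  qed
  have "haar_measure 1 (hess_law \<kappa> 0)"
  proof (rule haar_measureI)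
    show "prob_space (hess_law \<kappa> 0)"
      unfolding hess_law_def by (rule P.prob_space_distr[OF m])
    show "sets (hess_law \<kappa> 0) = sets (unitary_borel 1)" by (simp add: sets_hess_law)
    fix V and f :: "complex mat \<Rightarrow> ennreal"
    assume V: "V \<in> unitary_group 1" and f: "f \<in> borel_measurable (unitary_borel 1)"
    define v where "v = V $$ (0, 0)"
    have Vd: "V = ?d v"
      using unitaryD(1)[OF V] by (intro eq_matI) (auto simp: v_def mat_diag_def)
    have "(mat_adjoint V * V) $$ (0, 0) = cnj v * v"
      using unitaryD(1)[OF V] by (simp add: scalar_prod_def v_def)
    then have "cnj v * v = 1" using unitaryD(2)[OF V] by simp
    then have v: "cmod v = 1"
      using complex_norm_square[of v] norm_ge_zero[of v]
      by (auto simp: mult.commute power2_eq_1_iff simp flip: of_real_power)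
    \<comment> \<open>Composition with \<open>phase\<close> makes the diagonal matrix unitary for
      every complex c, so that g is Borel on the whole plane; on the circle \<open>phase\<close> is
      the identity.\<close>
    define g where "g c = f (?d (- phase c))" for c
    have "(\<lambda>c. ?d (- phase c)) \<in> measurable borel (unitary_borel 1)"
    proof (rule measurable_unitary_borelI)
      fix i j assume "i < (1 :: nat)" "j < (1 :: nat)"
      then show "(\<lambda>c. ?d (- phase c) $$ (i, j)) \<in> borel_measurable borel"
        by (simp add: mat_diag_def)
    qed (auto intro!: mat_diag_unitary simp del: One_nat_def)
    then have g: "g \<in> borel_measurable borel" unfolding g_def by (rule measurable_compose[OF _ f])
    have ph: "phase c = c" if "cmod c = 1" for c using that by (auto simp: phase_def sgn_div_norm)
    have "(\<integral>\<^sup>+X. f (V * X) \<partial>hess_law \<kappa> 0) = (\<integral>\<^sup>+t. g (v * exp (\<i> * complex_of_real t)) \<partial>uniform_angle)"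
      by (subst I) (use f measurable_compose[OF measurable_mult_unitary(1)[OF V] f] v in
          \<open>simp_all add: Vd g_def ph norm_mult del: One_nat_def add: One_nat_def[symmetric]\<close>)
    also have "\<dots> = (\<integral>\<^sup>+t. g (exp (\<i> * complex_of_real t)) \<partial>uniform_angle)"
      by (rule uniform_angle_rotate[OF g v])
    also have "\<dots> = (\<integral>\<^sup>+X. f X \<partial>hess_law \<kappa> 0)"
      by (subst I) (use f in \<open>simp_all add: g_def ph\<close>)
    finally show "(\<integral>\<^sup>+X. f (V * X) \<partial>hess_law \<kappa> 0) = (\<integral>\<^sup>+X. f X \<partial>hess_law \<kappa> 0)" .
  qed
  then show ?thesis by (rule haar_measure_unique) (rule haar_measure_haar)
qed

lemma hess_conjugate_identity:
  assumes W: "W \<in> unitary_group (Suc k)" and W': "W' \<in> unitary_group k" and X: "X \<in> unitary_group (Suc k)"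
  shows "one_plus (W * one_plus W') * (house (pair_vec (Suc (Suc k)) z) * one_plus X)
      * mat_adjoint (one_plus (W * one_plus W'))
    = one_plus W * (house (pair_vec (Suc (Suc k)) z)
      * one_plus (one_plus W' * X * mat_adjoint (one_plus W'))) * mat_adjoint (one_plus W)"
proof -
  let ?n = "Suc (Suc k)"
  let ?H = "house (pair_vec ?n z)" and ?V = "one_plus W'" 
  have V: "?V \<in> unitary_group (Suc k)" using W' by auto
  note c = unitaryD(1)[OF W] unitaryD(1)[OF V] unitaryD(1)[OF X]
  have oc: "one_plus W \<in> carrier_mat ?n ?n" "one_plus ?V \<in> carrier_mat ?n ?n" "one_plus X \<in> carrier_mat ?n ?n"
    "one_plus (mat_adjoint W) \<in> carrier_mat ?n ?n" "one_plus (mat_adjoint ?V) \<in> carrier_mat ?n ?n"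
    "?H \<in> carrier_mat ?n ?n"
    using c by auto
  have assoc: "A * B * C = A * (B * C)" if "A \<in> carrier_mat ?n ?n" "B \<in> carrier_mat ?n ?n" "C \<in> carrier_mat ?n ?n"
    for A B C :: "complex mat"
    using that by (rule assoc_mult_mat)
  have mc: "A * B \<in> carrier_mat ?n ?n" if "A \<in> carrier_mat ?n ?n" "B \<in> carrier_mat ?n ?n" for A B :: "complex mat"
    using that by (rule mult_carrier_mat)
  have adj: "mat_adjoint (one_plus (W * ?V)) = one_plus (mat_adjoint ?V) * one_plus (mat_adjoint W)"
    unfolding one_plus_adjoint[of "W * ?V"] mat_adjoint_mult[OF c(1,2)]
    using c by (intro one_plus_mult[of _ "Suc k" "Suc k" _ "Suc k"]) auto
  have in_eq: "one_plus (?V * X * mat_adjoint ?V) = one_plus ?V * one_plus X * one_plus (mat_adjoint ?V)"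
    using c by (subst one_plus_mult[of _ "Suc k" "Suc k" _ "Suc k"]) (auto simp: one_plus_mult[OF c(2,3)])
  have com: "one_plus ?V * ?H = ?H * one_plus ?V"
    by (rule house_pair_commute[symmetric]) (use unitaryD(1)[OF W'] in auto)
  \<comment> \<open>The commutation in right-nested form: it still applies after all products have
    been reassociated to the right.\<close>
  have com': "one_plus ?V * (?H * B) = ?H * (one_plus ?V * B)" if "B \<in> carrier_mat ?n ?n" for B
    using com assoc[OF oc(2) oc(6) that] assoc[OF oc(6) oc(2) that] by simp
  show ?thesis
    unfolding adj in_eq unfolding one_plus_mult[OF c(1,2)] one_plus_adjoint[of W]
    by (simp add: assoc mc oc com')
qed

text \<open>
  In the induction step, \<open>W\<close> may be replaced by \<open>W (1 \<oplus> W')\<close> with \<open>W'\<close> Haar. As \<open>1 \<oplus> 1 \<oplus> W'\<close> commutes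
  with the reflector, the induction hypothesis turns the inner Hessenberg matrix into a Haar matrix,
  which absorbs the adjoint of \<open>W\<close> on the right.
\<close>

theorem hess_law_conjugate:
  assumes \<kappa>: "\<And>i. sets (\<kappa> i) = sets borel" "\<And>i. prob_space (\<kappa> i)"
    and chi: "\<And>i. i \<in> {1..k} \<Longrightarrow> distr (\<kappa> i) borel (\<lambda>b. (cmod b)\<^sup>2) = chi2_complex i"
    and f: "f \<in> borel_measurable (unitary_borel (Suc k))"
  shows "(\<integral>\<^sup>+W. (\<integral>\<^sup>+X. f (one_plus W * X * mat_adjoint (one_plus W)) \<partial>hess_law \<kappa> k) \<partial>haar k)
    = (\<integral>\<^sup>+X. f X \<partial>haar (Suc k))"
  using chi f
proof (induction k arbitrary: f)
  case 0
  interpret H: prob_space "haar 0" by (rule prob_space_haar)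
  have "f (one_plus W * X * mat_adjoint (one_plus W)) = f X"
    if "W \<in> space (haar 0)" "X \<in> space (hess_law \<kappa> 0)" for W X
    using that unitary_group_0[of W] unitaryD(1)[of X "Suc 0"] by (simp add: space_haar space_hess_law)
  then have "(\<integral>\<^sup>+W. (\<integral>\<^sup>+X. f (one_plus W * X * mat_adjoint (one_plus W)) \<partial>hess_law \<kappa> 0) \<partial>haar 0)
      = (\<integral>\<^sup>+W. (\<integral>\<^sup>+X. f X \<partial>hess_law \<kappa> 0) \<partial>haar 0)"
    by (intro nn_integral_cong) simp
  then show ?case by (simp add: H.emeasure_space_1 hess_law_0)
next
  case (Suc k)
  note f [measurable] = Suc.prems(2)
  let ?n = "Suc (Suc k)"
  let ?R = "\<lambda>a b. house (pair_vec ?n (a, b))"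
  let ?C = "complex_normal 0 1" and ?B = "\<kappa> (Suc k)" and ?H = "haar (Suc k)" and ?L = "hess_law \<kappa> k"
  note [measurable_cong] = \<kappa>(1)
  interpret B: prob_space ?B by fact
  interpret C: prob_space ?C by (rule prob_space_complex_normal)
  interpret L: prob_space ?L by (rule prob_space_hess_law[OF \<kappa>])
  interpret H: prob_space ?H by (rule prob_space_haar)
  interpret H': prob_space "haar k" by (rule prob_space_haar)
  note pr = B.prob_space_axioms C.prob_space_axioms L.prob_space_axioms H.prob_space_axioms H'.prob_space_axioms
  define \<Phi> where "\<Phi> W a b X = f (one_plus W * (?R a b * one_plus X) * mat_adjoint (one_plus W))" for W a b X
  have \<Phi> [measurable (raw)]: "(\<lambda>x. \<Phi> (W x) (a x) (b x) (X x)) \<in> borel_measurable M"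
    if [measurable]: "W \<in> measurable M (unitary_borel (Suc k))" "a \<in> borel_measurable M" "b \<in> borel_measurable M"
       "X \<in> measurable M (unitary_borel (Suc k))"
    for W a b X and M :: "'x measure"
    unfolding \<Phi>_def by measurable
  define A where "A W = (\<integral>\<^sup>+a. (\<integral>\<^sup>+b. (\<integral>\<^sup>+X. \<Phi> W a b X \<partial>?L) \<partial>?B) \<partial>?C)" for W
  have A [measurable]: "A \<in> borel_measurable (unitary_borel (Suc k))"
    unfolding A_def by measurable
  have "(\<integral>\<^sup>+W. (\<integral>\<^sup>+X. f (one_plus W * X * mat_adjoint (one_plus W)) \<partial>hess_law \<kappa> (Suc k)) \<partial>?H)
      = (\<integral>\<^sup>+W. A W \<partial>?H)"
  proof (rule nn_integral_cong)
    fix W assume "W \<in> space ?H"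
    then have W: "one_plus W \<in> unitary_group ?n" by (auto simp: space_haar)
    have "(\<lambda>X. f (one_plus W * X * mat_adjoint (one_plus W))) \<in> borel_measurable (unitary_borel ?n)"
      by (rule measurable_compose[OF _ f], rule measurable_compose[OF measurable_mult_unitary(1)[OF W]
         measurable_mult_unitary(2)[OF unitary_adjoint[OF W]]])
    then show "(\<integral>\<^sup>+X. f (one_plus W * X * mat_adjoint (one_plus W)) \<partial>hess_law \<kappa> (Suc k)) = A W"
      unfolding A_def \<Phi>_def by (rule nn_integral_hess_law_Suc[OF \<kappa>])
  qed
  also have "\<dots> = (\<integral>\<^sup>+W'. (\<integral>\<^sup>+W. A W \<partial>?H) \<partial>haar k)"
    by (simp add: H'.emeasure_space_1)
  \<comment> \<open>Right invariance of the law of W, used separately for each fixed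
    \<open>W'\<close>.\<close>
  also have "\<dots> = (\<integral>\<^sup>+W'. (\<integral>\<^sup>+W. A (W * one_plus W') \<partial>?H) \<partial>haar k)"
    by (intro nn_integral_cong haar_measureD(5)[OF haar_measure_haar _ A, symmetric]) (auto simp: space_haar)
  also have "\<dots> = (\<integral>\<^sup>+W'. (\<integral>\<^sup>+W. (\<integral>\<^sup>+a. (\<integral>\<^sup>+b. (\<integral>\<^sup>+X.
      \<Phi> W a b (one_plus W' * X * mat_adjoint (one_plus W')) \<partial>?L) \<partial>?B) \<partial>?C) \<partial>?H) \<partial>haar k)"
    unfolding A_def \<Phi>_def
    by (intro nn_integral_cong arg_cong[where f = f] hess_conjugate_identity)
       (simp_all add: space_haar space_hess_law)
  \<comment> \<open>Fubini carries the integral over \<open>W'\<close> inwards, here past W and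
    afterwards past a and b, until it stands next to the integral over X as in the induction
    hypothesis.\<close>
  also have "\<dots> = (\<integral>\<^sup>+W. (\<integral>\<^sup>+W'. (\<integral>\<^sup>+a. (\<integral>\<^sup>+b. (\<integral>\<^sup>+X.
      \<Phi> W a b (one_plus W' * X * mat_adjoint (one_plus W')) \<partial>?L) \<partial>?B) \<partial>?C) \<partial>haar k) \<partial>?H)"
    by (intro nn_integral_swap pr) measurable
  also have "\<dots> = (\<integral>\<^sup>+W. (\<integral>\<^sup>+a. (\<integral>\<^sup>+b. (\<integral>\<^sup>+X. \<Phi> W a b X \<partial>?H) \<partial>?B) \<partial>?C) \<partial>?H)"
  proof (rule nn_integral_cong)
    fix W assume "W \<in> space ?H"
    then have [measurable]: "(\<lambda>_. W) \<in> measurable M (unitary_borel (Suc k))" for M :: "'x measure"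
      by (simp add: space_haar)
    have "(\<integral>\<^sup>+W'. (\<integral>\<^sup>+a. (\<integral>\<^sup>+b. (\<integral>\<^sup>+X. \<Phi> W a b (one_plus W' * X * mat_adjoint (one_plus W')) \<partial>?L) \<partial>?B) \<partial>?C) \<partial>haar k)
       = (\<integral>\<^sup>+a. (\<integral>\<^sup>+W'. (\<integral>\<^sup>+b. (\<integral>\<^sup>+X. \<Phi> W a b (one_plus W' * X * mat_adjoint (one_plus W')) \<partial>?L) \<partial>?B) \<partial>haar k) \<partial>?C)"
      by (intro nn_integral_swap pr) measurable
    also have "\<dots> = (\<integral>\<^sup>+a. (\<integral>\<^sup>+b. (\<integral>\<^sup>+W'. (\<integral>\<^sup>+X. \<Phi> W a b (one_plus W' * X * mat_adjoint (one_plus W')) \<partial>?L) \<partial>haar k) \<partial>?B) \<partial>?C)"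
      by (rule nn_integral_cong, intro nn_integral_swap pr) measurable
    \<comment> \<open>The induction hypothesis, applied to the function
      \<open>\<Phi> W a b\<close>.\<close>
    also have "\<dots> = (\<integral>\<^sup>+a. (\<integral>\<^sup>+b. (\<integral>\<^sup>+X. \<Phi> W a b X \<partial>?H) \<partial>?B) \<partial>?C)"
      by (intro nn_integral_cong Suc.IH Suc.prems(1)) (simp, measurable)
    finally show "(\<integral>\<^sup>+W'. (\<integral>\<^sup>+a. (\<integral>\<^sup>+b. (\<integral>\<^sup>+X. \<Phi> W a b (one_plus W' * X * mat_adjoint (one_plus W')) \<partial>?L) \<partial>?B) \<partial>?C) \<partial>haar k)
       = (\<integral>\<^sup>+a. (\<integral>\<^sup>+b. (\<integral>\<^sup>+X. \<Phi> W a b X \<partial>?H) \<partial>?B) \<partial>?C)" .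
  qed
  \<comment> \<open>X is now Haar: right invariance absorbs the adjoint of W, and
    \<open>haar_absorb\<close> moves the left factor \<open>one_plus W\<close> into the vector. The
    latter needs a nonzero pair (a, b), which holds for almost every a.\<close>
  also have "\<dots> = (\<integral>\<^sup>+W. (\<integral>\<^sup>+a. (\<integral>\<^sup>+b. (\<integral>\<^sup>+X. f (house (vCons a (Matrix.vec (Suc k) (\<lambda>i. b * W $$ (i, 0)))) * one_plus X)
      \<partial>?H) \<partial>?B) \<partial>?C) \<partial>?H)"
  proof (rule nn_integral_cong, rule nn_integral_cong_AE, use complex_normal_null in eventually_elim, rule nn_integral_cong)
    fix W a b assume W: "W \<in> space ?H" and a: "a \<noteq> (0 :: complex)"
    then have W: "W \<in> unitary_group (Suc k)" by (simp add: space_haar)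
    then have oW: "one_plus W \<in> unitary_group ?n" by auto
    note Wc = unitaryD(1)[OF W]
    have R: "?R a b \<in> carrier_mat ?n ?n" by auto
    have [measurable]: "(\<lambda>_. ?R a b) \<in> measurable (unitary_borel (Suc k)) (unitary_borel ?n)"
      "(\<lambda>_. one_plus W) \<in> measurable (unitary_borel (Suc k)) (unitary_borel ?n)"
      using oW by auto
    have "(\<integral>\<^sup>+X. \<Phi> W a b X \<partial>?H) = (\<integral>\<^sup>+X. f (one_plus W * ?R a b * one_plus (X * mat_adjoint W)) \<partial>?H)"
    proof (rule nn_integral_cong)
      fix X assume "X \<in> space ?H"
      then have X: "X \<in> carrier_mat (Suc k) (Suc k)" using unitaryD(1) by (simp add: space_haar)
      have "one_plus W * (?R a b * one_plus X) * one_plus (mat_adjoint W)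
          = one_plus W * (?R a b * one_plus X * one_plus (mat_adjoint W))"
        by (rule assoc_mult_mat[OF one_plus_carrier[OF Wc] mult_carrier_mat[OF R one_plus_carrier[OF X]]
             one_plus_carrier[OF mat_adjoint_carrier[OF Wc]]])
      also have "?R a b * one_plus X * one_plus (mat_adjoint W) = ?R a b * (one_plus X * one_plus (mat_adjoint W))"
        by (rule assoc_mult_mat[OF R one_plus_carrier[OF X] one_plus_carrier[OF mat_adjoint_carrier[OF Wc]]])
      also have "one_plus X * one_plus (mat_adjoint W) = one_plus (X * mat_adjoint W)"
        by (rule one_plus_mult[symmetric, OF X mat_adjoint_carrier[OF Wc]])
      also have "one_plus W * (?R a b * one_plus (X * mat_adjoint W)) = one_plus W * ?R a b * one_plus (X * mat_adjoint W)"
        by (rule assoc_mult_mat[symmetric, OF one_plus_carrier[OF Wc] R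
            one_plus_carrier[OF mult_carrier_mat[OF X mat_adjoint_carrier[OF Wc]]]])
      finally show "\<Phi> W a b X = f (one_plus W * ?R a b * one_plus (X * mat_adjoint W))"
        by (simp add: \<Phi>_def one_plus_adjoint)
    qed
    also have "\<dots> = (\<integral>\<^sup>+X. f (one_plus W * ?R a b * one_plus X) \<partial>?H)"
      by (rule haar_measureD(5)[OF haar_measure_haar unitary_adjoint[OF W], of "\<lambda>X. f (one_plus W * ?R a b * one_plus X)"])
         measurable
    also have "\<dots> = (\<integral>\<^sup>+X. f (house (one_plus W *\<^sub>v pair_vec ?n (a, b)) * one_plus X) \<partial>?H)"
      by (rule haar_absorb[OF haar_measure_haar f oW]) (use a in \<open>auto simp: norm2_pair_vec zero_prod_def\<close>)
    also have "one_plus W *\<^sub>v pair_vec ?n (a, b) = vCons a (Matrix.vec (Suc k) (\<lambda>i. b * W $$ (i, 0)))"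
    proof (rule eq_vecI)
      fix i assume "i < dim_vec (vCons a (Matrix.vec (Suc k) (\<lambda>i. b * W $$ (i, 0))))"
      then have i: "i < ?n" by simp
      have "(one_plus W *\<^sub>v pair_vec ?n (a, b)) $ i = (\<Sum>j = 0..<?n. one_plus W $$ (i, j) * pair_vec ?n (a, b) $ j)"
        using i Wc by (auto simp: scalar_prod_def simp del: sum.op_ivl_Suc intro!: sum.cong)
      also have "\<dots> = (\<Sum>j \<in> {0, 1}. one_plus W $$ (i, j) * pair_vec ?n (a, b) $ j)"
        by (intro sum.mono_neutral_right) (auto simp: pair_vec_def)
      also have "\<dots> = one_plus W $$ (i, 0) * a + one_plus W $$ (i, 1) * b"
        by (simp add: pair_vec_def)
      also have "\<dots> = vCons a (Matrix.vec (Suc k) (\<lambda>i. b * W $$ (i, 0))) $ i"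
        using i Wc by (auto simp: one_plus_index split: nat.split)
      finally show "(one_plus W *\<^sub>v pair_vec ?n (a, b)) $ i = vCons a (Matrix.vec (Suc k) (\<lambda>i. b * W $$ (i, 0))) $ i" .
    qed (use Wc in simp)
    finally show "(\<integral>\<^sup>+X. \<Phi> W a b X \<partial>?H)
       = (\<integral>\<^sup>+X. f (house (vCons a (Matrix.vec (Suc k) (\<lambda>i. b * W $$ (i, 0)))) * one_plus X) \<partial>?H)" .
  qed
  \<comment> \<open>W is brought next to b, so that the pair yields b times the first column of W, a
    Gaussian vector in polar form.\<close>
  also have "\<dots> = (\<integral>\<^sup>+a. (\<integral>\<^sup>+W. (\<integral>\<^sup>+b. (\<integral>\<^sup>+X. f (house (vCons a (Matrix.vec (Suc k) (\<lambda>i. b * W $$ (i, 0)))) * one_plus X)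
      \<partial>?H) \<partial>?B) \<partial>?H) \<partial>?C)"
  proof (intro nn_integral_swap pr)
    have [measurable]: "(\<lambda>p. house (vCons (snd (fst p)) (Matrix.vec (Suc k) (\<lambda>i. snd p * fst (fst p) $$ (i, 0)))))
        \<in> measurable ((?H \<Otimes>\<^sub>M ?C) \<Otimes>\<^sub>M ?B) (unitary_borel ?n)"
    proof (rule measurable_house)
      fix i assume i: "i < ?n"
      have e: "(\<lambda>p. fst (fst p) $$ (j, 0)) \<in> borel_measurable ((?H \<Otimes>\<^sub>M ?C) \<Otimes>\<^sub>M ?B)" if "j < Suc k" for j
        by (rule measurable_entry) (use that in auto)
      show "(\<lambda>p. vCons (snd (fst p)) (Matrix.vec (Suc k) (\<lambda>i. snd p * fst (fst p) $$ (i, 0))) $ i)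
          \<in> borel_measurable ((?H \<Otimes>\<^sub>M ?C) \<Otimes>\<^sub>M ?B)"
        using i e[of "i - 1"] by (cases i) auto
    qed auto
    have "(\<lambda>p. \<integral>\<^sup>+b. (\<integral>\<^sup>+X. f (house (vCons (snd p) (Matrix.vec (Suc k) (\<lambda>i. b * fst p $$ (i, 0)))) * one_plus X)
      \<partial>?H) \<partial>?B) \<in> borel_measurable (?H \<Otimes>\<^sub>M ?C)"
    proof (rule B.borel_measurable_nn_integral)
      have "(\<lambda>p. \<integral>\<^sup>+X. f (house (vCons (snd (fst p)) (Matrix.vec (Suc k) (\<lambda>i. snd p * fst (fst p) $$ (i, 0)))) * one_plus X) \<partial>?H)
          \<in> borel_measurable ((?H \<Otimes>\<^sub>M ?C) \<Otimes>\<^sub>M ?B)"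
        by measurable
      then show "(\<lambda>(p, b). \<integral>\<^sup>+X. f (house (vCons (snd p) (Matrix.vec (Suc k) (\<lambda>i. b * fst p $$ (i, 0)))) * one_plus X) \<partial>?H)
          \<in> borel_measurable ((?H \<Otimes>\<^sub>M ?C) \<Otimes>\<^sub>M ?B)"
        by (simp add: split_beta)
    qed
    then show "(\<lambda>(W, a). \<integral>\<^sup>+b. (\<integral>\<^sup>+X. f (house (vCons a (Matrix.vec (Suc k) (\<lambda>i. b * W $$ (i, 0)))) * one_plus X)
      \<partial>?H) \<partial>?B) \<in> borel_measurable (?H \<Otimes>\<^sub>M ?C)"
      by (simp add: split_beta)
  qed
  also have "\<dots> = (\<integral>\<^sup>+a. (\<integral>\<^sup>+x. (\<integral>\<^sup>+X. f (house (vCons a (Matrix.vec (Suc k) x)) * one_plus X) \<partial>?H) \<partial>gauss (Suc k)) \<partial>?C)"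
  proof (rule nn_integral_cong, rule nn_integral_gauss_polar[OF \<kappa>(2,1)])
    fix a
    have [measurable]: "(\<lambda>x. house (vCons a (Matrix.vec (Suc k) x))) \<in> measurable (Pi\<^sub>M {..<Suc k} (\<lambda>_. borel)) (unitary_borel ?n)"
    proof (rule measurable_house)
      fix i assume "i < ?n"
      then show "(\<lambda>x. vCons a (Matrix.vec (Suc k) x) $ i) \<in> borel_measurable (Pi\<^sub>M {..<Suc k} (\<lambda>_. borel))"
        by (cases i) auto
    qed auto
    show "(\<lambda>x. \<integral>\<^sup>+X. f (house (vCons a (Matrix.vec (Suc k) x)) * one_plus X) \<partial>?H)
        \<in> borel_measurable (Pi\<^sub>M {..<Suc k} (\<lambda>_. borel))"
      by measurable
  qed (use Suc.prems(1) in auto)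
  also have "\<dots> = (\<integral>\<^sup>+x. (\<integral>\<^sup>+X. f (house (Matrix.vec ?n x) * one_plus X) \<partial>?H) \<partial>gauss ?n)"
    by (rule nn_integral_gauss_Suc[symmetric, of "\<lambda>v. \<integral>\<^sup>+X. f (house v * one_plus X) \<partial>?H"]) measurable
  also have "\<dots> = (\<integral>\<^sup>+X. f X \<partial>haar ?n)"
    by (rule nn_integral_haar_Suc[OF f, symmetric])
  finally show ?case .
qed

section \<open>Measurability of eigenvalues\<close>

lemma coeff_mult_measurable:
  fixes P Q :: "'a \<Rightarrow> complex poly"
  assumes "\<And>i. (\<lambda>x. coeff (P x) i) \<in> borel_measurable M" "\<And>i. (\<lambda>x. coeff (Q x) i) \<in> borel_measurable M"
  shows "(\<lambda>x. coeff (P x * Q x) i) \<in> borel_measurable M"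
  unfolding coeff_mult by (intro borel_measurable_sum borel_measurable_times assms)

lemma coeff_prod_measurable:
  fixes P :: "'b \<Rightarrow> 'a \<Rightarrow> complex poly"
  assumes "\<And>j i. j \<in> A \<Longrightarrow> (\<lambda>x. coeff (P j x) i) \<in> borel_measurable M"
  shows "(\<lambda>x. coeff (\<Prod>j\<in>A. P j x) i) \<in> borel_measurable M"
  using assms
proof (induction A arbitrary: i rule: infinite_finite_induct)
  case (insert j A)
  then show ?case by (simp add: coeff_mult_measurable)
qed auto

text \<open>By the Leibniz formula the coefficients are sums of products of matrix entries.\<close>

lemma coeff_char_poly_measurable:
  "(\<lambda>U. coeff (char_poly U) i) \<in> borel_measurable (unitary_borel n)"
proof -
  let ?e = "\<lambda>U a b. (if a = b then [:0, 1:] else 0) + [:- U $$ (a, b):] :: complex poly"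
  have e: "(\<lambda>U. coeff (?e U a b) i) \<in> borel_measurable (unitary_borel n)" if "a < n" "b < n" for a b i
  proof -
    have "(\<lambda>U. U $$ (a, b)) \<in> borel_measurable (unitary_borel n)"
      by (rule measurable_entry[OF measurable_ident_sets]) (use that in auto)
    then show ?thesis by (cases i) (auto simp: coeff_pCons)
  qed
  have "(\<lambda>U. \<Sum>p | p permutes {0..<n}. coeff (signof p * (\<Prod>j = 0..<n. ?e U j (p j))) i)
      \<in> borel_measurable (unitary_borel n)"
    by (intro borel_measurable_sum coeff_mult_measurable coeff_prod_measurable e)
       (auto dest: permutes_in_image)
  also have "?this \<longleftrightarrow> ?thesis"
  proof (intro measurable_cong)
    fix U assume "U \<in> space (unitary_borel n)"
    then have U: "U \<in> carrier_mat n n" using unitaryD(1) by simp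
    have "char_poly U = (\<Sum>p | p permutes {0..<n}. signof p * (\<Prod>j = 0..<n. char_poly_matrix U $$ (j, p j)))"
      unfolding char_poly_def by (rule det_def'[OF char_poly_matrix_closed[OF U]])
    also have "\<dots> = (\<Sum>p | p permutes {0..<n}. signof p * (\<Prod>j = 0..<n. ?e U j (p j)))"
    proof (intro sum.cong prod.cong refl arg_cong2[where f = "(*)"])
      fix p j assume "p \<in> {p. p permutes {0..<n}}" "j \<in> {0..<n}"
      then have "j < n" "p j < n" by (auto dest: permutes_in_image)
      then show "char_poly_matrix U $$ (j, p j) = ?e U j (p j)"
        using U by (simp add: char_poly_matrix_def)
    qed
    finally show "(\<Sum>p | p permutes {0..<n}. coeff (signof p * (\<Prod>j = 0..<n. ?e U j (p j))) i) = coeff (char_poly U) i"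
      by (simp only: coeff_sum)
  qed
  finally show ?thesis .
qed

text \<open>
  A nonempty closed root set on the circle has a smallest angle; for fixed \<open>t\<close>, the arc up to
  \<open>t\<close> contains a root iff the polynomial takes arbitrarily small values at its rational points.
\<close>

lemma measurable_unimodular_root:
  fixes P :: "'a \<Rightarrow> complex poly"
  assumes meas: "\<And>z. (\<lambda>x. poly (P x) z) \<in> borel_measurable M"
    and ex: "\<And>x. x \<in> space M \<Longrightarrow> \<exists>z. poly (P x) z = 0 \<and> cmod z = 1"
  shows "\<exists>r \<in> borel_measurable M. \<forall>x \<in> space M. poly (P x) (r x) = 0"
proof -
  \<comment> \<open>Both endpoints are included to make the set closed; a root at 1 then has the
    angles 0 and 2 pi, and the infimum selects 0.\<close>
  define T where "T x = {s \<in> {0..2 * pi}. poly (P x) (cis s) = 0}" for x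
  define \<tau> where "\<tau> x = Inf (T x)" for x
  have bdd: "bdd_below (T x)" for x by (rule bdd_belowI[of _ 0]) (auto simp: T_def)
  have closed: "closed (T x)" for x
    unfolding T_def by (intro closed_Collect_conj[of "\<lambda>s. s \<in> {0..2 * pi}", simplified]
      continuous_closed_preimage_constant continuous_intros)
  have ne: "T x \<noteq> {}" if x: "x \<in> space M" for x
  proof -
    obtain z where z: "poly (P x) z = 0" "cmod z = 1" using ex[OF x] by blast
    have "z = cis (Arg2pi z)" using Arg2pi_eq[of z] z by (simp add: cis_conv_exp)
    then have "Arg2pi z \<in> T x"
      using z Arg2pi_ge_0[of z] Arg2pi_lt_2pi[of z] by (auto simp: T_def less_imp_le)
    then show ?thesis by blast
  qed
  have mem: "\<tau> x \<in> T x" if "x \<in> space M" for x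
    unfolding \<tau>_def by (rule closed_contains_Inf[OF ne[OF that] bdd closed])
  have le: "\<tau> x \<le> t \<longleftrightarrow> (\<exists>s \<in> T x. s \<le> t)" if "x \<in> space M" for x t
    using mem[OF that] cInf_lower[OF _ bdd, of _ x] unfolding \<tau>_def by (meson order_trans)
  have "\<tau> \<in> borel_measurable M"
  proof (rule borel_measurableI_le)
    fix t :: real
    show "{x \<in> space M. \<tau> x \<le> t} \<in> sets M"
    proof (cases "t < 0")
      case True
      then have "{x \<in> space M. \<tau> x \<le> t} = {}" using mem by (force simp: T_def)
      then show ?thesis by (simp only: sets.empty_sets)
    next
      case False
      \<comment> \<open>Angles beyond 2 pi contribute nothing. The arc up to b is parametrised as u
        b with u in [0, 1], so that the same countable set of rationals u serves every t.\<close>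
      define b where "b = min t (2 * pi)"
      have b: "b \<ge> 0" using False by (simp add: b_def)
      let ?Q = "\<rat> \<inter> {0..1 :: real}"
      have iff: "\<tau> x \<le> t \<longleftrightarrow> (\<forall>m :: nat. \<exists>q \<in> ?Q. cmod (poly (P x) (cis (q * b))) < 1 / Suc m)"
        if x: "x \<in> space M" for x
      proof -
        define g where "g u = cmod (poly (P x) (cis (u * b)))" for u
        have g: "continuous_on UNIV g" unfolding g_def cis_conv_exp by (intro continuous_intros)
        have 1: "\<tau> x \<le> t \<longleftrightarrow> (\<exists>u \<in> {0..1}. g u = 0)"
        proof
          assume "\<tau> x \<le> t"
          then obtain s where s: "s \<in> T x" "s \<le> t" using le[OF x] by blast
          then have "0 \<le> s" "s \<le> b" "poly (P x) (cis s) = 0" by (auto simp: T_def b_def)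
          \<comment> \<open>For b = 0 the witness s / b is 0 by convention, and s = 0 as well
            because 0 \<le> s \<le> b.\<close>
          then show "\<exists>u \<in> {0..1}. g u = 0"
            using b by (intro bexI[of _ "s / b"]) (cases "b = 0", auto simp: g_def divide_le_eq_1)
        next
          assume "\<exists>u \<in> {0..1}. g u = 0"
          then obtain u where u: "u \<in> {0..1}" "g u = 0" by blast
          then have "0 \<le> u * b" "u * b \<le> b" using b by (auto simp: mult_left_le_one_le)
          with u have "u * b \<in> T x" "u * b \<le> t" by (auto simp: T_def g_def b_def)
          then show "\<tau> x \<le> t" using le[OF x] by blast
        qed
        show ?thesis
          unfolding 1 g_def[symmetric]
        proof
          assume "\<exists>u \<in> {0..1}. g u = 0"
          then obtain u where u: "u \<in> {0..1}" "g u = 0" by blast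
          show "\<forall>m :: nat. \<exists>q \<in> ?Q. g q < 1 / Suc m"
          proof
            fix m :: nat
            have "isCont g u" using g by (simp add: continuous_on_eq_continuous_at)
            moreover have "1 / real (Suc m) > 0" by simp
            ultimately obtain d where d: "d > 0" "\<And>v. \<bar>v - u\<bar> < d \<Longrightarrow> \<bar>g v - g u\<bar> < 1 / Suc m"
              unfolding continuous_at_eps_delta dist_real_def by blast
            have "max 0 (u - d) < min 1 (u + d)" using u d(1) by auto
            then obtain q where q: "q \<in> \<rat>" "max 0 (u - d) < q" "q < min 1 (u + d)"
              using Rats_dense_in_real by blast
            then have "\<bar>q - u\<bar> < d" by auto
            from d(2)[OF this] u(2) have "g q < 1 / Suc m" by simp
            with q show "\<exists>q \<in> ?Q. g q < 1 / Suc m" by (intro bexI[of _ q]) auto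
          qed
        next
          \<comment> \<open>By compactness g attains its minimum on [0, 1]; being below every 1 / (m
            + 1), the minimum is 0.\<close>
          assume small: "\<forall>m :: nat. \<exists>q \<in> ?Q. g q < 1 / Suc m"
          obtain u where u: "u \<in> {0..1}" "\<And>v. v \<in> {0..1} \<Longrightarrow> g u \<le> g v"
            using continuous_attains_inf[of "{0..1 :: real}" g] continuous_on_subset[OF g, of "{0..1}"] by auto
          have "g u < 1 / Suc m" for m :: nat
            using small u(2) by (meson IntD2 le_less_trans)
          then have "\<not> g u > 0" using nat_approx_posE by (metis less_asym)
          then have "g u = 0" by (simp add: g_def)
          with u(1) show "\<exists>u \<in> {0..1}. g u = 0" by blast
        qed
      qed
      have Q: "countable ?Q" by (simp add: countable_rat)
      have "{x \<in> space M. \<tau> x \<le> t}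
          = {x \<in> space M. \<forall>m :: nat. \<exists>q \<in> ?Q. cmod (poly (P x) (cis (q * b))) < 1 / Suc m}"
        using iff by blast
      also have "\<dots> \<in> sets M"
        by (intro sets.sets_Collect_countable_All sets.sets_Collect_countable_Ex'[OF _ Q] borel_measurable_less
           borel_measurable_const measurable_compose[OF meas borel_measurable_norm])
      finally show ?thesis .
    qed
  qed
  moreover have "cis \<in> borel_measurable borel"
    by (intro borel_measurable_continuous_onI) (simp add: cis_conv_exp continuous_intros)
  ultimately have "(\<lambda>x. cis (\<tau> x)) \<in> borel_measurable M" by (rule measurable_compose)
  then show ?thesis
    using mem by (intro bexI[of _ "\<lambda>x. cis (\<tau> x)"]) (auto simp: T_def)
qed

text \<open>Deflation: divide by the linear factor of a measurably selected root and continue. The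
  quotient is monic of degree one less with roots still on the circle, and its coefficients have to
  be shown measurable.\<close>

lemma measurable_unimodular_roots:
  fixes P :: "'a \<Rightarrow> complex poly"
  assumes "\<And>i. (\<lambda>x. coeff (P x) i) \<in> borel_measurable M"
    and "\<And>x. x \<in> space M \<Longrightarrow> degree (P x) = n \<and> coeff (P x) n = 1"
    and "\<And>x z. x \<in> space M \<Longrightarrow> poly (P x) z = 0 \<Longrightarrow> cmod z = 1"
  shows "\<exists>e. (\<forall>i. e i \<in> borel_measurable M) \<and> (\<forall>x \<in> space M. proots (P x) = unordered_of n (\<lambda>i. e i x))"
  using assms
proof (induction n arbitrary: P)
  case 0
  have "P x = 1" if "x \<in> space M" for x
    using 0(2)[OF that] by (metis degree_0_id one_pCons of_nat_1)
  then show ?case by (intro exI[of _ "\<lambda>_ _. 0"]) (auto simp: unordered_of_def)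
next
  case (Suc n)
  note meas = Suc.prems(1)
  have pm: "(\<lambda>x. poly (P x) z) \<in> borel_measurable M" for z
  proof -
    have "(\<lambda>x. \<Sum>i\<le>Suc n. coeff (P x) i * z ^ i) \<in> borel_measurable M"
      by (intro borel_measurable_sum borel_measurable_times meas borel_measurable_const)
    also have "?this \<longleftrightarrow> ?thesis"
      using Suc.prems(2) by (intro measurable_cong) (simp add: poly_altdef)
    finally show ?thesis .
  qed
  have "\<exists>z. poly (P x) z = 0 \<and> cmod z = 1" if x: "x \<in> space M" for x
  proof -
    have "degree (P x) \<noteq> 0" using Suc.prems(2)[OF x] by simp
    then have "\<not> constant (poly (P x))" by (simp add: constant_degree)
    then show ?thesis using fundamental_theorem_of_algebra Suc.prems(3)[OF x] by blast
  qed
  from measurable_unimodular_root[OF pm this]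
  obtain r where r [measurable]: "r \<in> borel_measurable M" and root: "\<And>x. x \<in> space M \<Longrightarrow> poly (P x) (r x) = 0"
    by blast
  define Q where "Q x = synthetic_div (P x) (r x)" for x
  have PQ: "P x = [:- r x, 1:] * Q x" if "x \<in> space M" for x
    using synthetic_div_correct'[of "r x" "P x"] root[OF that] by (simp add: Q_def)
  have dQ: "degree (Q x) = n" if "x \<in> space M" for x
    using Suc.prems(2)[OF that] by (simp add: Q_def degree_synthetic_div)
  \<comment> \<open>Comparison of the coefficients of degree i + 1 in P = (X - r) Q.\<close>
  have cQ: "coeff (Q x) i = coeff (P x) (Suc i) + r x * coeff (Q x) (Suc i)" if "x \<in> space M" for x i
    using arg_cong[OF PQ[OF that], of "\<lambda>p. coeff p (Suc i)"] by simp
  have Q1: "coeff (Q x) n = 1" if "x \<in> space M" for x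
    using cQ[OF that, of n] Suc.prems(2)[OF that] dQ[OF that] by (simp add: coeff_eq_0)
  have mQ: "(\<lambda>x. coeff (Q x) i) \<in> borel_measurable M" for i
  proof -
    \<comment> \<open>The recursion runs downwards, written as induction on d = n + 1 - i; it starts
      at i = n + 1, where the coefficient of \<open>Q x\<close> vanishes.\<close>
    have low: "(\<lambda>x. coeff (Q x) i) \<in> borel_measurable M" if "i + d = Suc n" for i d
      using that
    proof (induction d arbitrary: i)
      case 0
      then have "coeff (Q x) i = 0" if "x \<in> space M" for x using dQ[OF that] by (simp add: coeff_eq_0)
      then have "(\<lambda>x. coeff (Q x) i) \<in> borel_measurable M \<longleftrightarrow> (\<lambda>x. 0 :: complex) \<in> borel_measurable M"
        by (rule measurable_cong)
      then show ?case by simp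
    next
      case (Suc d)
      then have "(\<lambda>x. coeff (P x) (Suc i) + r x * coeff (Q x) (Suc i)) \<in> borel_measurable M"
        by (intro borel_measurable_add borel_measurable_times meas r) auto
      also have "?this \<longleftrightarrow> ?case" by (rule measurable_cong) (rule cQ[symmetric])
      finally show ?case .
    qed
    have high: "(\<lambda>x. coeff (Q x) i) \<in> borel_measurable M" if "i > n"
    proof -
      have "coeff (Q x) i = 0" if "x \<in> space M" for x using dQ[OF that] \<open>i > n\<close> by (simp add: coeff_eq_0)
      then have "(\<lambda>x. coeff (Q x) i) \<in> borel_measurable M \<longleftrightarrow> (\<lambda>x. 0 :: complex) \<in> borel_measurable M"
        by (rule measurable_cong)
      then show ?thesis by simp
    qed
    show ?thesis
    proof (cases "i > n")
      case False
      then show ?thesis by (intro low[of i "Suc n - i"]) simp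
    qed (rule high)
  qed
  have unit: "cmod z = 1" if "x \<in> space M" "poly (Q x) z = 0" for x z
    using Suc.prems(3)[OF that(1), of z] PQ[OF that(1)] that(2) by simp
  have "\<exists>e. (\<forall>i. e i \<in> borel_measurable M) \<and> (\<forall>x \<in> space M. proots (Q x) = unordered_of n (\<lambda>i. e i x))"
    by (rule Suc.IH[OF mQ]) (simp add: dQ Q1, erule (1) unit)
  then obtain e where e: "\<And>i. e i \<in> borel_measurable M" "\<And>x. x \<in> space M \<Longrightarrow> proots (Q x) = unordered_of n (\<lambda>i. e i x)"
    by blast
  define e' where "e' i = (if i = Suc n then r else e i)" for i
  have "proots (P x) = unordered_of (Suc n) (\<lambda>i. e' i x)" if x: "x \<in> space M" for x
  proof -
    have "Q x \<noteq> 0" using Q1[OF x] by auto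
    then have "proots (P x) = proots [:- r x, 1:] + proots (Q x)"
      unfolding PQ[OF x] by (intro proots_mult) auto
    also have "\<dots> = add_mset (r x) (image_mset (\<lambda>i. e i x) (mset_set {1..n}))"
      by (simp add: e(2)[OF x] unordered_of_def)
    also have "image_mset (\<lambda>i. e i x) (mset_set {1..n}) = image_mset (\<lambda>i. e' i x) (mset_set {1..n})"
      by (rule image_mset_cong) (auto simp: e'_def)
    also have "{1..Suc n} = insert (Suc n) {1..n}" by auto
    then have "add_mset (r x) (image_mset (\<lambda>i. e' i x) (mset_set {1..n})) = unordered_of (Suc n) (\<lambda>i. e' i x)"
      by (simp add: unordered_of_def e'_def)
    finally show ?thesis .
  qed
  then show ?case using e(1) r by (intro exI[of _ e']) (auto simp: e'_def)
qed

section \<open>The spectrum as a measurable function on \<open>U(n)\<close>\<close>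

lemma measurable_unordered_of: "unordered_of n \<in> measurable (Pi\<^sub>M {1..n} (\<lambda>_. borel)) (unordered_tuples n)"
  by (rule measurableI) (auto simp: space_unordered_tuples sets_unordered_tuples unordered_of_def)

lemma unitary_eigenvalue:
  assumes U: "U \<in> unitary_group n" and z: "poly (char_poly U) z = 0"
  shows "cmod z = 1"
proof -
  note Uc = unitaryD(1)[OF U]
  obtain v where v: "v \<in> carrier_vec n" "v \<noteq> 0\<^sub>v n" "U *\<^sub>v v = z \<cdot>\<^sub>v v"
    using eigenvalue_root_char_poly[OF Uc] z Uc unfolding eigenvalue_def eigenvector_def by auto
  have "norm2_vec (z \<cdot>\<^sub>v v) = cmod z * norm2_vec v"
    by (simp add: norm2_vec_def norm_mult power_mult_distrib sum_distrib_left[symmetric] real_sqrt_mult)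
  then have "cmod z * norm2_vec v = norm2_vec v"
    using unitary_norm2_vec[OF U v(1)] v(3) by simp
  moreover have "norm2_vec v \<noteq> 0"
  proof
    assume "norm2_vec v = 0"
    then have "v = 0\<^sub>v n" using v(1) by (intro eq_vecI) (auto simp: norm2_vec_eq_0)
    with v(2) show False by simp
  qed
  ultimately show ?thesis by simp
qed

text \<open>The spectrum lies on the circle, so the roots can be enumerated measurably;
  \<open>unordered_of\<close> then forgets the enumeration.\<close>

lemma measurable_eigenvalues: "eigenvalues \<in> measurable (unitary_borel n) (unordered_tuples n)"
proof -
  have "\<exists>e. (\<forall>i. e i \<in> borel_measurable (unitary_borel n))
      \<and> (\<forall>U \<in> space (unitary_borel n). proots (char_poly U) = unordered_of n (\<lambda>i. e i U))"
    by (rule measurable_unimodular_roots)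
       (auto intro!: coeff_char_poly_measurable degree_monic_char_poly unitaryD unitary_eigenvalue
         dest: unitary_eigenvalue degree_monic_char_poly[OF unitaryD(1)])
  then obtain e where e: "\<And>i. e i \<in> borel_measurable (unitary_borel n)"
    "\<And>U. U \<in> space (unitary_borel n) \<Longrightarrow> proots (char_poly U) = unordered_of n (\<lambda>i. e i U)" by blast
  have "(\<lambda>U. \<lambda>i\<in>{1..n}. e i U) \<in> measurable (unitary_borel n) (Pi\<^sub>M {1..n} (\<lambda>_. borel))"
    by (intro measurable_restrict e)
  from measurable_compose[OF this measurable_unordered_of]
  have "(\<lambda>U. unordered_of n (\<lambda>i\<in>{1..n}. e i U)) \<in> measurable (unitary_borel n) (unordered_tuples n)" .
  also have "?this \<longleftrightarrow> ?thesis"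
  proof (rule measurable_cong)
    fix U assume U: "U \<in> space (unitary_borel n)"
    have "unordered_of n (\<lambda>i\<in>{1..n}. e i U) = unordered_of n (\<lambda>i. e i U)"
      unfolding unordered_of_def by (rule image_mset_cong) simp
    then show "unordered_of n (\<lambda>i\<in>{1..n}. e i U) = eigenvalues U"
      by (simp add: eigenvalues_def e(2)[OF U])
  qed
  finally show ?thesis .
qed

lemma eigenvalues_conjugate:
  assumes V: "V \<in> unitary_group n" and X: "X \<in> unitary_group n"
  shows "eigenvalues (V * X * mat_adjoint V) = eigenvalues X"
proof -
  note c = unitaryD(1)[OF V] unitaryD(1)[OF X] mat_adjoint_carrier[OF unitaryD(1)[OF V]]
  have "V * X * mat_adjoint V \<in> carrier_mat n n"
    by (rule mult_carrier_mat[OF mult_carrier_mat[OF c(1,2)] c(3)])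
  then have "similar_mat (V * X * mat_adjoint V) X"
    using c by (intro similar_matI[OF _ unitaryD(3)[OF V] unitaryD(2)[OF V] refl])
      (simp only: insert_subset empty_subsetI simp_thms)
  then show ?thesis by (simp add: eigenvalues_def char_poly_similar)
qed

section \<open>Laws of the eigenvalues, and the passage from random variables to their laws\<close>

lemma hess_law_eigenvalues:
  assumes \<kappa>: "\<And>i. sets (\<kappa> i) = sets borel" "\<And>i. prob_space (\<kappa> i)"
    and chi: "\<And>i. i \<in> {1..k} \<Longrightarrow> distr (\<kappa> i) borel (\<lambda>b. (cmod b)\<^sup>2) = chi2_complex i"
  shows "distr (hess_law \<kappa> k) (unordered_tuples (Suc k)) eigenvalues
    = distr (haar (Suc k)) (unordered_tuples (Suc k)) eigenvalues"
proof (rule measure_eqI)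
  interpret H: prob_space "haar k" by (rule prob_space_haar)
  let ?T = "unordered_tuples (Suc k)"
  have m: "eigenvalues \<in> measurable (hess_law \<kappa> k) ?T" "eigenvalues \<in> measurable (haar (Suc k)) ?T"
    using measurable_eigenvalues[of "Suc k"]
    by (simp_all add: measurable_cong_sets[OF sets_hess_law refl] measurable_cong_sets[OF sets_haar refl])
  fix A assume "A \<in> sets (distr (hess_law \<kappa> k) ?T eigenvalues)"
  then have A: "A \<in> sets ?T" by simp
  \<comment> \<open>f is a class function, so conjugating X by a random \<open>one_plus W\<close>
    and averaging does not change its integral.\<close>
  define f where "f X = (indicator A (eigenvalues X) :: ennreal)" for X
  have f: "f \<in> borel_measurable (unitary_borel (Suc k))"
    unfolding f_def by (rule measurable_compose[OF measurable_eigenvalues borel_measurable_indicator[OF A]])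
  have "emeasure (distr (hess_law \<kappa> k) ?T eigenvalues) A = (\<integral>\<^sup>+X. f X \<partial>hess_law \<kappa> k)"
    unfolding f_def using A m by (subst nn_integral_distr[symmetric, OF m(1)]) auto
  also have "\<dots> = (\<integral>\<^sup>+W. (\<integral>\<^sup>+X. f X \<partial>hess_law \<kappa> k) \<partial>haar k)"
    by (simp add: H.emeasure_space_1)
  also have "\<dots> = (\<integral>\<^sup>+W. (\<integral>\<^sup>+X. f (one_plus W * X * mat_adjoint (one_plus W)) \<partial>hess_law \<kappa> k) \<partial>haar k)"
    by (intro nn_integral_cong)
       (auto simp: f_def space_haar space_hess_law eigenvalues_conjugate[OF one_plus_unitary])
  also have "\<dots> = (\<integral>\<^sup>+X. f X \<partial>haar (Suc k))"
    by (rule hess_law_conjugate[OF \<kappa> chi f])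
  also have "\<dots> = emeasure (distr (haar (Suc k)) ?T eigenvalues) A"
    unfolding f_def using A m by (subst nn_integral_distr[symmetric, OF m(2)]) auto
  finally show "emeasure (distr (hess_law \<kappa> k) ?T eigenvalues) A = emeasure (distr (haar (Suc k)) ?T eigenvalues) A" .
qed simp

text \<open>The modulus of the square is the square of the modulus, and a sum of squares is its own
  modulus; the sign of b disappears.\<close>

lemma chi2_of_square:
  assumes b: "b \<in> borel_measurable M"
    and eq: "distr M borel (\<lambda>\<omega>. (b \<omega>)\<^sup>2) = distr (chi2_complex i) borel complex_of_real"
  shows "distr M borel (\<lambda>\<omega>. (cmod (b \<omega>))\<^sup>2) = chi2_complex i"
proof -
  let ?P = "Pi\<^sub>M {1..i} (\<lambda>_. complex_normal 0 1)" and ?S = "\<lambda>d. \<Sum>j = 1..i. (cmod (d j))\<^sup>2"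
  have S: "?S \<in> borel_measurable ?P" by measurable
  have "distr M borel (\<lambda>\<omega>. (cmod (b \<omega>))\<^sup>2) = distr M borel (cmod \<circ> (\<lambda>\<omega>. (b \<omega>)\<^sup>2))"
    by (simp add: o_def norm_power)
  also have "\<dots> = distr (distr M borel (\<lambda>\<omega>. (b \<omega>)\<^sup>2)) borel cmod"
    by (rule distr_distr[symmetric]) (use b in auto)
  also have "\<dots> = distr (chi2_complex i) borel (cmod \<circ> complex_of_real)"
    unfolding eq by (rule distr_distr) (auto simp: chi2_complex_def)
  also have "\<dots> = distr ?P borel ((cmod \<circ> complex_of_real) \<circ> ?S)"
    unfolding chi2_complex_def by (rule distr_distr[OF _ S]) auto
  also have "(cmod \<circ> complex_of_real) \<circ> ?S = ?S"
    by (auto simp: sum_nonneg simp del: of_real_sum)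
  finally show ?thesis by (simp add: chi2_complex_def)
qed

text \<open>The empty index set, which occurs for matrices of order 1, is treated separately: both
  sides are then the point mass on the only extensional function.\<close>

lemma (in prob_space) distr_PiM_indep:
  fixes X :: "'b \<Rightarrow> 'a \<Rightarrow> 'c"
  assumes I: "finite I" and ind: "indep_vars (\<lambda>_. N) X I"
  shows "distr M (Pi\<^sub>M I (\<lambda>_. N)) (\<lambda>\<omega>. \<lambda>i\<in>I. X i \<omega>) = Pi\<^sub>M I (\<lambda>i. distr M N (X i))"
proof (cases "I = {}")
  case True
  let ?u = "\<lambda>_ :: 'b. undefined :: 'c"
  have f: "(\<lambda>\<omega>. \<lambda>i\<in>{}. X i \<omega>) = (\<lambda>_. ?u)" by (simp add: restrict_def)
  show ?thesis
    unfolding True PiM_empty f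
  proof (rule measure_eqI)
    fix A assume "A \<in> sets (distr M (count_space {?u}) (\<lambda>_. ?u))"
    then have "A = {} \<or> A = {?u}" by auto
    then show "emeasure (distr M (count_space {?u}) (\<lambda>_. ?u)) A = emeasure (count_space {?u}) A"
      by (auto simp: emeasure_distr emeasure_space_1)
  qed simp
next
  case False
  have "random_variable N (X i)" if "i \<in> I" for i
    using ind that by (auto simp: indep_vars_def)
  then show ?thesis
    using indep_vars_iff_distr_eq_PiM'[OF False, where M' = "\<lambda>_. N" and X = X] ind by simp
qed

text \<open>Rectangles determine the product measure, and their preimages are intersections of
  events from the two independent sigma-algebras.\<close>

lemma (in prob_space) distr_pair_indep_set:
  assumes X: "random_variable S X" and Y: "random_variable T Y"
    and ind: "indep_set (sets (vimage_algebra (space M) X S)) (sets (vimage_algebra (space M) Y T))"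
  shows "distr M (S \<Otimes>\<^sub>M T) (\<lambda>\<omega>. (X \<omega>, Y \<omega>)) = distr M S X \<Otimes>\<^sub>M distr M T Y"
proof (rule pair_measure_eqI[symmetric])
  interpret X: prob_space "distr M S X" by (rule prob_space_distr[OF X])
  interpret Y: prob_space "distr M T Y" by (rule prob_space_distr[OF Y])
  show "sigma_finite_measure (distr M S X)" "sigma_finite_measure (distr M T Y)" ..
  note XY = measurable_Pair[OF X Y]
  fix A B assume "A \<in> sets (distr M S X)" "B \<in> sets (distr M T Y)"
  then have AB: "A \<in> sets S" "B \<in> sets T" by simp_all
  have pre: "X -` A \<inter> space M \<in> sets (vimage_algebra (space M) X S)"
    "Y -` B \<inter> space M \<in> sets (vimage_algebra (space M) Y T)"
    using AB by (auto intro!: in_vimage_algebra)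
  have "emeasure (distr M (S \<Otimes>\<^sub>M T) (\<lambda>\<omega>. (X \<omega>, Y \<omega>))) (A \<times> B)
      = emeasure M ((X -` A \<inter> space M) \<inter> (Y -` B \<inter> space M))"
    using AB by (subst emeasure_distr[OF XY]) (auto intro!: arg_cong[where f = "emeasure M"])
  also have "\<dots> = emeasure M (X -` A \<inter> space M) * emeasure M (Y -` B \<inter> space M)"
    using ind pre by (simp add: indep_sets2_eq emeasure_eq_measure ennreal_mult)
  finally show "emeasure (distr M S X) A * emeasure (distr M T Y) B
      = emeasure (distr M (S \<Otimes>\<^sub>M T) (\<lambda>\<omega>. (X \<omega>, Y \<omega>))) (A \<times> B)"
    using AB by (simp add: emeasure_distr[OF X] emeasure_distr[OF Y])
qed (simp cong: sets_pair_measure_cong)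

theorem theorem4p1:
  fixes n :: nat
    and M :: "'a measure" and N :: "'b measure"
    and \<alpha> \<beta> :: "nat \<Rightarrow> 'a \<Rightarrow> complex" and \<theta>n :: "'a \<Rightarrow> real"
    and H :: "'a \<Rightarrow> complex mat" and U :: "'b \<Rightarrow> complex mat"
  assumes n: "n \<ge> 1"
    and M: "prob_space M"
    and w_indep: "prob_space.indep_vars M (\<lambda>_. borel) (\<lambda>j \<omega>. (\<alpha> j \<omega>, \<beta> j \<omega>)) {1..n - 1}"
    and \<alpha>\<beta>_indep: "\<And>j. j \<in> {1..n - 1} \<Longrightarrow> prob_space.indep_var M borel (\<alpha> j) borel (\<beta> j)"
    and \<theta>n_meas: "\<theta>n \<in> borel_measurable M"
    and \<theta>n_indep: "prob_space.indep_set M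
          (sets (vimage_algebra (space M) \<theta>n borel))
          (sets (vimage_algebra (space M) (\<lambda>\<omega>. \<lambda>j \<in> {1..n - 1}. (\<alpha> j \<omega>, \<beta> j \<omega>))
             (Pi\<^sub>M {1..n - 1} (\<lambda>_. borel))))"
    and \<alpha>_distr: "\<And>j. j \<in> {1..n - 1} \<Longrightarrow> distr M borel (\<alpha> j) = complex_normal 0 1"
    and \<beta>_distr: "\<And>j. j \<in> {1..n - 1} \<Longrightarrow>
          distr M borel (\<lambda>\<omega>. (\<beta> j \<omega>)\<^sup>2) = distr (chi2_complex (n - j)) borel complex_of_real"
    and \<theta>n_distr: "distr M borel \<theta>n = uniform_measure lborel {-pi<..pi}"
    and H: "\<And>\<omega>. H \<omega> = hessenberg_product n (\<lambda>j. \<alpha> j \<omega>) (\<lambda>j. \<beta> j \<omega>) (\<theta>n \<omega>)"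
    and N: "prob_space N"
    and U: "haar_distributed n N U"
  shows "(\<forall>\<omega> \<in> space M. H \<omega> \<in> unitary_group n \<and> upper_hessenberg (H \<omega>)) \<and>
         (\<lambda>\<omega>. eigenvalues (H \<omega>)) \<in> measurable M (unordered_tuples n) \<and>
         (\<lambda>\<omega>. eigenvalues (U \<omega>)) \<in> measurable N (unordered_tuples n) \<and>
         joint_eigenvalue_distribution n M H = joint_eigenvalue_distribution n N U"
proof -
  interpret M: prob_space M by fact
  obtain k where k: "n = Suc k" using n by (cases n) auto
  then have k': "n - 1 = k" by simp
  let ?J = "{1..k}" and ?X = "\<lambda>j \<omega>. (\<alpha> j \<omega>, \<beta> j \<omega>)"
  let ?B = "\<lambda>_ :: nat. borel :: (complex \<times> complex) measure"
  define w where "w \<omega> = (\<lambda>j\<in>?J. ?X j \<omega>)" for \<omega>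
  \<comment> \<open>The numbering is reversed to that of \<open>hmat\<close>: index i refers to
    \<beta> at \<open>n - i\<close>, whose square has \<open>n - (n - i) = i\<close> degrees of
    freedom.\<close>
  define w' where "w' \<omega> = (\<lambda>i\<in>?J. w \<omega> (n - i))" for \<omega>
  note ind = \<alpha>\<beta>_indep[unfolded k'] and \<alpha>_distr' = \<alpha>_distr[unfolded k'] and \<beta>_distr' = \<beta>_distr[unfolded k']
  have flip: "n - i \<in> ?J" "n - (n - i) = i" if "i \<in> ?J" for i using that k by auto
  have Hh: "H \<omega> = hmat k (w' \<omega>) (\<theta>n \<omega>)" for \<omega>
    unfolding H k hessenberg_product_eq_hmat
    by (rule hmat_cong) (use flip in \<open>auto simp: w'_def w_def k\<close>)
  have ab: "\<alpha> j \<in> borel_measurable M" "\<beta> j \<in> borel_measurable M" if "j \<in> ?J" for j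
    using M.indep_var_rv1 M.indep_var_rv2 ind that by blast+
  have Xm: "?X j \<in> borel_measurable M" if "j \<in> ?J" for j
    using ab[OF that] by measurable
  have wm: "w \<in> measurable M (Pi\<^sub>M ?J ?B)"
    unfolding w_def by (intro measurable_restrict Xm)
  have rm: "(\<lambda>v. \<lambda>i\<in>?J. v (n - i)) \<in> measurable (Pi\<^sub>M ?J ?B) (Pi\<^sub>M ?J ?B)"
    by (intro measurable_restrict measurable_component_singleton flip)
  have w'm: "w' \<in> measurable M (Pi\<^sub>M ?J ?B)"
    unfolding w'_def by (rule measurable_compose[OF wm rm])
  \<comment> \<open>The point mass outside the index range is a dummy, so that every
    \<open>\<kappa> i\<close> is a Borel probability measure.\<close>
  define \<kappa> where "\<kappa> i = (if i \<in> ?J then distr M borel (\<beta> (n - i)) else return borel 0)" for i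
  have \<kappa>s: "sets (\<kappa> i) = sets borel" for i by (simp add: \<kappa>_def)
  have \<kappa>p: "prob_space (\<kappa> i)" for i
    using ab(2)[OF flip(1)] by (auto simp: \<kappa>_def intro!: M.prob_space_distr prob_space_return)
  have chi: "distr (\<kappa> i) borel (\<lambda>b. (cmod b)\<^sup>2) = chi2_complex i" if i: "i \<in> ?J" for i
  proof -
    have "distr (\<kappa> i) borel (\<lambda>b. (cmod b)\<^sup>2) = distr M borel (\<lambda>\<omega>. (cmod (\<beta> (n - i) \<omega>))\<^sup>2)"
      using i ab(2)[OF flip(1)[OF i]] by (simp add: \<kappa>_def distr_distr o_def)
    also have "\<dots> = chi2_complex i"
      by (rule chi2_of_square) (use ab(2)[OF flip(1)[OF i]] \<beta>_distr'[OF flip(1)[OF i]] flip(2)[OF i] in auto)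
    finally show ?thesis .
  qed
  let ?L = "\<lambda>j. distr M borel (?X j)"
  have L: "?L (n - i) = complex_normal 0 1 \<Otimes>\<^sub>M \<kappa> i" if i: "i \<in> ?J" for i
  proof -
    note j = flip(1)[OF i]
    have "M.indep_var borel (\<alpha> (n - i)) borel (\<beta> (n - i))" by (rule ind[OF j])
    then have "distr M borel (\<alpha> (n - i)) \<Otimes>\<^sub>M distr M borel (\<beta> (n - i)) = distr M (borel \<Otimes>\<^sub>M borel) (?X (n - i))"
      by (simp add: M.indep_var_distribution_eq)
    then show ?thesis using \<alpha>_distr'[OF j] i by (simp add: \<kappa>_def borel_prod)
  qed
  have Lp: "prob_space (?L j)" if "j \<in> ?J" for j
    by (rule M.prob_space_distr[OF Xm[OF that]])
  have "distr M (Pi\<^sub>M ?J ?B) w = Pi\<^sub>M ?J ?L"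
    unfolding w_def by (rule M.distr_PiM_indep) (use w_indep[unfolded k'] in simp_all)
  then have "distr M (Pi\<^sub>M ?J ?B) w' = distr (Pi\<^sub>M ?J ?L) (Pi\<^sub>M ?J ?B) (\<lambda>v. \<lambda>i\<in>?J. v (n - i))"
    using distr_distr[OF rm wm] by (simp add: w'_def[abs_def] o_def)
  also have "\<dots> = distr (Pi\<^sub>M ?J ?L) (Pi\<^sub>M ?J (\<lambda>i. ?L (n - i))) (\<lambda>v. \<lambda>i\<in>?J. v (n - i))"
    by (intro distr_cong refl sets_PiM_cong) auto
  also have "\<dots> = Pi\<^sub>M ?J (\<lambda>i. ?L (n - i))"
    by (rule distr_PiM_reindex[where M = ?L])
       (use Lp flip in \<open>auto intro!: inj_on_inverseI[of _ "\<lambda>i. n - i"]\<close>)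
  also have "\<dots> = Pi\<^sub>M ?J (\<lambda>i. complex_normal 0 1 \<Otimes>\<^sub>M \<kappa> i)"
    by (rule PiM_cong) (simp_all add: L)
  finally have w'd: "distr M (Pi\<^sub>M ?J ?B) w' = Pi\<^sub>M ?J (\<lambda>i. complex_normal 0 1 \<Otimes>\<^sub>M \<kappa> i)" (is "_ = ?K") .
  have "distr M (borel \<Otimes>\<^sub>M Pi\<^sub>M ?J ?B) (\<lambda>\<omega>. (\<theta>n \<omega>, w' \<omega>)) = distr M borel \<theta>n \<Otimes>\<^sub>M distr M (Pi\<^sub>M ?J ?B) w'"
  proof (rule M.distr_pair_indep_set[OF \<theta>n_meas w'm])
    \<comment> \<open>\<open>w'\<close> only permutes the coordinates of w, so its events are events
      of w and the independence of the last angle carries over.\<close>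
    have "sets (vimage_algebra (space M) w' (Pi\<^sub>M ?J ?B)) \<subseteq> sets (vimage_algebra (space M) w (Pi\<^sub>M ?J ?B))"
    proof
      fix S assume "S \<in> sets (vimage_algebra (space M) w' (Pi\<^sub>M ?J ?B))"
      then obtain A where A: "A \<in> sets (Pi\<^sub>M ?J ?B)" "S = w' -` A \<inter> space M"
        using measurable_space[OF w'm] by (subst (asm) sets_vimage_algebra2) auto
      have "S = w -` ((\<lambda>v. \<lambda>i\<in>?J. v (n - i)) -` A \<inter> space (Pi\<^sub>M ?J ?B)) \<inter> space M"
        using measurable_space[OF wm] by (auto simp: A(2) w'_def[abs_def])
      then show "S \<in> sets (vimage_algebra (space M) w (Pi\<^sub>M ?J ?B))"
        using in_vimage_algebra[OF measurable_sets[OF rm A(1)]] by simp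
    qed
    then show "M.indep_set (sets (vimage_algebra (space M) \<theta>n borel)) (sets (vimage_algebra (space M) w' (Pi\<^sub>M ?J ?B)))"
      using \<theta>n_indep[unfolded k'] unfolding M.indep_sets2_eq w_def[abs_def] by blast
  qed
  then have joint: "distr M (borel \<Otimes>\<^sub>M Pi\<^sub>M ?J ?B) (\<lambda>\<omega>. (\<theta>n \<omega>, w' \<omega>)) = uniform_angle \<Otimes>\<^sub>M ?K"
    unfolding w'd \<theta>n_distr uniform_angle_def .
  interpret K: prob_space ?K by (intro prob_space_PiM prob_space_normal_pair \<kappa>p)
  interpret A: prob_space uniform_angle by (rule prob_space_uniform_angle)
  interpret KA: pair_prob_space ?K uniform_angle ..
  let ?h = "\<lambda>(v, t). hmat k v t"
  have hm: "?h \<in> measurable (?K \<Otimes>\<^sub>M uniform_angle) (unitary_borel n)"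
    unfolding k by (rule measurable_hmat_PiM[OF \<kappa>s])
  have sK: "sets ?K = sets (Pi\<^sub>M ?J ?B)"
    by (intro sets_PiM_cong sets_normal_pair \<kappa>s) auto
  have hm': "(\<lambda>(t, v). hmat k v t) \<in> measurable (borel \<Otimes>\<^sub>M Pi\<^sub>M ?J ?B) (unitary_borel n)"
  proof -
    have "(\<lambda>(t, v). ?h (v, t)) \<in> measurable (uniform_angle \<Otimes>\<^sub>M ?K) (unitary_borel n)"
      using measurable_compose[OF measurable_pair_swap' hm] by (simp add: split_beta')
    then show ?thesis
      unfolding measurable_cong_sets[OF sets_pair_measure_cong[OF sets_uniform_angle sK] refl] by simp
  qed
  have pm: "(\<lambda>\<omega>. (\<theta>n \<omega>, w' \<omega>)) \<in> measurable M (borel \<Otimes>\<^sub>M Pi\<^sub>M ?J ?B)"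
    using \<theta>n_meas w'm by measurable
  have Hm: "H \<in> measurable M (unitary_borel n)"
    using measurable_compose[OF pm hm'] by (simp add: Hh[abs_def])
  have "distr M (unitary_borel n) H = distr (uniform_angle \<Otimes>\<^sub>M ?K) (unitary_borel n) (\<lambda>(t, v). hmat k v t)"
    unfolding joint[symmetric] distr_distr[OF hm' pm] by (simp add: Hh[abs_def] o_def)
  \<comment> \<open>The independence assumption lists the angle first, \<open>hess_law\<close> lists
    it last; the law is unchanged under the swap.\<close>
  also have "\<dots> = distr (distr (uniform_angle \<Otimes>\<^sub>M ?K) (?K \<Otimes>\<^sub>M uniform_angle) (\<lambda>(t, v). (v, t))) (unitary_borel n) ?h"
    by (subst distr_distr[OF hm]) (auto simp: o_def split_beta')
  also have "\<dots> = distr (?K \<Otimes>\<^sub>M uniform_angle) (unitary_borel n) ?h"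
    by (simp only: KA.distr_pair_swap[symmetric])
  also have "\<dots> = hess_law \<kappa> k" by (simp add: hess_law_def k)
  finally have Hd: "distr M (unitary_borel n) H = hess_law \<kappa> k" .
  have Um: "U \<in> measurable N (unitary_borel n)" and Ud: "distr N (unitary_borel n) U = haar n"
    using U haar_measure_unique[OF _ haar_measure_haar] by (auto simp: haar_distributed_def)
  note e = measurable_eigenvalues[of n]
  have "joint_eigenvalue_distribution n M H = distr (hess_law \<kappa> k) (unordered_tuples n) eigenvalues"
    unfolding joint_eigenvalue_distribution_def Hd[symmetric] distr_distr[OF e Hm] by (simp add: o_def)
  also have "\<dots> = distr (haar n) (unordered_tuples n) eigenvalues"
    unfolding k by (rule hess_law_eigenvalues[OF \<kappa>s \<kappa>p chi])
  also have "\<dots> = joint_eigenvalue_distribution n N U"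
    unfolding joint_eigenvalue_distribution_def Ud[symmetric] distr_distr[OF e Um] by (simp add: o_def)
  finally have "joint_eigenvalue_distribution n M H = joint_eigenvalue_distribution n N U" .
  moreover have "H \<omega> \<in> unitary_group n \<and> upper_hessenberg (H \<omega>)" for \<omega>
    unfolding Hh k using hmat_unitary hmat_upper_hessenberg by blast
  ultimately show ?thesis
    using measurable_compose[OF Hm e] measurable_compose[OF Um e] by blast
qed

end
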